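(* A commutative ring $R$ has no middle class if and only if there is a ring decomposition $R=S\oplus T$, where $S$ is a semisimple Artinian ring, and $T$ is zero or a local ring whose maximal ideal is minimal.
   Context: Rings are associative with identity and modules are unital. For $R$-modules $M,N$, $M$ is $N$-injective if every homomorphism from a submodule of $N$ to $M$ extends to a homomorphism $N\to M$. $M$ is poor if the only $R$-modules $N$ for which $M$ is $N$-injective are the semisimple ones. $R$ has no middle class if every $R$-module is either injective or poor. "The maximal ideal is minimal" means that it is a minimal nonzero ideal (i.e. a simple module). *)

theory Defs
  imports "HOL-Algebra.Algebra" "HOL-Library.Equipollence"
begin

text \<open>
  Modules are those of the locale \<^locale>\<open>module\<close> over a commutative ring. Its records carry
  multiplicative fields, which that locale and all definitions below ignore.
\<close>

definition module_hom_set ::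
  "('a, 'c) ring_scheme \<Rightarrow> ('a, 'm, 'd) module_scheme \<Rightarrow> ('a, 'n, 'e) module_scheme
    \<Rightarrow> ('m \<Rightarrow> 'n) set" where
  "module_hom_set R N M =
    {f \<in> carrier N \<rightarrow> carrier M.
       (\<forall>x \<in> carrier N. \<forall>y \<in> carrier N. f (x \<oplus>\<^bsub>N\<^esub> y) = f x \<oplus>\<^bsub>M\<^esub> f y) \<and>
       (\<forall>r \<in> carrier R. \<forall>x \<in> carrier N. f (r \<odot>\<^bsub>N\<^esub> x) = r \<odot>\<^bsub>M\<^esub> f x)}"

text \<open>\<open>relatively_injective R N M\<close>: the module \<open>M\<close> is \<open>N\<close>-injective.\<close>

definition relatively_injective ::
  "('a, 'c) ring_scheme \<Rightarrow> ('a, 'm, 'd) module_scheme \<Rightarrow> ('a, 'n, 'e) module_scheme \<Rightarrow> bool" where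
  "relatively_injective R N M \<longleftrightarrow>
    (\<forall>K f. submodule K R N \<longrightarrow> f \<in> module_hom_set R (N\<lparr>carrier := K\<rparr>) M \<longrightarrow>
       (\<exists>g \<in> module_hom_set R N M. \<forall>x \<in> K. g x = f x))"

definition simple_submodule ::
  "'m set \<Rightarrow> ('a, 'c) ring_scheme \<Rightarrow> ('a, 'm, 'd) module_scheme \<Rightarrow> bool" where
  "simple_submodule K R N \<longleftrightarrow>
    submodule K R N \<and> K \<noteq> {\<zero>\<^bsub>N\<^esub>} \<and>
    (\<forall>L. submodule L R N \<and> L \<subseteq> K \<longrightarrow> L = {\<zero>\<^bsub>N\<^esub>} \<or> L = K)"

text \<open>
  A module is semisimple if it is the sum of its simple submodules; the sum of a family of
  submodules is the smallest submodule containing all of them.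
\<close>

definition semisimple_module ::
  "('a, 'c) ring_scheme \<Rightarrow> ('a, 'm, 'd) module_scheme \<Rightarrow> bool" where
  "semisimple_module R N \<longleftrightarrow>
    carrier N = \<Inter>{H. submodule H R N \<and> (\<forall>K. simple_submodule K R N \<longrightarrow> K \<subseteq> H)}"

text \<open>
  A quantification over ``all modules'' ranges over all modules whose carrier is a subset of one
  type \<open>'m\<close>, which plays the role of the universe: the type of \<open>M\<close> in the next two
  definitions, the explicit argument in the third one.
\<close>

definition injective_module ::
  "('a, 'c) ring_scheme \<Rightarrow> ('a, 'm) module \<Rightarrow> bool" where
  "injective_module R M \<longleftrightarrow>
    (\<forall>N :: ('a, 'm) module. module R N \<longrightarrow> relatively_injective R N M)"

definition poor_module ::
  "('a, 'c) ring_scheme \<Rightarrow> ('a, 'm) module \<Rightarrow> bool" where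
  "poor_module R M \<longleftrightarrow>
    (\<forall>N :: ('a, 'm) module. module R N \<and> relatively_injective R N M \<longrightarrow> semisimple_module R N)"

definition no_middle_class ::
  "'m itself \<Rightarrow> ('a, 'c) ring_scheme \<Rightarrow> bool" where
  "no_middle_class _ R \<longleftrightarrow>
    (\<forall>M :: ('a, 'm) module. module R M \<longrightarrow> injective_module R M \<or> poor_module R M)"

text \<open>
  The type \<open>'m\<close> has at least \<open>max (2 ^ |R|) \<aleph>\<^sub>0\<close> elements. Then it contains a copy of every
  module of at most that size, which makes \<^const>\<open>no_middle_class\<close> independent of \<open>'m\<close>:
  injectivity of \<open>M\<close> is decided by \<open>N = R\<close> (Baer), poverty of \<open>M\<close> by the cyclic modules \<open>N\<close>,
  and if some module is neither injective nor poor, then closing a suitable small submodule of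
  it under extensions of homomorphisms from submodules of one cyclic module yields such a module
  of size at most \<open>max (2 ^ |R|) \<aleph>\<^sub>0\<close>. On a small type the notion would be degenerate
  (on a one-element type only zero modules exist).
\<close>

definition large_universe ::
  "'m itself \<Rightarrow> ('a, 'c) ring_scheme \<Rightarrow> bool" where
  "large_universe _ R \<longleftrightarrow>
    infinite (UNIV :: 'm set) \<and> lepoll (Pow (carrier R)) (UNIV :: 'm set)"

definition regular_module :: "('a, 'c) ring_scheme \<Rightarrow> ('a, 'a) module" where
  "regular_module R =
    \<lparr>carrier = carrier R, monoid.mult = monoid.mult R, one = one R, ring.zero = ring.zero R, ring.add = ring.add R, smult = monoid.mult R\<rparr>"

definition artinian_ring :: "('a, 'c) ring_scheme \<Rightarrow> bool" where
  "artinian_ring R \<longleftrightarrow>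
    (\<forall>I :: nat \<Rightarrow> 'a set. (\<forall>n. ideal (I n) R) \<and> (\<forall>n. I (Suc n) \<subseteq> I n) \<longrightarrow>
       (\<exists>n. \<forall>k \<ge> n. I k = I n))"

text \<open>As usual, the zero ring is semisimple Artinian.\<close>

definition semisimple_artinian_ring :: "('a, 'c) ring_scheme \<Rightarrow> bool" where
  "semisimple_artinian_ring R \<longleftrightarrow> semisimple_module R (regular_module R) \<and> artinian_ring R"

definition local_ring :: "('a, 'c) ring_scheme \<Rightarrow> bool" where
  "local_ring R \<longleftrightarrow> (\<exists>!m. maximalideal m R)"

definition minimal_ideal :: "'a set \<Rightarrow> ('a, 'c) ring_scheme \<Rightarrow> bool" where
  "minimal_ideal I R \<longleftrightarrow>
    ideal I R \<and> I \<noteq> {\<zero>\<^bsub>R\<^esub>} \<and> (\<forall>J. ideal J R \<and> J \<subseteq> I \<longrightarrow> J = {\<zero>\<^bsub>R\<^esub>} \<or> J = I)"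

end

theory Submission
  imports Defs
begin

text \<open>
  Suppose that \<open>R\<close> has no middle class. If \<open>x\<close> is not von Neumann regular, then \<open>xR + Ann(x)\<close> is a
  proper ideal, and the character module \<open>M\<close> of the additive group of \<open>R / xR\<close> is \<open>R / xR\<close>-injective
  but not injective: a character that is trivial on \<open>xR + Ann(x)\<close> and nontrivial at \<open>1\<close> defines a
  homomorphism \<open>xR \<rightarrow> M\<close> without an extension to \<open>R\<close>, since \<open>xM = 0\<close>. Hence \<open>R / xR\<close> is semisimple.
  Similarly, an ideal \<open>I\<close> with \<open>I \<inter> Ann(I) = 0\<close> is \<open>R / I\<close>-injective, which rules out infinite chains
  of idempotents. So, unless \<open>R\<close> is semisimple, there is a maximal idempotent \<open>f\<close> for which
  \<open>T = (1 - f)R\<close> is not semisimple, and \<open>T\<close> has no nontrivial idempotents. Thus an \<open>x \<in> T\<close> that is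
  neither zero nor a unit is not regular. Then \<open>x\<^sup>2 = 0\<close>: otherwise \<open>x\<^sup>2\<close> is not regular either, and
  semisimplicity of \<open>R / x\<^sup>2R\<close> gives \<open>x \<in> x\<^sup>2R\<close>. Semisimplicity of \<open>R / xR\<close> now puts every other
  nonunit of \<open>T\<close> into \<open>xR\<close>, and makes \<open>fR\<close> semisimple.

  Conversely, let \<open>e\<close> be the identity of \<open>T\<close> and \<open>z\<close> a generator of its maximal ideal. A module that
  is not semisimple is not annihilated by \<open>z\<close>, so it contains a copy of \<open>eR\<close>; a module injective
  relative to it is therefore injective relative to \<open>R\<close>, and hence injective by Baer's criterion.
\<close>

text \<open>The hypothesis speaks only about modules that fit into \<open>'m\<close>, so the test
  modules have to be small and explicit. Injective hulls would first have to be bounded. The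
  characters of \<open>R / xR\<close> with values in the roots of unity, a copy of Q/Z, form an
  injective module over the ring \<open>R / xR\<close>, hence one that is injective relative to
  \<open>R / xR\<close>; and they are few enough for \<open>large_universe\<close>. For an ideal
  \<open>I\<close> with \<open>I \<inter> Ann(I) = 0\<close>, relative injectivity has a cheaper
  cause: every homomorphism \<open>J / I \<rightarrow> I\<close> has its image in
  \<open>I \<inter> Ann(I)\<close>, so it is zero.

  Both implications meet in \<open>nearly_semisimple\<close>, a statement about one idempotent of
  \<open>R\<close>. Semisimplicity of \<open>R / I\<close> is used only through complements of
  ideals above \<open>I\<close>, so that the computations stay in \<open>R\<close>.

  The maximal idempotent is sought among those whose complement \<open>T\<close> is not semisimple:
  an idempotent \<open>g\<close> splitting \<open>T\<close> nontrivially would, by maximality, make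
  both \<open>gT\<close> and its complement in \<open>T\<close> semisimple, and then
  \<open>T\<close> as well.\<close>

section \<open>Homomorphisms, the regular module and Baer's criterion\<close>

lemma module_hom_setI:
  assumes "\<And>x. x \<in> carrier N \<Longrightarrow> f x \<in> carrier M"
    and "\<And>x y. \<lbrakk>x \<in> carrier N; y \<in> carrier N\<rbrakk> \<Longrightarrow> f (x \<oplus>\<^bsub>N\<^esub> y) = f x \<oplus>\<^bsub>M\<^esub> f y"
    and "\<And>r x. \<lbrakk>r \<in> carrier R; x \<in> carrier N\<rbrakk> \<Longrightarrow> f (r \<odot>\<^bsub>N\<^esub> x) = r \<odot>\<^bsub>M\<^esub> f x"
  shows "f \<in> module_hom_set R N M"
  using assms by (simp add: module_hom_set_def)

lemma module_hom_setD:
  assumes "f \<in> module_hom_set R N M"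
  shows "x \<in> carrier N \<Longrightarrow> f x \<in> carrier M"
    and "\<lbrakk>x \<in> carrier N; y \<in> carrier N\<rbrakk> \<Longrightarrow> f (x \<oplus>\<^bsub>N\<^esub> y) = f x \<oplus>\<^bsub>M\<^esub> f y"
    and "\<lbrakk>r \<in> carrier R; x \<in> carrier N\<rbrakk> \<Longrightarrow> f (r \<odot>\<^bsub>N\<^esub> x) = r \<odot>\<^bsub>M\<^esub> f x"
  using assms by (auto simp: module_hom_set_def)

lemma module_hom_set_zero:
  assumes "module R N" "module R M" "f \<in> module_hom_set R N M"
  shows "f \<zero>\<^bsub>N\<^esub> = \<zero>\<^bsub>M\<^esub>"
proof -
  interpret N: module R N by fact
  interpret M: module R M by fact
  have "f (\<zero>\<^bsub>R\<^esub> \<odot>\<^bsub>N\<^esub> \<zero>\<^bsub>N\<^esub>) = \<zero>\<^bsub>R\<^esub> \<odot>\<^bsub>M\<^esub> f \<zero>\<^bsub>N\<^esub>"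
    by (rule module_hom_setD(3)[OF assms(3)]) auto
  then show ?thesis using module_hom_setD(1)[OF assms(3) N.zero_closed] by simp
qed

lemma regular_module_simps [simp]:
  "carrier (regular_module R) = carrier R"
  "\<zero>\<^bsub>regular_module R\<^esub> = \<zero>\<^bsub>R\<^esub>"
  "x \<oplus>\<^bsub>regular_module R\<^esub> y = x \<oplus>\<^bsub>R\<^esub> y"
  "x \<odot>\<^bsub>regular_module R\<^esub> y = x \<otimes>\<^bsub>R\<^esub> y"
  by (simp_all add: regular_module_def)

lemma (in cring) regular_module_module: "module R (regular_module R)"
proof (rule moduleI)
  show "abelian_group (regular_module R)"
    by (rule abelian_groupI) (auto simp: a_ac intro: l_neg)
qed (auto simp: l_distr r_distr m_assoc cring_axioms)

lemma (in cring) submodule_regular_iff: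
  "submodule K R (regular_module R) \<longleftrightarrow> ideal K R"
proof
  interpret M: module R "regular_module R" by (rule regular_module_module)
  assume K: "submodule K R (regular_module R)"
  note * = M.submoduleE[OF K, simplified]
  have inv: "\<ominus>x \<in> K" if "x \<in> K" for x
    using *(4)[of "\<ominus>\<one>" x] *(1) that by (auto simp: l_minus)
  show "ideal K R"
  proof (rule idealI)
    show "subgroup K (add_monoid R)"
      using * inv by (intro add.subgroupI) auto
  qed (use *(1,4) ring_axioms in \<open>auto, metis m_comm subsetD\<close>)
next
  interpret M: module R "regular_module R" by (rule regular_module_module)
  assume "ideal K R"
  then interpret ideal K R .
  have "\<ominus>\<^bsub>regular_module R\<^esub> x \<in> K" if "x \<in> K" for x
  proof -
    have "\<ominus>\<^bsub>regular_module R\<^esub> x = \<ominus> x"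
      by (rule M.minus_equality) (use that a_subset in \<open>auto simp: l_neg\<close>)
    then show ?thesis using that by simp
  qed
  then show "submodule K R (regular_module R)"
    by (intro M.submoduleI) (use I_l_closed a_subset in auto)
qed

text \<open>Zorn's lemma on the graphs of extensions of \<open>f\<close>, i.e. on additive relations.\<close>

theorem Baer_criterion:
  assumes "module R M" "module R N" and inj: "relatively_injective R (regular_module R) M"
  shows "relatively_injective R N M"
  unfolding relatively_injective_def
proof (intro allI impI)
  interpret R: cring R using assms(1) by (simp add: module_def)
  interpret M: module R M by fact
  interpret N: module R N by fact
  fix K f
  assume K: "submodule K R N" and f: "f \<in> module_hom_set R (N\<lparr>carrier := K\<rparr>) M"
  have K': "module R (N\<lparr>carrier := K\<rparr>)"
    by (rule submodule.submodule_is_module[OF K \<open>module R N\<close>])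
  note KE = N.submoduleE[OF K] and fD = module_hom_setD[OF f, simplified]
  have f0: "f \<zero>\<^bsub>N\<^esub> = \<zero>\<^bsub>M\<^esub>" using module_hom_set_zero[OF K' \<open>module R M\<close> f] by simp
  have K0: "\<zero>\<^bsub>N\<^esub> \<in> K" using KE(2-5) KE(1) N.r_neg by (metis all_not_in_conv subsetD)
  \<comment> \<open>Single-valuedness is demanded only over zero: the relations are closed under
    addition and, by the scalar \<open>-1\<close>, under negation, so two values over one point
    differ by a value over zero. In this form the condition passes to unions and is easy to check
    for an enlarged relation.\<close>
  define \<A> where "\<A> = {G. G \<subseteq> carrier N \<times> carrier M \<and> (\<forall>x\<in>K. (x, f x) \<in> G) \<and>
    (\<forall>x y x' y'. (x,y) \<in> G \<longrightarrow> (x',y') \<in> G \<longrightarrow> (x \<oplus>\<^bsub>N\<^esub> x', y \<oplus>\<^bsub>M\<^esub> y') \<in> G) \<and>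
    (\<forall>r\<in>carrier R. \<forall>x y. (x,y) \<in> G \<longrightarrow> (r \<odot>\<^bsub>N\<^esub> x, r \<odot>\<^bsub>M\<^esub> y) \<in> G) \<and>
    (\<forall>y. (\<zero>\<^bsub>N\<^esub>, y) \<in> G \<longrightarrow> y = \<zero>\<^bsub>M\<^esub>)}"
  have "\<exists>G\<in>\<A>. \<forall>H\<in>\<A>. G \<subseteq> H \<longrightarrow> H = G"
  proof (rule subset_Zorn_nonempty)
    have "(\<lambda>x. (x, f x)) ` K \<in> \<A>"
      using KE fD f0 by (auto simp: \<A>_def)
    then show "\<A> \<noteq> {}" by blast
  next
    fix \<C> assume C: "\<C> \<noteq> {}" "subset.chain \<A> \<C>"
    have CA: "G \<in> \<A>" if "G \<in> \<C>" for G using C that by (auto simp: subset_chain_def)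
    have two: "\<exists>G\<in>\<C>. p \<in> G \<and> q \<in> G" if "p \<in> \<Union>\<C>" "q \<in> \<Union>\<C>" for p q
      using that C(2) unfolding subset_chain_def by (meson UnionE subsetD)
    show "\<Union>\<C> \<in> \<A>"
      unfolding \<A>_def mem_Collect_eq
    proof (intro conjI allI impI ballI)
      show "\<Union>\<C> \<subseteq> carrier N \<times> carrier M" using CA unfolding \<A>_def by blast
      show "(x, f x) \<in> \<Union>\<C>" if "x \<in> K" for x
        using C(1) CA that by (fastforce simp: \<A>_def)
      show "(x \<oplus>\<^bsub>N\<^esub> x', y \<oplus>\<^bsub>M\<^esub> y') \<in> \<Union>\<C>" if *: "(x,y) \<in> \<Union>\<C>" "(x',y') \<in> \<Union>\<C>" for x y x' y'
      proof -
        obtain G where "G \<in> \<C>" "(x,y) \<in> G" "(x',y') \<in> G" using two[OF *] by blast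
        then show ?thesis using CA[of G] unfolding \<A>_def by blast
      qed
      show "(r \<odot>\<^bsub>N\<^esub> x, r \<odot>\<^bsub>M\<^esub> y) \<in> \<Union>\<C>" if "r \<in> carrier R" "(x,y) \<in> \<Union>\<C>" for r x y
        using CA that unfolding \<A>_def by blast
      show "y = \<zero>\<^bsub>M\<^esub>" if "(\<zero>\<^bsub>N\<^esub>, y) \<in> \<Union>\<C>" for y
        using CA that unfolding \<A>_def by blast
    qed
  qed
  then obtain G where "G \<in> \<A>" and max: "\<And>H. \<lbrakk>H \<in> \<A>; G \<subseteq> H\<rbrakk> \<Longrightarrow> H = G" by blast
  then have Gsub: "G \<subseteq> carrier N \<times> carrier M" and Gf: "\<And>x. x \<in> K \<Longrightarrow> (x, f x) \<in> G"
    and Gadd: "\<And>x y x' y'. (x,y) \<in> G \<Longrightarrow> (x',y') \<in> G \<Longrightarrow> (x \<oplus>\<^bsub>N\<^esub> x', y \<oplus>\<^bsub>M\<^esub> y') \<in> G"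
    and Gsm: "\<And>r x y. r \<in> carrier R \<Longrightarrow> (x,y) \<in> G \<Longrightarrow> (r \<odot>\<^bsub>N\<^esub> x, r \<odot>\<^bsub>M\<^esub> y) \<in> G"
    and G0: "\<And>y. (\<zero>\<^bsub>N\<^esub>, y) \<in> G \<Longrightarrow> y = \<zero>\<^bsub>M\<^esub>"
    unfolding \<A>_def by blast+
  have Gcl: "x \<in> carrier N" "y \<in> carrier M" if "(x,y) \<in> G" for x y using Gsub that by auto
  have Gneg: "(\<ominus>\<^bsub>N\<^esub> x, \<ominus>\<^bsub>M\<^esub> y) \<in> G" if "(x,y) \<in> G" for x y
    using Gsm[OF R.a_inv_closed[OF R.one_closed] that] Gcl[OF that]
    by (simp add: N.smult_l_minus M.smult_l_minus)
  have Guniq: "y = y'" if "(x,y) \<in> G" "(x,y') \<in> G" for x y y'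
    using G0[of "y \<oplus>\<^bsub>M\<^esub> \<ominus>\<^bsub>M\<^esub> y'"] Gadd[OF that(1) Gneg[OF that(2)]] Gcl[OF that(1)] Gcl[OF that(2)]
    by (metis M.minus_equality M.minus_minus M.add.inv_closed N.r_neg)
  have total: "\<exists>y. (n,y) \<in> G" if n: "n \<in> carrier N" for n
  proof -
    \<comment> \<open>\<open>J\<close> collects the scalars that carry \<open>n\<close> into the
      domain of \<open>G\<close>, and \<open>h\<close> is the value that \<open>G\<close> forces at
      \<open>r n\<close>. The hypothesis extends \<open>h\<close> to \<open>R\<close>, and the
      extended map prescribes the values on \<open>R n\<close>.\<close>
    define J where "J = {r \<in> carrier R. \<exists>y. (r \<odot>\<^bsub>N\<^esub> n, y) \<in> G}"
    define h where "h r = (SOME y. (r \<odot>\<^bsub>N\<^esub> n, y) \<in> G)" for r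
    have h: "(r \<odot>\<^bsub>N\<^esub> n, h r) \<in> G" if "r \<in> J" for r
      using that unfolding J_def h_def by (auto intro: someI)
    have h_eq: "h r = y" if "(r \<odot>\<^bsub>N\<^esub> n, y) \<in> G" for r y
      using that Guniq unfolding h_def by blast
    interpret Reg: module R "regular_module R" by (rule R.regular_module_module)
    have J: "ideal J R"
    proof (rule idealI[OF R.ring_axioms])
      show "subgroup J (add_monoid R)"
      proof (rule R.add.subgroupI)
        show "J \<noteq> {}" using Gf[OF K0] n by (auto simp: J_def intro!: exI[of _ "\<zero>\<^bsub>R\<^esub>"])
      qed (use Gadd Gneg n in \<open>auto simp: J_def N.smult_l_distr N.smult_l_minus a_inv_def[symmetric]; blast\<close>)+
    qed (use Gsm n in \<open>auto simp: J_def N.smult_assoc1 R.m_comm; metis N.smult_assoc1 R.m_comm\<close>)+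
    then have subJ: "submodule J R (regular_module R)" by (simp add: R.submodule_regular_iff)
    have JR: "J \<subseteq> carrier R" by (auto simp: J_def)
    have "h \<in> module_hom_set R (regular_module R\<lparr>carrier := J\<rparr>) M"
    proof (rule module_hom_setI)
      fix x assume "x \<in> carrier (regular_module R\<lparr>carrier := J\<rparr>)"
      then show "h x \<in> carrier M" using Gcl(2)[OF h] by simp
    next
      fix x y assume "x \<in> carrier (regular_module R\<lparr>carrier := J\<rparr>)" "y \<in> carrier (regular_module R\<lparr>carrier := J\<rparr>)"
      then have "x \<in> J" "y \<in> J" by auto
      then show "h (x \<oplus>\<^bsub>regular_module R\<lparr>carrier := J\<rparr>\<^esub> y) = h x \<oplus>\<^bsub>M\<^esub> h y"
        using Gadd[OF h h] JR n by (auto intro!: h_eq simp: N.smult_l_distr subset_iff)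
    next
      fix r x assume "r \<in> carrier R" "x \<in> carrier (regular_module R\<lparr>carrier := J\<rparr>)"
      then show "h (r \<odot>\<^bsub>regular_module R\<lparr>carrier := J\<rparr>\<^esub> x) = r \<odot>\<^bsub>M\<^esub> h x"
        using Gsm[OF _ h] JR n by (auto intro!: h_eq simp: N.smult_assoc1 subset_iff)
    qed
    then obtain g where g: "g \<in> module_hom_set R (regular_module R) M" and gh: "\<And>r. r \<in> J \<Longrightarrow> g r = h r"
      using inj subJ unfolding relatively_injective_def by blast
    note gD = module_hom_setD[OF g, simplified]
    define G' where "G' = {(x \<oplus>\<^bsub>N\<^esub> r \<odot>\<^bsub>N\<^esub> n, y \<oplus>\<^bsub>M\<^esub> g r) | x y r. (x,y) \<in> G \<and> r \<in> carrier R}"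
    have g0: "g \<zero>\<^bsub>R\<^esub> = \<zero>\<^bsub>M\<^esub>"
      using module_hom_set_zero[OF Reg.module_axioms \<open>module R M\<close> g] by simp
    have GG': "G \<subseteq> G'"
    proof clarify
      fix x y assume "(x,y) \<in> G"
      then show "(x,y) \<in> G'"
        using Gcl[of x y] g0 n unfolding G'_def by (auto intro!: exI[of _ x] exI[of _ y] exI[of _ "\<zero>\<^bsub>R\<^esub>"])
    qed
    have "G' \<in> \<A>"
      unfolding \<A>_def mem_Collect_eq
    proof (intro conjI allI impI ballI)
      show "G' \<subseteq> carrier N \<times> carrier M" using Gcl gD(1) n by (auto simp: G'_def)
      show "(x, f x) \<in> G'" if "x \<in> K" for x using that Gf GG' by blast
      fix a b assume "(a,b) \<in> G'"
      then obtain x y r where 1: "a = x \<oplus>\<^bsub>N\<^esub> r \<odot>\<^bsub>N\<^esub> n" "b = y \<oplus>\<^bsub>M\<^esub> g r" "(x,y) \<in> G" "r \<in> carrier R"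
        by (auto simp: G'_def)
      note cl = Gcl[OF 1(3)] 1(4) n gD(1)[OF 1(4)]
      {
        fix a' b' assume "(a',b') \<in> G'"
        then obtain x' y' r' where 2: "a' = x' \<oplus>\<^bsub>N\<^esub> r' \<odot>\<^bsub>N\<^esub> n" "b' = y' \<oplus>\<^bsub>M\<^esub> g r'" "(x',y') \<in> G" "r' \<in> carrier R"
          by (auto simp: G'_def)
        note cl' = Gcl[OF 2(3)] 2(4) gD(1)[OF 2(4)]
        have "a \<oplus>\<^bsub>N\<^esub> a' = (x \<oplus>\<^bsub>N\<^esub> x') \<oplus>\<^bsub>N\<^esub> (r \<oplus>\<^bsub>R\<^esub> r') \<odot>\<^bsub>N\<^esub> n"
          using cl cl' by (simp add: 1 2 N.smult_l_distr N.a_ac)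
        moreover have "b \<oplus>\<^bsub>M\<^esub> b' = (y \<oplus>\<^bsub>M\<^esub> y') \<oplus>\<^bsub>M\<^esub> g (r \<oplus>\<^bsub>R\<^esub> r')"
          using cl cl' by (simp add: 1 2 gD M.a_ac)
        ultimately show "(a \<oplus>\<^bsub>N\<^esub> a', b \<oplus>\<^bsub>M\<^esub> b') \<in> G'"
          using Gadd[OF 1(3) 2(3)] 1(4) 2(4) unfolding G'_def by blast
      }
      {
        fix s assume s: "s \<in> carrier R"
        have "s \<odot>\<^bsub>N\<^esub> a = s \<odot>\<^bsub>N\<^esub> x \<oplus>\<^bsub>N\<^esub> (s \<otimes>\<^bsub>R\<^esub> r) \<odot>\<^bsub>N\<^esub> n" "s \<odot>\<^bsub>M\<^esub> b = s \<odot>\<^bsub>M\<^esub> y \<oplus>\<^bsub>M\<^esub> g (s \<otimes>\<^bsub>R\<^esub> r)"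
          using cl s by (simp_all add: 1 N.smult_r_distr M.smult_r_distr N.smult_assoc1 gD)
        then show "(s \<odot>\<^bsub>N\<^esub> a, s \<odot>\<^bsub>M\<^esub> b) \<in> G'"
          using Gsm[OF s 1(3)] 1(4) s unfolding G'_def by blast
      }
    next
      fix b assume "(\<zero>\<^bsub>N\<^esub>,b) \<in> G'"
      then obtain x y r where 1: "\<zero>\<^bsub>N\<^esub> = x \<oplus>\<^bsub>N\<^esub> r \<odot>\<^bsub>N\<^esub> n" "b = y \<oplus>\<^bsub>M\<^esub> g r" "(x,y) \<in> G" "r \<in> carrier R"
        by (auto simp: G'_def)
      \<comment> \<open>Here old and new values must agree: \<open>r n = - x\<close> lies in the
        domain of \<open>G\<close>, so \<open>r\<close> lies in \<open>J\<close>, where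
        \<open>g\<close> is the value prescribed by \<open>G\<close>.\<close>
      have "r \<odot>\<^bsub>N\<^esub> n = \<ominus>\<^bsub>N\<^esub> x"
        using 1 Gcl[OF 1(3)] n by (metis N.a_comm N.minus_equality N.smult_closed)
      then have rG: "(r \<odot>\<^bsub>N\<^esub> n, \<ominus>\<^bsub>M\<^esub> y) \<in> G" using Gneg[OF 1(3)] by simp
      then have "r \<in> J" using 1(4) by (auto simp: J_def)
      then have "g r = \<ominus>\<^bsub>M\<^esub> y" using gh h_eq[OF rG] by simp
      then show "b = \<zero>\<^bsub>M\<^esub>" using 1 Gcl[OF 1(3)] by (simp add: M.r_neg)
    qed
    then have "G' = G" using max GG' by blast
    moreover have "(\<zero>\<^bsub>N\<^esub> \<oplus>\<^bsub>N\<^esub> \<one>\<^bsub>R\<^esub> \<odot>\<^bsub>N\<^esub> n, \<zero>\<^bsub>M\<^esub> \<oplus>\<^bsub>M\<^esub> g \<one>\<^bsub>R\<^esub>) \<in> G'"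
      using Gf[OF K0] f0 unfolding G'_def by auto
    ultimately show ?thesis using n by auto
  qed
  define g where "g x = (SOME y. (x,y) \<in> G)" for x
  have gG: "(x, g x) \<in> G" if "x \<in> carrier N" for x
    using total[OF that] unfolding g_def by (auto intro: someI)
  show "\<exists>g\<in>module_hom_set R N M. \<forall>x\<in>K. g x = f x"
  proof (intro bexI ballI)
    show "g x = f x" if "x \<in> K" for x using Guniq[OF gG Gf] that KE(1) by blast
    show "g \<in> module_hom_set R N M"
    proof (rule module_hom_setI)
      show "g x \<in> carrier M" if "x \<in> carrier N" for x using Gcl gG that by blast
      show "g (x \<oplus>\<^bsub>N\<^esub> y) = g x \<oplus>\<^bsub>M\<^esub> g y" if "x \<in> carrier N" "y \<in> carrier N" for x y
        by (rule Guniq[OF gG Gadd[OF gG gG]]) (use that in auto)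
      show "g (r \<odot>\<^bsub>N\<^esub> x) = r \<odot>\<^bsub>M\<^esub> g x" if "r \<in> carrier R" "x \<in> carrier N" for r x
        by (rule Guniq[OF gG Gsm[OF _ gG]]) (use that in auto)
    qed
  qed
qed


subsection \<open>Complements and semisimplicity\<close>

text \<open>The form of semisimplicity that is carried along isomorphisms and pulled back from
  quotients of \<open>R\<close>. Whatever is extracted from a semisimple module below is extracted
  as a complement.\<close>

definition complemented_module ::
  "('a, 'c) ring_scheme \<Rightarrow> ('a, 'm, 'd) module_scheme \<Rightarrow> bool" where
  "complemented_module R N \<longleftrightarrow> (\<forall>K. submodule K R N \<longrightarrow>
     (\<exists>L. submodule L R N \<and> K \<inter> L = {\<zero>\<^bsub>N\<^esub>} \<and> (\<forall>x\<in>carrier N. \<exists>k\<in>K. \<exists>l\<in>L. x = k \<oplus>\<^bsub>N\<^esub> l)))"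

context module
begin

lemma submodule_zero: "submodule H R M \<Longrightarrow> \<zero>\<^bsub>M\<^esub> \<in> H"
  using subgroup.one_closed[OF submodule.axioms(1)] by fastforce

lemma submodule_Int:
  assumes "submodule H R M" "submodule K R M"
  shows "submodule (H \<inter> K) R M"
  using submoduleE[OF assms(1)] submoduleE[OF assms(2)] submodule_zero assms
  by (intro submoduleI) auto

lemma submodule_sum:
  assumes H: "submodule H R M" and K: "submodule K R M"
  shows "submodule {h \<oplus>\<^bsub>M\<^esub> k | h k. h \<in> H \<and> k \<in> K} R M"
proof (rule submoduleI)
  note HE = submoduleE[OF H] submodule_zero[OF H] and KE = submoduleE[OF K] submodule_zero[OF K]
  have HM: "h \<in> carrier M" if "h \<in> H" for h using HE that by blast
  have KM: "k \<in> carrier M" if "k \<in> K" for k using KE that by blast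
  show "{h \<oplus>\<^bsub>M\<^esub> k | h k. h \<in> H \<and> k \<in> K} \<subseteq> carrier M" using HM KM by auto
  show "\<zero>\<^bsub>M\<^esub> \<in> {h \<oplus>\<^bsub>M\<^esub> k | h k. h \<in> H \<and> k \<in> K}"
    using HE KE by (auto intro!: exI[of _ "\<zero>\<^bsub>M\<^esub>"])
  fix a assume "a \<in> {h \<oplus>\<^bsub>M\<^esub> k | h k. h \<in> H \<and> k \<in> K}"
  then obtain h k where 1: "a = h \<oplus>\<^bsub>M\<^esub> k" "h \<in> H" "k \<in> K" by blast
  note cl = HM[OF 1(2)] KM[OF 1(3)]
  have "\<ominus>\<^bsub>M\<^esub> a = \<ominus>\<^bsub>M\<^esub> h \<oplus>\<^bsub>M\<^esub> \<ominus>\<^bsub>M\<^esub> k" using cl by (simp add: 1 minus_add)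
  then show "\<ominus>\<^bsub>M\<^esub> a \<in> {h \<oplus>\<^bsub>M\<^esub> k | h k. h \<in> H \<and> k \<in> K}"
    using 1 HE(3) KE(3) by blast
  {
    fix b assume "b \<in> {h \<oplus>\<^bsub>M\<^esub> k | h k. h \<in> H \<and> k \<in> K}"
    then obtain h' k' where 2: "b = h' \<oplus>\<^bsub>M\<^esub> k'" "h' \<in> H" "k' \<in> K" by blast
    have "a \<oplus>\<^bsub>M\<^esub> b = (h \<oplus>\<^bsub>M\<^esub> h') \<oplus>\<^bsub>M\<^esub> (k \<oplus>\<^bsub>M\<^esub> k')"
      using cl HM[OF 2(2)] KM[OF 2(3)] by (simp add: 1 2 M.a_ac)
    then show "a \<oplus>\<^bsub>M\<^esub> b \<in> {h \<oplus>\<^bsub>M\<^esub> k | h k. h \<in> H \<and> k \<in> K}"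
      using HE(5)[OF 1(2) 2(2)] KE(5)[OF 1(3) 2(3)] by blast
  }
  fix r assume r: "r \<in> carrier R"
  have "r \<odot>\<^bsub>M\<^esub> a = r \<odot>\<^bsub>M\<^esub> h \<oplus>\<^bsub>M\<^esub> r \<odot>\<^bsub>M\<^esub> k"
    using cl r by (simp add: 1 smult_r_distr)
  then show "r \<odot>\<^bsub>M\<^esub> a \<in> {h \<oplus>\<^bsub>M\<^esub> k | h k. h \<in> H \<and> k \<in> K}"
    using HE(4)[OF r 1(2)] KE(4)[OF r 1(3)] by blast
qed

lemma submodule_Union_chain:
  assumes C: "\<C> \<noteq> {}" "\<And>H. H \<in> \<C> \<Longrightarrow> submodule H R M"
    and chain: "\<And>H K. \<lbrakk>H \<in> \<C>; K \<in> \<C>\<rbrakk> \<Longrightarrow> H \<subseteq> K \<or> K \<subseteq> H"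
  shows "submodule (\<Union>\<C>) R M"
proof (rule submoduleI)
  show "\<Union>\<C> \<subseteq> carrier M" using submoduleE(1) C by blast
  show "\<zero>\<^bsub>M\<^esub> \<in> \<Union>\<C>" using submodule_zero C by blast
  show "\<ominus>\<^bsub>M\<^esub> a \<in> \<Union>\<C>" if "a \<in> \<Union>\<C>" for a using submoduleE(3) C(2) that by blast
  show "a \<oplus>\<^bsub>M\<^esub> b \<in> \<Union>\<C>" if ab: "a \<in> \<Union>\<C>" "b \<in> \<Union>\<C>" for a b
  proof -
    obtain H where "H \<in> \<C>" "a \<in> H" "b \<in> H"
      using ab chain by (metis UnionE subsetD)
    then show ?thesis using submoduleE(5)[OF C(2)] by blast
  qed
  show "r \<odot>\<^bsub>M\<^esub> a \<in> \<Union>\<C>" if "r \<in> carrier R" "a \<in> \<Union>\<C>" for r a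
    using submoduleE(4) C(2) that by blast
qed

lemma submodule_smult_image:
  assumes "m \<in> carrier M"
  shows "submodule {r \<odot>\<^bsub>M\<^esub> m | r. r \<in> carrier R} R M"
proof (rule submoduleI)
  show "\<zero>\<^bsub>M\<^esub> \<in> {r \<odot>\<^bsub>M\<^esub> m | r. r \<in> carrier R}"
    using assms by (auto intro!: exI[of _ "\<zero>\<^bsub>R\<^esub>"])
  show "\<ominus>\<^bsub>M\<^esub> a \<in> {r \<odot>\<^bsub>M\<^esub> m | r. r \<in> carrier R}" if "a \<in> {r \<odot>\<^bsub>M\<^esub> m | r. r \<in> carrier R}" for a
    using that assms by (auto simp: smult_l_minus[symmetric])
  show "a \<oplus>\<^bsub>M\<^esub> b \<in> {r \<odot>\<^bsub>M\<^esub> m | r. r \<in> carrier R}"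
    if "a \<in> {r \<odot>\<^bsub>M\<^esub> m | r. r \<in> carrier R}" "b \<in> {r \<odot>\<^bsub>M\<^esub> m | r. r \<in> carrier R}" for a b
    using that assms by (auto simp: smult_l_distr[symmetric])
  show "s \<odot>\<^bsub>M\<^esub> a \<in> {r \<odot>\<^bsub>M\<^esub> m | r. r \<in> carrier R}"
    if "s \<in> carrier R" "a \<in> {r \<odot>\<^bsub>M\<^esub> m | r. r \<in> carrier R}" for a s
    using that assms by (auto simp: smult_assoc1[symmetric])
qed (use assms in auto)

text \<open>Let \<open>L\<close> be maximal among the submodules that meet \<open>K\<close> in zero.
  A simple \<open>U\<close> meets \<open>K + L\<close> in zero or lies in it. In the first case
  \<open>L + U\<close> still meets \<open>K\<close> in zero, so \<open>U\<close> lies in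
  \<open>L\<close> by maximality. Thus \<open>K + L\<close> contains all simple submodules.\<close>

lemma semisimple_imp_complemented:
  assumes ss: "semisimple_module R M"
  shows "complemented_module R M"
  unfolding complemented_module_def
proof (intro allI impI)
  fix K assume K: "submodule K R M"
  define \<A> where "\<A> = {L. submodule L R M \<and> K \<inter> L = {\<zero>\<^bsub>M\<^esub>}}"
  have "\<exists>L\<in>\<A>. \<forall>H\<in>\<A>. L \<subseteq> H \<longrightarrow> H = L"
  proof (rule subset_Zorn_nonempty)
    have "submodule {\<zero>\<^bsub>M\<^esub>} R M" by (rule submoduleI) auto
    then show "\<A> \<noteq> {}" using submodule_zero[OF K] by (auto simp: \<A>_def)
    fix \<C> assume C: "\<C> \<noteq> {}" "subset.chain \<A> \<C>"
    have "submodule (\<Union>\<C>) R M"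
      using C by (intro submodule_Union_chain) (auto simp: \<A>_def subset_chain_def)
    moreover have "K \<inter> \<Union>\<C> = {\<zero>\<^bsub>M\<^esub>}"
    proof -
      have "K \<inter> H = {\<zero>\<^bsub>M\<^esub>}" if "H \<in> \<C>" for H using C(2) that by (auto simp: \<A>_def subset_chain_def)
      then show ?thesis using C(1) by (simp add: Int_Union)
    qed
    ultimately show "\<Union>\<C> \<in> \<A>" by (simp add: \<A>_def)
  qed
  then obtain L where L: "submodule L R M" "K \<inter> L = {\<zero>\<^bsub>M\<^esub>}"
    and max: "\<And>H. \<lbrakk>submodule H R M; K \<inter> H = {\<zero>\<^bsub>M\<^esub>}; L \<subseteq> H\<rbrakk> \<Longrightarrow> H = L"
    by (auto simp: \<A>_def)
  define S where "S = {k \<oplus>\<^bsub>M\<^esub> l | k l. k \<in> K \<and> l \<in> L}"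
  have S: "submodule S R M" unfolding S_def by (rule submodule_sum[OF K L(1)])
  note KE = submoduleE[OF K] and LE = submoduleE[OF L(1)] and K0 = submodule_zero[OF K]
  have LS: "L \<subseteq> S"
  proof
    fix l assume "l \<in> L"
    then have "l = \<zero>\<^bsub>M\<^esub> \<oplus>\<^bsub>M\<^esub> l" using LE(1) by auto
    then show "l \<in> S" using K0 \<open>l \<in> L\<close> unfolding S_def by blast
  qed
  have "U \<subseteq> S" if U: "simple_submodule U R M" for U
  proof -
    have sU: "submodule U R M" using U by (simp add: simple_submodule_def)
    note UE = submoduleE[OF sU]
    have "U \<inter> S = {\<zero>\<^bsub>M\<^esub>} \<or> U \<inter> S = U"
      using U submodule_Int[OF sU S] by (auto simp: simple_submodule_def)
    then show ?thesis
    proof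
      assume US: "U \<inter> S = {\<zero>\<^bsub>M\<^esub>}"
      define L' where "L' = {l \<oplus>\<^bsub>M\<^esub> u | l u. l \<in> L \<and> u \<in> U}"
      have L': "submodule L' R M" unfolding L'_def by (rule submodule_sum[OF L(1) sU])
      have "L \<subseteq> L'"
      proof
        fix l assume "l \<in> L"
        then have "l = l \<oplus>\<^bsub>M\<^esub> \<zero>\<^bsub>M\<^esub>" using LE(1) by auto
        then show "l \<in> L'" using submodule_zero[OF sU] \<open>l \<in> L\<close> unfolding L'_def by blast
      qed
      moreover have "x = \<zero>\<^bsub>M\<^esub>" if x: "x \<in> K" "x \<in> L'" for x
      proof -
        obtain l u where 1: "x = l \<oplus>\<^bsub>M\<^esub> u" "l \<in> L" "u \<in> U" using x(2) unfolding L'_def by blast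
        have cl: "x \<in> carrier M" "l \<in> carrier M" "u \<in> carrier M"
          using 1 x(1) KE(1) LE(1) UE(1) by auto
        \<comment> \<open>Moving \<open>l\<close> to the other side puts \<open>u\<close> into
          \<open>K + L\<close>, which meets \<open>U\<close> in zero; so \<open>x = l\<close> lies
          in both \<open>K\<close> and \<open>L\<close>.\<close>
        have "u = x \<oplus>\<^bsub>M\<^esub> \<ominus>\<^bsub>M\<^esub> l" using cl 1(1) M.a_comm M.r_neg1 by (metis M.a_inv_closed)
        then have "u \<in> S" using x(1) LE(3)[OF 1(2)] unfolding S_def by blast
        then have "u = \<zero>\<^bsub>M\<^esub>" using US 1(3) by blast
        then show ?thesis using 1 x(1) L(2) cl by auto
      qed
      ultimately have "L' = L"
        using max[OF L'] K0 submodule_zero[OF L'] by blast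
      moreover have "U \<subseteq> L'"
      proof
        fix u assume "u \<in> U"
        then have "u = \<zero>\<^bsub>M\<^esub> \<oplus>\<^bsub>M\<^esub> u" using UE(1) by auto
        then show "u \<in> L'" using submodule_zero[OF L(1)] \<open>u \<in> U\<close> unfolding L'_def by blast
      qed
      ultimately show ?thesis using LS by blast
    qed blast
  qed
  then have "carrier M \<subseteq> S" using ss S unfolding semisimple_module_def by blast
  then show "\<exists>L. submodule L R M \<and> K \<inter> L = {\<zero>\<^bsub>M\<^esub>} \<and> (\<forall>x\<in>carrier M. \<exists>k\<in>K. \<exists>l\<in>L. x = k \<oplus>\<^bsub>M\<^esub> l)"
    using L unfolding S_def by blast
qed

end

section \<open>Ideals and maximal ideals\<close>

context cring
begin

lemma ideal_props:
  assumes "ideal I R"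
  shows "x \<in> I \<Longrightarrow> x \<in> carrier R" "\<zero> \<in> I"
    "\<lbrakk>x \<in> I; y \<in> I\<rbrakk> \<Longrightarrow> x \<oplus> y \<in> I" "x \<in> I \<Longrightarrow> \<ominus> x \<in> I" "\<lbrakk>x \<in> I; y \<in> I\<rbrakk> \<Longrightarrow> x \<ominus> y \<in> I"
    "\<lbrakk>x \<in> I; r \<in> carrier R\<rbrakk> \<Longrightarrow> r \<otimes> x \<in> I" "\<lbrakk>x \<in> I; r \<in> carrier R\<rbrakk> \<Longrightarrow> x \<otimes> r \<in> I"
proof -
  interpret I: ideal I R by fact
  show "x \<in> I \<Longrightarrow> x \<in> carrier R" "\<zero> \<in> I"
    "\<lbrakk>x \<in> I; y \<in> I\<rbrakk> \<Longrightarrow> x \<oplus> y \<in> I" "x \<in> I \<Longrightarrow> \<ominus> x \<in> I" "\<lbrakk>x \<in> I; y \<in> I\<rbrakk> \<Longrightarrow> x \<ominus> y \<in> I"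
    "\<lbrakk>x \<in> I; r \<in> carrier R\<rbrakk> \<Longrightarrow> r \<otimes> x \<in> I" "\<lbrakk>x \<in> I; r \<in> carrier R\<rbrakk> \<Longrightarrow> x \<otimes> r \<in> I"
    using I.I_l_closed I.I_r_closed by (auto simp: a_minus_def)
qed

lemma idealI':
  assumes "\<And>x. x \<in> I \<Longrightarrow> x \<in> carrier R" "\<zero> \<in> I"
    and "\<And>x y. \<lbrakk>x \<in> I; y \<in> I\<rbrakk> \<Longrightarrow> x \<oplus> y \<in> I"
    and "\<And>r x. \<lbrakk>r \<in> carrier R; x \<in> I\<rbrakk> \<Longrightarrow> r \<otimes> x \<in> I"
  shows "ideal I R"
proof (rule idealI[OF ring_axioms])
  have "\<ominus> x \<in> I" if "x \<in> I" for x
    using assms(4)[of "\<ominus>\<one>" x] assms(1)[OF that] that by (simp add: l_minus)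
  then show "subgroup I (add_monoid R)"
    using assms by (intro add.subgroupI) auto
qed (use assms m_comm in fastforce)+

lemma exists_maximalideal:
  assumes I: "ideal I R" "\<one> \<notin> I"
  obtains P where "maximalideal P R" "I \<subseteq> P"
proof -
  interpret Reg: module R "regular_module R" by (rule regular_module_module)
  define \<A> where "\<A> = {J. ideal J R \<and> I \<subseteq> J \<and> \<one> \<notin> J}"
  have "\<exists>J\<in>\<A>. \<forall>H\<in>\<A>. J \<subseteq> H \<longrightarrow> H = J"
  proof (rule subset_Zorn_nonempty)
    show "\<A> \<noteq> {}" using I by (auto simp: \<A>_def)
    fix \<C> assume C: "\<C> \<noteq> {}" "subset.chain \<A> \<C>"
    have "submodule (\<Union>\<C>) R (regular_module R)"
      using C by (intro Reg.submodule_Union_chain) (auto simp: \<A>_def subset_chain_def submodule_regular_iff)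
    moreover have "I \<subseteq> \<Union>\<C>" "\<one> \<notin> \<Union>\<C>"
      using C by (fastforce simp: \<A>_def subset_chain_def)+
    ultimately show "\<Union>\<C> \<in> \<A>" by (simp add: \<A>_def submodule_regular_iff)
  qed
  then obtain P where P: "ideal P R" "I \<subseteq> P" "\<one> \<notin> P"
    and max: "\<And>J. \<lbrakk>ideal J R; P \<subseteq> J; \<one> \<notin> J\<rbrakk> \<Longrightarrow> J = P"
    by (auto simp: \<A>_def)
  have "maximalideal P R"
  proof (rule maximalidealI[OF P(1)])
    show "carrier R \<noteq> P" using P(3) by auto
    fix J assume J: "ideal J R" "P \<subseteq> J" "J \<subseteq> carrier R"
    show "J = P \<or> J = carrier R"
      using max[OF J(1,2)] ideal.one_imp_carrier[OF J(1)] by blast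
  qed
  then show ?thesis using that P(2) by blast
qed

lemma ideal_sum_principal:
  assumes I: "ideal I R" and r: "r \<in> carrier R"
  shows "ideal {p \<oplus> s \<otimes> r | p s. p \<in> I \<and> s \<in> carrier R} R"
proof -
  interpret Reg: module R "regular_module R" by (rule regular_module_module)
  have "submodule {h \<oplus> k | h k. h \<in> I \<and> k \<in> {s \<otimes> r | s. s \<in> carrier R}} R (regular_module R)"
    using Reg.submodule_sum[of I "{s \<otimes> r | s. s \<in> carrier R}"] Reg.submodule_smult_image[of r] I r
    by (simp add: submodule_regular_iff)
  moreover have "{h \<oplus> k | h k. h \<in> I \<and> k \<in> {s \<otimes> r | s. s \<in> carrier R}} = {p \<oplus> s \<otimes> r | p s. p \<in> I \<and> s \<in> carrier R}"
    by blast
  ultimately show ?thesis by (simp add: submodule_regular_iff)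
qed

text \<open>\<open>R / P\<close> is a field, and \<open>s\<close> represents the inverse of
  \<open>r\<close> in it.\<close>

lemma maximalideal_inverse_mod:
  assumes P: "maximalideal P R" and r: "r \<in> carrier R" "r \<notin> P"
  obtains p s where "p \<in> P" "s \<in> carrier R" "\<one> = p \<oplus> s \<otimes> r"
proof -
  interpret P: maximalideal P R by fact
  define J where "J = {p \<oplus> s \<otimes> r | p s. p \<in> P \<and> s \<in> carrier R}"
  have J: "ideal J R" unfolding J_def by (rule ideal_sum_principal[OF P.is_ideal r(1)])
  have "P \<subseteq> J"
  proof
    fix p assume "p \<in> P"
    then have "p = p \<oplus> \<zero> \<otimes> r" using r P.a_subset by auto
    then show "p \<in> J" using \<open>p \<in> P\<close> unfolding J_def by blast
  qed
  moreover have "r \<in> J"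
  proof -
    have "r = \<zero> \<oplus> \<one> \<otimes> r" using r by simp
    then show ?thesis unfolding J_def using P.zero_closed by blast
  qed
  ultimately have "J = carrier R" using P.I_maximal[OF J] ideal_props(1)[OF J] r by blast
  then have "\<one> \<in> J" by simp
  then show ?thesis using that unfolding J_def by blast
qed

end

text \<open>
  The hypothesis says that \<open>R / Z\<close> is a semisimple ring; the simple submodules needed to reach an
  element \<open>n\<close> are found inside \<open>(\<one> \<ominus> e)n\<close>.
\<close>

lemma (in module) semisimple_moduleI:
  assumes Z: "ideal Z R" and ZM: "\<And>z n. \<lbrakk>z \<in> Z; n \<in> carrier M\<rbrakk> \<Longrightarrow> z \<odot>\<^bsub>M\<^esub> n = \<zero>\<^bsub>M\<^esub>"
    and gen: "\<And>P. \<lbrakk>maximalideal P R; Z \<subseteq> P\<rbrakk> \<Longrightarrow> \<exists>e\<in>P. \<forall>y\<in>P. (\<one> \<ominus> e) \<otimes> y \<in> Z"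
  shows "semisimple_module R M"
proof -
  have "n \<in> H" if n: "n \<in> carrier M" and H: "submodule H R M"
    and simple: "\<And>K. simple_submodule K R M \<Longrightarrow> K \<subseteq> H" for n H
  proof (rule ccontr)
    assume nH: "n \<notin> H"
    note HE = submoduleE[OF H] and H0 = submodule_zero[OF H]
    \<comment> \<open>This ideal is proper, so it lies in a maximal ideal \<open>P\<close>. The
      contradiction will be that it contains \<open>\<one> \<ominus> e\<close>, although
      \<open>e\<close> lies in \<open>P\<close>.\<close>
    define A where "A = {r \<in> carrier R. r \<odot>\<^bsub>M\<^esub> n \<in> H}"
    have "ideal A R"
      by (rule idealI') (use HE H0 n in \<open>auto simp: A_def smult_l_distr smult_assoc1\<close>)
    moreover have "\<one> \<notin> A" using n nH by (simp add: A_def)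
    ultimately obtain P where P: "maximalideal P R" "A \<subseteq> P" by (rule exists_maximalideal)
    interpret P: maximalideal P R by (rule P)
    have "Z \<subseteq> P" using P(2) ZM[OF _ n] H0 ideal_props(1)[OF Z] by (auto simp: A_def)
    then obtain e where e: "e \<in> P" and eP: "\<And>y. y \<in> P \<Longrightarrow> (\<one> \<ominus> e) \<otimes> y \<in> Z"
      using gen P(1) by blast
    have eR: "e \<in> carrier R" using e P.a_subset by blast
    \<comment> \<open>\<open>P\<close> annihilates \<open>m\<close>, because
      \<open>(1 - e) P\<close> lies in \<open>Z\<close> and \<open>Z\<close> annihilates the module.
      Hence \<open>R m\<close> is zero or a copy of the field \<open>R / P\<close>, which is
      simple.\<close>
    define m where "m = (\<one> \<ominus> e) \<odot>\<^bsub>M\<^esub> n"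
    have m: "m \<in> carrier M" using eR n by (simp add: m_def)
    have Pm: "y \<odot>\<^bsub>M\<^esub> m = \<zero>\<^bsub>M\<^esub>" if y: "y \<in> P" for y
    proof -
      have yR: "y \<in> carrier R" using y P.a_subset by blast
      have "y \<odot>\<^bsub>M\<^esub> m = ((\<one> \<ominus> e) \<otimes> y) \<odot>\<^bsub>M\<^esub> n"
        using yR eR n by (simp add: m_def smult_assoc1[symmetric] m_comm)
      then show ?thesis using ZM[OF eP[OF y] n] by simp
    qed
    have "m \<in> H"
    proof (cases "m = \<zero>\<^bsub>M\<^esub>")
      case False
      define U where "U = {r \<odot>\<^bsub>M\<^esub> m | r. r \<in> carrier R}"
      have mU: "m \<in> U" unfolding U_def using m by (auto intro!: exI[of _ "\<one>"])
      have "simple_submodule U R M"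
        unfolding simple_submodule_def
      proof (intro conjI allI impI)
        show "submodule U R M" unfolding U_def by (rule submodule_smult_image[OF m])
        show "U \<noteq> {\<zero>\<^bsub>M\<^esub>}" using mU False by blast
        fix L assume L: "submodule L R M \<and> L \<subseteq> U"
        note LE = submoduleE[OF conjunct1[OF L]]
        show "L = {\<zero>\<^bsub>M\<^esub>} \<or> L = U"
        proof (cases "L = {\<zero>\<^bsub>M\<^esub>}")
          case False
          then obtain l where l: "l \<in> L" "l \<noteq> \<zero>\<^bsub>M\<^esub>" using LE(2) by blast
          then obtain r where r: "r \<in> carrier R" "l = r \<odot>\<^bsub>M\<^esub> m" using L unfolding U_def by blast
          then have "r \<notin> P" using Pm l(2) by blast
          then obtain p s where ps: "p \<in> P" "s \<in> carrier R" "\<one> = p \<oplus> s \<otimes> r"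
            using maximalideal_inverse_mod[OF P(1) r(1)] by blast
          have pR: "p \<in> carrier R" using ps P.a_subset by blast
          have "m = (p \<oplus> s \<otimes> r) \<odot>\<^bsub>M\<^esub> m" using m by (simp flip: ps(3))
          also have "\<dots> = s \<odot>\<^bsub>M\<^esub> l"
            using pR ps(2) r m Pm[OF ps(1)] by (simp add: smult_l_distr smult_assoc1)
          finally have "m \<in> L" using LE(4)[OF ps(2) l(1)] by simp
          then have "U \<subseteq> L" unfolding U_def using LE(4) by blast
          then show ?thesis using L by blast
        qed simp
      qed
      then show ?thesis using simple mU by blast
    qed (use H0 in simp)
    then have "\<one> \<ominus> e \<in> P" using P(2) eR by (auto simp: A_def m_def)
    then have "(\<one> \<ominus> e) \<oplus> e \<in> P" using e by (rule P.a_closed)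
    moreover have "(\<one> \<ominus> e) \<oplus> e = \<one>" using eR by algebra
    ultimately have "\<one> \<in> P" by simp
    then show False using P.I_notcarr P.one_imp_carrier by blast
  qed
  then show ?thesis
    unfolding semisimple_module_def
    using carrier_is_submodule submoduleE(1) by (auto simp: simple_submodule_def)
qed


subsection \<open>Transfer along isomorphisms\<close>

lemma module_hom_set_compose:
  assumes "f \<in> module_hom_set R L M" "g \<in> module_hom_set R M N"
  shows "(\<lambda>x. g (f x)) \<in> module_hom_set R L N"
  using assms by (auto simp: module_hom_set_def Pi_def)

text \<open>The inverse is part of the data because submodules and homomorphisms are moved in both
  directions.\<close>

definition module_iso_pair where
  "module_iso_pair R N N' f g \<longleftrightarrow> f \<in> module_hom_set R N N' \<and> g \<in> module_hom_set R N' N \<and>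
     (\<forall>x\<in>carrier N. g (f x) = x) \<and> (\<forall>y\<in>carrier N'. f (g y) = y)"

lemma module_iso_pairD:
  assumes "module_iso_pair R N N' f g"
  shows "f \<in> module_hom_set R N N'" "g \<in> module_hom_set R N' N"
    "x \<in> carrier N \<Longrightarrow> g (f x) = x" "y \<in> carrier N' \<Longrightarrow> f (g y) = y"
  using assms by (simp_all add: module_iso_pair_def)

lemma module_iso_pair_sym: "module_iso_pair R N N' f g \<Longrightarrow> module_iso_pair R N' N g f"
  by (auto simp: module_iso_pair_def)

lemma submodule_image:
  assumes "module R N" "module R N'" and f: "f \<in> module_hom_set R N N'" and K: "submodule K R N"
  shows "submodule (f ` K) R N'"
proof -
  interpret N: module R N by fact
  interpret N': module R N' by fact
  note fD = module_hom_setD[OF f] and KE = N.submoduleE[OF K]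
  have neg: "\<ominus>\<^bsub>N'\<^esub> f k = f (\<ominus>\<^bsub>N\<^esub> k)" if "k \<in> K" for k
  proof -
    have k: "k \<in> carrier N" using KE(1) that by blast
    have "f (\<ominus>\<^bsub>N\<^esub> k) \<oplus>\<^bsub>N'\<^esub> f k = f (\<ominus>\<^bsub>N\<^esub> k \<oplus>\<^bsub>N\<^esub> k)" using k by (simp add: fD)
    also have "\<dots> = \<zero>\<^bsub>N'\<^esub>"
      using k module_hom_set_zero[OF assms(1-3)] by (simp add: N.l_neg)
    finally show ?thesis by (intro N'.minus_equality) (use k fD in auto)
  qed
  show ?thesis
  proof (rule N'.submoduleI)
    show "\<zero>\<^bsub>N'\<^esub> \<in> f ` K"
      using module_hom_set_zero[OF assms(1-3)] N.submodule_zero[OF K] by force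
    show "\<ominus>\<^bsub>N'\<^esub> a \<in> f ` K" if "a \<in> f ` K" for a using that neg KE(3) by auto
    show "a \<oplus>\<^bsub>N'\<^esub> b \<in> f ` K" if "a \<in> f ` K" "b \<in> f ` K" for a b
      using that KE(1,5) by (auto simp: fD(2)[symmetric] subset_iff)
    show "r \<odot>\<^bsub>N'\<^esub> a \<in> f ` K" if "r \<in> carrier R" "a \<in> f ` K" for r a
      using that KE(1,4) by (auto simp: fD(3)[symmetric] subset_iff)
  qed (use fD KE in auto)
qed

text \<open>Conjugation: \<open>h\<close> becomes \<open>x \<mapsto> q (h (f x))\<close> on the
  image of \<open>K\<close> under \<open>g\<close>, is extended there to \<open>u\<close>, and comes
  back as \<open>y \<mapsto> p (u (g y))\<close>.\<close>

lemma relatively_injective_transfer: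
  assumes mods: "module R N" "module R N'"
    and N: "module_iso_pair R N N' f g" and M: "module_iso_pair R M M' p q"
    and inj: "relatively_injective R N M"
  shows "relatively_injective R N' M'"
  unfolding relatively_injective_def
proof (intro allI impI)
  fix K h assume K: "submodule K R N'" and h: "h \<in> module_hom_set R (N'\<lparr>carrier := K\<rparr>) M'"
  interpret N': module R N' by fact
  have KN: "K \<subseteq> carrier N'" by (rule N'.submoduleE(1)[OF K])
  have gK: "submodule (g ` K) R N"
    by (rule submodule_image[OF mods(2,1) module_iso_pairD(2)[OF N] K])
  have "f \<in> module_hom_set R (N\<lparr>carrier := g ` K\<rparr>) (N'\<lparr>carrier := K\<rparr>)"
  proof (rule module_hom_setI, simp_all)
    fix x assume "x \<in> g ` K"
    then obtain y where y: "y \<in> K" "x = g y" by blast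
    have *: "x' \<in> carrier N" if "x' \<in> g ` K" for x'
      using that KN module_hom_setD(1)[OF module_iso_pairD(2)[OF N]] by blast
    note fD = module_hom_setD[OF module_iso_pairD(1)[OF N]]
    show "f x \<in> K" using y KN module_iso_pairD(4)[OF N] by auto
    show "f (x \<oplus>\<^bsub>N\<^esub> x') = f x \<oplus>\<^bsub>N'\<^esub> f x'" if "x' \<in> g ` K" for x'
      using fD(2) * \<open>x \<in> g ` K\<close> that by blast
    show "f (r \<odot>\<^bsub>N\<^esub> x) = r \<odot>\<^bsub>N'\<^esub> f x" if "r \<in> carrier R" for r
      using fD(3) * \<open>x \<in> g ` K\<close> that by blast
  qed
  then have "(\<lambda>x. h (f x)) \<in> module_hom_set R (N\<lparr>carrier := g ` K\<rparr>) M'"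
    using h by (rule module_hom_set_compose)
  then have "(\<lambda>x. q (h (f x))) \<in> module_hom_set R (N\<lparr>carrier := g ` K\<rparr>) M"
    using module_iso_pairD(2)[OF M] by (rule module_hom_set_compose)
  then obtain u where u: "u \<in> module_hom_set R N M" "\<And>x. x \<in> g ` K \<Longrightarrow> u x = q (h (f x))"
    using inj gK unfolding relatively_injective_def by blast
  have "(\<lambda>y. p (u (g y))) \<in> module_hom_set R N' M'"
    by (rule module_hom_set_compose[OF module_hom_set_compose[OF module_iso_pairD(2)[OF N] u(1)]
          module_iso_pairD(1)[OF M]])
  moreover have "p (u (g y)) = h y" if "y \<in> K" for y
  proof -
    have "f (g y) = y" using module_iso_pairD(4)[OF N] KN that by blast
    then have "u (g y) = q (h y)" using u(2)[of "g y"] that by simp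
    moreover have "h y \<in> carrier M'" using module_hom_setD(1)[OF h] that by simp
    ultimately show ?thesis using M by (simp add: module_iso_pair_def)
  qed
  ultimately show "\<exists>g\<in>module_hom_set R N' M'. \<forall>x\<in>K. g x = h x"
    by (intro bexI[of _ "\<lambda>y. p (u (g y))"] ballI)
qed

lemma complemented_module_transfer:
  assumes mods: "module R N" "module R N'"
    and iso: "module_iso_pair R N N' f g" and compl: "complemented_module R N"
  shows "complemented_module R N'"
  unfolding complemented_module_def
proof (intro allI impI)
  fix K assume K: "submodule K R N'"
  interpret N: module R N by fact
  interpret N': module R N' by fact
  have f: "f \<in> module_hom_set R N N'" and g: "g \<in> module_hom_set R N' N"
    and gf: "\<And>x. x \<in> carrier N \<Longrightarrow> g (f x) = x" and fg: "\<And>y. y \<in> carrier N' \<Longrightarrow> f (g y) = y"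
    using module_iso_pairD[OF iso] by blast+
  have KN: "K \<subseteq> carrier N'" by (rule N'.submoduleE(1)[OF K])
  obtain L where L: "submodule L R N" "g ` K \<inter> L = {\<zero>\<^bsub>N\<^esub>}"
    "\<forall>x\<in>carrier N. \<exists>k\<in>g ` K. \<exists>l\<in>L. x = k \<oplus>\<^bsub>N\<^esub> l"
    using compl[unfolded complemented_module_def, rule_format, OF submodule_image[OF mods(2,1) g K]]
    by (elim exE conjE)
  have LN: "L \<subseteq> carrier N" by (rule N.submoduleE(1)[OF L(1)])
  have fL: "submodule (f ` L) R N'" by (rule submodule_image[OF mods f L(1)])
  moreover have "K \<inter> f ` L = {\<zero>\<^bsub>N'\<^esub>}"
  proof
    show "K \<inter> f ` L \<subseteq> {\<zero>\<^bsub>N'\<^esub>}"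
    proof
      fix x assume x: "x \<in> K \<inter> f ` L"
      then obtain l where l: "l \<in> L" "x = f l" by blast
      then have "g x = l" using gf LN by blast
      then have "l \<in> g ` K \<inter> L" using x l by blast
      then show "x \<in> {\<zero>\<^bsub>N'\<^esub>}" using L(2) l module_hom_set_zero[OF mods f] by simp
    qed
  qed (use N'.submodule_zero K fL in auto)
  moreover have "\<exists>k\<in>K. \<exists>l\<in>f ` L. y = k \<oplus>\<^bsub>N'\<^esub> l" if y: "y \<in> carrier N'" for y
  proof -
    obtain k l where kl: "k \<in> K" "l \<in> L" "g y = g k \<oplus>\<^bsub>N\<^esub> l"
      using bspec[OF L(3) module_hom_setD(1)[OF g y]] by blast
    have k: "k \<in> carrier N'" "l \<in> carrier N" using kl KN LN by auto
    have "y = f (g k \<oplus>\<^bsub>N\<^esub> l)" using fg[OF y] kl(3) by simp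
    also have "\<dots> = k \<oplus>\<^bsub>N'\<^esub> f l"
      using k fg module_hom_setD(1)[OF g] by (simp add: module_hom_setD(2)[OF f])
    finally show ?thesis using kl by blast
  qed
  ultimately show "\<exists>L. submodule L R N' \<and> K \<inter> L = {\<zero>\<^bsub>N'\<^esub>} \<and> (\<forall>x\<in>carrier N'. \<exists>k\<in>K. \<exists>l\<in>L. x = k \<oplus>\<^bsub>N'\<^esub> l)"
    by blast
qed

text \<open>Transport of structure along an injection. The multiplicative fields may stay undefined,
  since no notion about modules reads them.\<close>

lemma module_copy:
  fixes N :: "('a, 'n, 'e) module_scheme"
  assumes "module R N" and "carrier N \<lesssim> (UNIV :: 'm set)"
  obtains N' :: "('a, 'm) module" and f g where "module R N'" "module_iso_pair R N N' f g"
proof -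
  interpret N: module R N by fact
  obtain \<iota> :: "'n \<Rightarrow> 'm" where \<iota>: "inj_on \<iota> (carrier N)"
    using assms(2) by (auto simp: lepoll_def)
  define g where "g = the_inv_into (carrier N) \<iota>"
  have g: "g (\<iota> x) = x" if "x \<in> carrier N" for x
    using the_inv_into_f_f[OF \<iota> that] by (simp add: g_def)
  define N' :: "('a, 'm) module" where
    "N' = \<lparr>carrier = \<iota> ` carrier N, monoid.mult = undefined, one = undefined, ring.zero = \<iota> \<zero>\<^bsub>N\<^esub>,
       ring.add = (\<lambda>x y. \<iota> (g x \<oplus>\<^bsub>N\<^esub> g y)), smult = (\<lambda>r x. \<iota> (r \<odot>\<^bsub>N\<^esub> g x))\<rparr>"
  have "abelian_group N'"
  proof (rule abelian_groupI)
    fix x assume "x \<in> carrier N'"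
    then obtain n where n: "n \<in> carrier N" "x = \<iota> n" by (auto simp: N'_def)
    have "\<iota> (\<ominus>\<^bsub>N\<^esub> n) \<in> carrier N'" "\<iota> (\<ominus>\<^bsub>N\<^esub> n) \<oplus>\<^bsub>N'\<^esub> x = \<zero>\<^bsub>N'\<^esub>"
      using n by (auto simp: N'_def g N.l_neg)
    then show "\<exists>y\<in>carrier N'. y \<oplus>\<^bsub>N'\<^esub> x = \<zero>\<^bsub>N'\<^esub>" by blast
  qed (auto simp: N'_def g N.a_ac)
  then have "module R N'"
    by (intro moduleI) (auto simp: N'_def g N.smult_l_distr N.smult_r_distr N.smult_assoc1 N.cring_axioms)
  moreover have "module_iso_pair R N N' \<iota> g"
    by (auto simp: module_iso_pair_def module_hom_set_def N'_def g)
  ultimately show ?thesis by (rule that)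
qed

text \<open>The modules of \<^const>\<open>no_middle_class\<close> may live on any type, as long as they fit into \<open>'m\<close>.\<close>

lemma no_middle_class_dichotomy:
  fixes M :: "('a, 'p, 'd) module_scheme" and N :: "('a, 'q, 'e) module_scheme"
  assumes nmc: "no_middle_class TYPE('m) R" and R: "cring R"
    and mods: "module R M" "module R N"
    and small: "carrier R \<lesssim> (UNIV :: 'm set)" "carrier M \<lesssim> (UNIV :: 'm set)" "carrier N \<lesssim> (UNIV :: 'm set)"
    and inj: "relatively_injective R N M"
  shows "relatively_injective R (regular_module R) M \<or> complemented_module R N"
proof -
  interpret R: cring R by fact
  note reg = R.regular_module_module
  obtain M' :: "('a, 'm) module" and p q where M': "module R M'" "module_iso_pair R M M' p q"
    using module_copy[OF mods(1) small(2)] by blast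
  obtain N' :: "('a, 'm) module" and f g where N': "module R N'" "module_iso_pair R N N' f g"
    using module_copy[OF mods(2) small(3)] by blast
  \<comment> \<open>\<open>R\<close> itself is copied into \<open>'m\<close>, because
    \<open>injective_module\<close> tests only modules on that type.\<close>
  obtain Q :: "('a, 'm) module" and u v where Q: "module R Q" "module_iso_pair R (regular_module R) Q u v"
    using module_copy[OF reg] small(1) by auto
  have "injective_module R M' \<or> poor_module R M'"
    using nmc M'(1) by (simp add: no_middle_class_def)
  then show ?thesis
  proof
    assume "injective_module R M'"
    then have "relatively_injective R Q M'" using Q(1) by (simp add: injective_module_def)
    then show ?thesis
      by (intro disjI1 relatively_injective_transfer[OF Q(1) reg module_iso_pair_sym[OF Q(2)]
            module_iso_pair_sym[OF M'(2)]])
  next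
    assume "poor_module R M'"
    then have "semisimple_module R N'"
      using relatively_injective_transfer[OF mods(2) N'(1) N'(2) M'(2) inj] N'(1)
      by (simp add: poor_module_def)
    then show ?thesis
      by (intro disjI2 complemented_module_transfer[OF N'(1) mods(2) module_iso_pair_sym[OF N'(2)]]
            module.semisimple_imp_complemented[OF N'(1)])
  qed
qed

subsection \<open>An internal form of the decomposition\<close>

text \<open>For an idempotent \<open>u\<close>, this says that the ring \<open>uR\<close> is semisimple.\<close>

definition semisimple_corner :: "('a, 'c) ring_scheme \<Rightarrow> 'a \<Rightarrow> bool" where
  "semisimple_corner R u \<longleftrightarrow>
    (\<forall>K. ideal K R \<and> (\<forall>y\<in>K. u \<otimes>\<^bsub>R\<^esub> y = y) \<longrightarrow> (\<exists>h\<in>K. \<forall>y\<in>K. h \<otimes>\<^bsub>R\<^esub> y = y))"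

text \<open>For an idempotent \<open>e\<close>, this says that \<open>zR\<close> is the only nonzero proper ideal of the ring \<open>eR\<close>.\<close>

definition uniserial_corner :: "('a, 'c) ring_scheme \<Rightarrow> 'a \<Rightarrow> 'a \<Rightarrow> bool" where
  "uniserial_corner R e z \<longleftrightarrow> z \<in> carrier R \<and> e \<otimes>\<^bsub>R\<^esub> z = z \<and> z \<noteq> \<zero>\<^bsub>R\<^esub> \<and>
    (\<forall>s\<in>carrier R. z \<otimes>\<^bsub>R\<^esub> s \<noteq> e) \<and>
    (\<forall>r\<in>carrier R. e \<otimes>\<^bsub>R\<^esub> r = r \<longrightarrow> r = \<zero>\<^bsub>R\<^esub> \<or> (\<exists>s\<in>carrier R. r \<otimes>\<^bsub>R\<^esub> s = e) \<or>
       (\<exists>s\<in>carrier R. r = z \<otimes>\<^bsub>R\<^esub> s) \<and> (\<exists>t\<in>carrier R. z = r \<otimes>\<^bsub>R\<^esub> t))"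

text \<open>The decomposition as seen inside \<open>R\<close>: \<open>e\<close> is the identity of
  \<open>T\<close> and \<open>1 - e\<close> that of \<open>S\<close>. Each implication of the
  theorem is proved through this form.\<close>

definition nearly_semisimple :: "('a, 'c) ring_scheme \<Rightarrow> bool" where
  "nearly_semisimple R \<longleftrightarrow> (\<exists>e\<in>carrier R. e \<otimes>\<^bsub>R\<^esub> e = e \<and> semisimple_corner R (\<one>\<^bsub>R\<^esub> \<ominus>\<^bsub>R\<^esub> e) \<and>
     (e = \<zero>\<^bsub>R\<^esub> \<or> (\<exists>z. uniserial_corner R e z)))"

section \<open>Modules over a nearly semisimple ring\<close>

text \<open>\<open>R / zR\<close> is a semisimple ring: one corner is semisimple, and the other
  becomes a field modulo \<open>z\<close>, unless it is zero. To apply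
  \<open>semisimple_moduleI\<close> with \<open>Z = zR\<close>, an element of \<open>P\<close> that
  acts as the identity on \<open>P\<close> modulo \<open>zR\<close> is assembled from the two
  corners. The value \<open>z = 0\<close> belongs to the case \<open>e = 0\<close>.\<close>

lemma (in module) semisimple_if_annihilated:
  assumes e: "e \<in> carrier R" "e \<otimes> e = e"
    and ss: "semisimple_corner R (\<one> \<ominus> e)" and z: "e = \<zero> \<and> z = \<zero> \<or> uniserial_corner R e z"
    and zM: "\<And>n. n \<in> carrier M \<Longrightarrow> z \<odot>\<^bsub>M\<^esub> n = \<zero>\<^bsub>M\<^esub>"
  shows "semisimple_module R M"
proof (rule semisimple_moduleI)
  have zR: "z \<in> carrier R" using z by (auto simp: uniserial_corner_def)
  define Z where "Z = {z \<otimes> s | s. s \<in> carrier R}"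
  show Z: "ideal Z R"
  proof (rule idealI')
    show "\<zero> \<in> Z" unfolding Z_def using zR by (auto intro!: exI[of _ \<zero>])
    show "x \<oplus> y \<in> Z" if "x \<in> Z" "y \<in> Z" for x y
      using that zR unfolding Z_def by (auto simp: r_distr[symmetric])
    show "r \<otimes> x \<in> Z" if "r \<in> carrier R" "x \<in> Z" for r x
    proof -
      obtain s where s: "s \<in> carrier R" "x = z \<otimes> s" using \<open>x \<in> Z\<close> by (auto simp: Z_def)
      then have "r \<otimes> x = z \<otimes> (r \<otimes> s)" using zR \<open>r \<in> carrier R\<close> by (simp add: m_lcomm)
      then show ?thesis unfolding Z_def using s \<open>r \<in> carrier R\<close> by blast
    qed
  qed (use zR in \<open>auto simp: Z_def\<close>)
  show "a \<odot>\<^bsub>M\<^esub> n = \<zero>\<^bsub>M\<^esub>" if "a \<in> Z" "n \<in> carrier M" for a n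
    using that zR zM by (auto simp: Z_def smult_assoc1)
  fix P assume P: "maximalideal P R" "Z \<subseteq> P"
  interpret P: maximalideal P R by (rule P)
  note PD = ideal_props[OF P.is_ideal]
  define K where "K = {y \<in> P. (\<one> \<ominus> e) \<otimes> y = y}"
  have "ideal K R"
    by (rule idealI') (use PD e in \<open>auto simp: K_def r_distr m_lcomm\<close>)
  then obtain h where h: "h \<in> K" "\<And>y. y \<in> K \<Longrightarrow> h \<otimes> y = y"
    using ss unfolding semisimple_corner_def K_def by blast
  have hP: "h \<in> P" "h \<in> carrier R" and eh: "(\<one> \<ominus> e) \<otimes> h = h" using h(1) PD by (auto simp: K_def)
  have he: "h \<otimes> e = \<zero>"
  proof -
    have "h \<otimes> e = h \<otimes> (e \<ominus> e \<otimes> e)" using hP e(1) by (subst eh[symmetric]) algebra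
    then show ?thesis using hP e by (simp add: a_minus_def R.r_neg)
  qed
  have yK: "(\<one> \<ominus> e) \<otimes> y \<in> K" if "y \<in> P" for y
  proof -
    have "(\<one> \<ominus> e) \<otimes> ((\<one> \<ominus> e) \<otimes> y) = y \<ominus> (e \<oplus> e \<ominus> e \<otimes> e) \<otimes> y" using PD that e(1) by algebra
    also have "\<dots> = (\<one> \<ominus> e) \<otimes> y" using PD that e(1) unfolding e(2) by algebra
    finally show ?thesis using PD that e(1) by (auto simp: K_def)
  qed
  \<comment> \<open>\<open>h e = 0\<close>, so \<open>h\<close> sees only the component
    \<open>(1 - e) y\<close>, on which it is the identity. What remains of \<open>y\<close> is
    \<open>e y\<close>.\<close>
  have hy: "(\<one> \<ominus> h) \<otimes> y = e \<otimes> y" if y: "y \<in> P" for y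
  proof -
    have "(\<one> \<ominus> h) \<otimes> y = e \<otimes> y \<oplus> ((\<one> \<ominus> e) \<otimes> y \<ominus> h \<otimes> ((\<one> \<ominus> e) \<otimes> y)) \<ominus> (h \<otimes> e) \<otimes> y"
      using PD(1)[OF y] e(1) hP(2) by algebra
    also have "\<dots> = e \<otimes> y" using h(2)[OF yK[OF y]] he PD(1)[OF y] e(1) by (simp add: a_minus_def R.r_neg)
    finally show ?thesis .
  qed
  show "\<exists>e\<in>P. \<forall>y\<in>P. (\<one> \<ominus> e) \<otimes> y \<in> Z"
  proof (cases "e \<in> P")
    \<comment> \<open>Adding \<open>e\<close> to \<open>h\<close> removes the remaining
      \<open>e y\<close>.\<close>
    case True
    have "(\<one> \<ominus> (h \<oplus> e)) \<otimes> y = \<zero>" if y: "y \<in> P" for y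
    proof -
      have "(\<one> \<ominus> (h \<oplus> e)) \<otimes> y = (\<one> \<ominus> h) \<otimes> y \<ominus> e \<otimes> y"
        using PD(1)[OF y] e(1) hP(2) by algebra
      then show ?thesis using hy[OF y] PD(1)[OF y] e(1) by simp
    qed
    then show ?thesis
      using PD(3)[OF hP(1) True] ideal_props(2)[OF Z] by (intro bexI[of _ "h \<oplus> e"]) auto
  next
    \<comment> \<open>Now \<open>e y\<close> is not a unit of \<open>eR\<close>, since
      \<open>P\<close> would contain \<open>e\<close>; so it is a multiple of \<open>z\<close>
      already.\<close>
    case False
    have "(\<one> \<ominus> h) \<otimes> y \<in> Z" if y: "y \<in> P" for y
    proof -
      have yR: "y \<in> carrier R" "e \<otimes> y \<in> carrier R" using PD(1) y e by auto
      have eey: "e \<otimes> (e \<otimes> y) = e \<otimes> y" using yR e by (simp flip: m_assoc)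
      have notunit: "(e \<otimes> y) \<otimes> s \<noteq> e" if "s \<in> carrier R" for s
        using False PD(6,7) y e(1) that by metis
      have "e \<otimes> y = \<zero> \<or> (\<exists>s\<in>carrier R. e \<otimes> y = z \<otimes> s)"
        using z
      proof
        assume "e = \<zero> \<and> z = \<zero>"
        then show ?thesis using yR by simp
      next
        assume "uniserial_corner R e z"
        then show ?thesis using yR eey notunit unfolding uniserial_corner_def by blast
      qed
      then show ?thesis using hy[OF y] ideal_props(2)[OF Z] by (auto simp: Z_def)
    qed
    then show ?thesis using hP(1) by blast
  qed
qed

text \<open>
  If \<open>N\<close> is not semisimple then \<open>z\<close> does not annihilate \<open>N\<close>, so that \<open>eR\<close>, all of whose nonzero
  ideals contain \<open>z\<close>, embeds into \<open>N\<close>.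
\<close>

lemma nearly_semisimple_injective:
  assumes R: "nearly_semisimple R" and mods: "module R M" "module R N"
    and inj: "relatively_injective R N M" and N: "\<not> semisimple_module R N"
  shows "relatively_injective R (regular_module R) M"
  unfolding relatively_injective_def
proof (intro allI impI)
  interpret R: cring R using mods(1) by (simp add: module_def)
  interpret M: module R M by fact
  interpret N: module R N by fact
  fix J f assume "submodule J R (regular_module R)"
    and "f \<in> module_hom_set R (regular_module R\<lparr>carrier := J\<rparr>) M"
  then have J: "ideal J R" and f: "f \<in> module_hom_set R (regular_module R\<lparr>carrier := J\<rparr>) M"
    by (simp_all add: R.submodule_regular_iff)
  obtain e where e: "e \<in> carrier R" "e \<otimes>\<^bsub>R\<^esub> e = e" and ss: "semisimple_corner R (\<one>\<^bsub>R\<^esub> \<ominus>\<^bsub>R\<^esub> e)"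
    and "e = \<zero>\<^bsub>R\<^esub> \<or> (\<exists>z. uniserial_corner R e z)"
    using R unfolding nearly_semisimple_def by blast
  then obtain z where z: "e = \<zero>\<^bsub>R\<^esub> \<and> z = \<zero>\<^bsub>R\<^esub> \<or> uniserial_corner R e z" by blast
  have zR: "z \<in> carrier R" using z by (auto simp: uniserial_corner_def)
  obtain n where n: "n \<in> carrier N" "z \<odot>\<^bsub>N\<^esub> n \<noteq> \<zero>\<^bsub>N\<^esub>"
    using N.semisimple_if_annihilated[OF e ss z] N by blast
  then have z: "uniserial_corner R e z" using z by auto
  \<comment> \<open>A nonzero \<open>r\<close> in \<open>eR\<close> has \<open>z\<close> among its
    multiples, either directly or because it is a unit of \<open>eR\<close>. So
    \<open>r n = 0\<close> would give \<open>z n = 0\<close>.\<close>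
  have ann: "r = \<zero>\<^bsub>R\<^esub>" if r: "r \<in> carrier R" "e \<otimes>\<^bsub>R\<^esub> r = r" "r \<odot>\<^bsub>N\<^esub> n = \<zero>\<^bsub>N\<^esub>" for r
  proof (rule ccontr)
    assume "r \<noteq> \<zero>\<^bsub>R\<^esub>"
    then have "(\<exists>s\<in>carrier R. r \<otimes>\<^bsub>R\<^esub> s = e) \<or> (\<exists>t\<in>carrier R. z = r \<otimes>\<^bsub>R\<^esub> t)"
      using z r unfolding uniserial_corner_def by blast
    then have "\<exists>t\<in>carrier R. z = t \<otimes>\<^bsub>R\<^esub> r"
    proof
      assume "\<exists>s\<in>carrier R. r \<otimes>\<^bsub>R\<^esub> s = e"
      then obtain s where s: "s \<in> carrier R" "r \<otimes>\<^bsub>R\<^esub> s = e" by blast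
      have "(s \<otimes>\<^bsub>R\<^esub> z) \<otimes>\<^bsub>R\<^esub> r = (r \<otimes>\<^bsub>R\<^esub> s) \<otimes>\<^bsub>R\<^esub> z" using s(1) r(1) zR by (simp add: R.m_ac)
      then have "z = (s \<otimes>\<^bsub>R\<^esub> z) \<otimes>\<^bsub>R\<^esub> r" using s(2) z by (simp add: uniserial_corner_def)
      then show ?thesis using s zR by blast
    qed (use r R.m_comm in blast)
    then show False using n r(1,3) by (auto simp: N.smult_assoc1)
  qed
  note fD = module_hom_setD[OF f, simplified] and JD = R.ideal_props[OF J]
  have Jmod: "module R (regular_module R\<lparr>carrier := J\<rparr>)"
    by (intro submodule.submodule_is_module R.regular_module_module) (simp add: R.submodule_regular_iff J)
  define K where "K = {y \<in> J. e \<otimes>\<^bsub>R\<^esub> y = y}"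
  have K: "ideal K R"
    by (rule R.idealI') (use JD e in \<open>auto simp: K_def R.r_distr R.m_lcomm\<close>)
  note KD = R.ideal_props[OF K]
  have KJ: "K \<subseteq> J" and eK: "\<And>y. y \<in> K \<Longrightarrow> e \<otimes>\<^bsub>R\<^esub> y = y" by (auto simp: K_def)
  \<comment> \<open>Relative injectivity is applied to the image of \<open>K = eJ\<close> under
    \<open>r \<mapsto> r n\<close>; by \<open>ann\<close> the choice in \<open>f'\<close> is
    immaterial. The extension lives on all of \<open>N\<close>, in particular on
    \<open>e R n\<close>.\<close>
  define C where "C = {r \<odot>\<^bsub>N\<^esub> n | r. r \<in> K}"
  define f' where "f' x = f (SOME r. r \<in> K \<and> x = r \<odot>\<^bsub>N\<^esub> n)" for x
  have f': "f' (r \<odot>\<^bsub>N\<^esub> n) = f r" if r: "r \<in> K" for r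
  proof -
    define s where "s = (SOME s. s \<in> K \<and> r \<odot>\<^bsub>N\<^esub> n = s \<odot>\<^bsub>N\<^esub> n)"
    have "s \<in> K \<and> r \<odot>\<^bsub>N\<^esub> n = s \<odot>\<^bsub>N\<^esub> n" unfolding s_def by (rule someI[of _ r]) (simp add: r)
    then have s: "f' (r \<odot>\<^bsub>N\<^esub> n) = f s" "s \<in> K" "r \<odot>\<^bsub>N\<^esub> n = s \<odot>\<^bsub>N\<^esub> n"
      by (simp_all add: f'_def s_def)
    have "r \<ominus>\<^bsub>R\<^esub> s = \<zero>\<^bsub>R\<^esub>"
    proof (rule ann)
      show "e \<otimes>\<^bsub>R\<^esub> (r \<ominus>\<^bsub>R\<^esub> s) = r \<ominus>\<^bsub>R\<^esub> s" by (rule eK[OF KD(5)[OF r s(2)]])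
      show "(r \<ominus>\<^bsub>R\<^esub> s) \<odot>\<^bsub>N\<^esub> n = \<zero>\<^bsub>N\<^esub>"
        using KD(1)[OF r] KD(1)[OF s(2)] n(1) s(3)
        by (simp add: a_minus_def N.smult_l_distr N.smult_l_minus N.r_neg)
    qed (use KD r s in auto)
    then show ?thesis using s KD(1)[OF r] KD(1)[OF s(2)] by simp
  qed
  have "submodule C R N"
  proof (rule N.submoduleI)
    show "\<zero>\<^bsub>N\<^esub> \<in> C" using KD(2) n by (auto simp: C_def intro!: exI[of _ "\<zero>\<^bsub>R\<^esub>"])
    show "\<ominus>\<^bsub>N\<^esub> a \<in> C" if "a \<in> C" for a
    proof -
      obtain r where "a = r \<odot>\<^bsub>N\<^esub> n" "r \<in> K" using \<open>a \<in> C\<close> by (auto simp: C_def)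
      then have "\<ominus>\<^bsub>N\<^esub> a = (\<ominus>\<^bsub>R\<^esub> r) \<odot>\<^bsub>N\<^esub> n" using KD(1) n by (simp add: N.smult_l_minus)
      then show ?thesis unfolding C_def using KD(4)[OF \<open>r \<in> K\<close>] by blast
    qed
    show "a \<oplus>\<^bsub>N\<^esub> b \<in> C" if "a \<in> C" "b \<in> C" for a b
      using that KD(1,3) n unfolding C_def by (auto simp: N.smult_l_distr[symmetric])
    show "r \<odot>\<^bsub>N\<^esub> a \<in> C" if "r \<in> carrier R" "a \<in> C" for r a
      using that KD(1,6) n unfolding C_def by (auto simp: N.smult_assoc1[symmetric])
  qed (use KD n in \<open>auto simp: C_def\<close>)
  moreover have "f' \<in> module_hom_set R (N\<lparr>carrier := C\<rparr>) M"
  proof (rule module_hom_setI)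
    fix x assume "x \<in> carrier (N\<lparr>carrier := C\<rparr>)"
    then obtain a where a: "a \<in> K" "x = a \<odot>\<^bsub>N\<^esub> n" by (auto simp: C_def)
    then show "f' x \<in> carrier M" using f' fD(1) KJ by auto
    {
      fix y assume "y \<in> carrier (N\<lparr>carrier := C\<rparr>)"
      then obtain b where b: "b \<in> K" "y = b \<odot>\<^bsub>N\<^esub> n" by (auto simp: C_def)
      have "f' (x \<oplus>\<^bsub>N\<^esub> y) = f (a \<oplus>\<^bsub>R\<^esub> b)"
        using f'[OF KD(3)[OF a(1) b(1)]] a b KD(1) n by (simp add: N.smult_l_distr)
      then show "f' (x \<oplus>\<^bsub>N\<lparr>carrier := C\<rparr>\<^esub> y) = f' x \<oplus>\<^bsub>M\<^esub> f' y"
        using a b f' fD(2) KJ by auto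
    }
    fix r assume r: "r \<in> carrier R"
    have "f' (r \<odot>\<^bsub>N\<^esub> x) = f (r \<otimes>\<^bsub>R\<^esub> a)"
      using f'[OF KD(6)[OF a(1) r]] a KD(1) n r by (simp add: N.smult_assoc1)
    then show "f' (r \<odot>\<^bsub>N\<lparr>carrier := C\<rparr>\<^esub> x) = r \<odot>\<^bsub>M\<^esub> f' x"
      using a f' fD(3) KJ r by auto
  qed
  ultimately obtain g where g: "g \<in> module_hom_set R N M" and gf: "\<And>x. x \<in> C \<Longrightarrow> g x = f' x"
    using inj unfolding relatively_injective_def by blast
  note gD = module_hom_setD[OF g]
  define u where "u = \<one>\<^bsub>R\<^esub> \<ominus>\<^bsub>R\<^esub> e"
  have u: "u \<in> carrier R" using e by (simp add: u_def)
  have uu: "u \<otimes>\<^bsub>R\<^esub> (u \<otimes>\<^bsub>R\<^esub> y) = u \<otimes>\<^bsub>R\<^esub> y" if y: "y \<in> carrier R" for y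
  proof -
    have "u \<otimes>\<^bsub>R\<^esub> (u \<otimes>\<^bsub>R\<^esub> y) = y \<ominus>\<^bsub>R\<^esub> (e \<oplus>\<^bsub>R\<^esub> e \<ominus>\<^bsub>R\<^esub> e \<otimes>\<^bsub>R\<^esub> e) \<otimes>\<^bsub>R\<^esub> y"
      using y e(1) unfolding u_def by algebra
    also have "\<dots> = u \<otimes>\<^bsub>R\<^esub> y" using y e(1) unfolding e(2) u_def by algebra
    finally show ?thesis .
  qed
  have "ideal {y \<in> J. u \<otimes>\<^bsub>R\<^esub> y = y} R"
    by (rule R.idealI') (use JD u in \<open>auto simp: R.r_distr R.m_lcomm\<close>)
  then obtain h where h: "h \<in> J" "\<And>y. \<lbrakk>y \<in> J; u \<otimes>\<^bsub>R\<^esub> y = y\<rbrakk> \<Longrightarrow> h \<otimes>\<^bsub>R\<^esub> y = y"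
    using ss unfolding semisimple_corner_def u_def by blast
  \<comment> \<open>The summands of \<open>J = eJ + uJ\<close> are treated separately: on
    \<open>eR\<close> the extension passes through \<open>N\<close>, while on \<open>uR\<close> it
    is multiplication by \<open>h\<close>, which lands in \<open>J\<close> and is the identity on
    \<open>uJ\<close>, followed by \<open>f\<close>.\<close>
  define G where "G r = g ((e \<otimes>\<^bsub>R\<^esub> r) \<odot>\<^bsub>N\<^esub> n) \<oplus>\<^bsub>M\<^esub> f (h \<otimes>\<^bsub>R\<^esub> (u \<otimes>\<^bsub>R\<^esub> r))" for r
  have hJ: "h \<otimes>\<^bsub>R\<^esub> (u \<otimes>\<^bsub>R\<^esub> r) \<in> J" if "r \<in> carrier R" for r using h(1) u that JD(7) by simp
  have hR: "h \<in> carrier R" using h JD by blast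
  show "\<exists>g\<in>module_hom_set R (regular_module R) M. \<forall>x\<in>J. g x = f x"
  proof (intro bexI ballI)
    show "G \<in> module_hom_set R (regular_module R) M"
    proof (rule module_hom_setI, simp_all)
      fix x assume x: "x \<in> carrier R"
      show "G x \<in> carrier M" using x e n hJ fD(1) gD(1) by (simp add: G_def)
      show "G (x \<oplus>\<^bsub>R\<^esub> y) = G x \<oplus>\<^bsub>M\<^esub> G y" if y: "y \<in> carrier R" for y
        using x y e n hJ[OF x] hJ[OF y] fD gD u hR
        by (simp add: G_def R.r_distr N.smult_l_distr M.a_ac)
      show "G (r \<otimes>\<^bsub>R\<^esub> x) = r \<odot>\<^bsub>M\<^esub> G x" if r: "r \<in> carrier R" for r
      proof -
        have "e \<otimes>\<^bsub>R\<^esub> (r \<otimes>\<^bsub>R\<^esub> x) = r \<otimes>\<^bsub>R\<^esub> (e \<otimes>\<^bsub>R\<^esub> x)" "h \<otimes>\<^bsub>R\<^esub> (u \<otimes>\<^bsub>R\<^esub> (r \<otimes>\<^bsub>R\<^esub> x)) = r \<otimes>\<^bsub>R\<^esub> (h \<otimes>\<^bsub>R\<^esub> (u \<otimes>\<^bsub>R\<^esub> x))"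
          using x r e(1) u hR by (simp_all add: R.m_lcomm)
        then show ?thesis
          using x r e n hJ[OF x] fD gD by (simp add: G_def N.smult_assoc1 M.smult_r_distr)
      qed
    qed
    fix y assume y: "y \<in> J"
    have yR: "y \<in> carrier R" using y JD by blast
    have ey: "e \<otimes>\<^bsub>R\<^esub> y \<in> K" using JD(6)[OF y e(1)] yR e by (simp add: K_def flip: R.m_assoc)
    have uy: "u \<otimes>\<^bsub>R\<^esub> y \<in> J" using JD(6)[OF y u] .
    have eyC: "(e \<otimes>\<^bsub>R\<^esub> y) \<odot>\<^bsub>N\<^esub> n \<in> C" using ey by (auto simp: C_def)
    have "G y = f (e \<otimes>\<^bsub>R\<^esub> y) \<oplus>\<^bsub>M\<^esub> f (u \<otimes>\<^bsub>R\<^esub> y)"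
      using gf[of "(e \<otimes>\<^bsub>R\<^esub> y) \<odot>\<^bsub>N\<^esub> n"] eyC f'[OF ey] h(2)[OF uy uu[OF yR]] by (simp add: G_def)
    also have "\<dots> = f (e \<otimes>\<^bsub>R\<^esub> y \<oplus>\<^bsub>R\<^esub> u \<otimes>\<^bsub>R\<^esub> y)" using ey KJ uy by (simp add: fD(2) subset_iff)
    also have "e \<otimes>\<^bsub>R\<^esub> y \<oplus>\<^bsub>R\<^esub> u \<otimes>\<^bsub>R\<^esub> y = y" using e(1) yR unfolding u_def by algebra
    finally show "G y = f y" .
  qed
qed

text \<open>Injectivity relative to \<open>R\<close> separates the two cases: with it, Baer's
  criterion makes \<open>M\<close> injective; without it, \<open>nearly_semisimple_injective\<close>
  leaves only semisimple \<open>N\<close>.\<close>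

theorem nearly_semisimple_no_middle_class:
  assumes "nearly_semisimple R"
  shows "no_middle_class TYPE('m) R"
  unfolding no_middle_class_def
proof (intro allI impI)
  fix M :: "('a, 'm) module" assume M: "module R M"
  show "injective_module R M \<or> poor_module R M"
  proof (cases "relatively_injective R (regular_module R) M")
    case True
    then show ?thesis using M by (auto simp: injective_module_def intro: Baer_criterion)
  next
    case False
    then show ?thesis using nearly_semisimple_injective[OF assms M] by (auto simp: poor_module_def)
  qed
qed


subsection \<open>Characters of the additive group\<close>

text \<open>A multiplicative copy of Q/Z. It is countable, divisible and has elements of every
  finite order, which gives the size bound, the extension of characters and the existence of
  nontrivial ones.\<close>

definition unity_roots :: "complex set" where
  "unity_roots = {c. \<exists>n>0. c ^ n = 1}"

lemma unity_roots_nonzero: "c \<in> unity_roots \<Longrightarrow> c \<noteq> 0"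
  by (auto simp: unity_roots_def power_0_left)

lemma one_unity_roots: "1 \<in> unity_roots"
  by (auto simp: unity_roots_def)

lemma mult_unity_roots:
  assumes "c \<in> unity_roots" "d \<in> unity_roots"
  shows "c * d \<in> unity_roots"
proof -
  obtain m n where "m > 0" "c ^ m = 1" "n > 0" "d ^ n = 1"
    using assms by (auto simp: unity_roots_def)
  then have "m * n > 0" "(c * d) ^ (m * n) = 1"
    by (simp_all add: power_mult_distrib power_mult) (metis mult.commute power_mult power_one)
  then show ?thesis unfolding unity_roots_def by blast
qed

lemma powi_unity_roots:
  assumes "c \<in> unity_roots"
  shows "c powi k \<in> unity_roots"
proof -
  obtain m where m: "m > 0" "c ^ m = 1" using assms by (auto simp: unity_roots_def)
  have "(c powi k) ^ m = (c ^ m) powi k" by (simp add: power_int_power power_int_power' mult.commute)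
  then show ?thesis using m by (auto simp: unity_roots_def)
qed

lemma unity_roots_divisible:
  assumes "c \<in> unity_roots" "n > 0"
  obtains d where "d \<in> unity_roots" "d ^ n = c"
proof -
  have "card {z. z ^ n = c} = n" using assms unity_roots_nonzero by (intro card_nth_roots)
  then obtain d where d: "d ^ n = c" using assms(2) by (metis (mono_tags) Collect_empty_eq card.empty less_numeral_extra(3))
  obtain m where "m > 0" "c ^ m = 1" using assms by (auto simp: unity_roots_def)
  then have "n * m > 0" "d ^ (n * m) = 1" using assms(2) d by (simp_all add: power_mult)
  then show ?thesis using that d unfolding unity_roots_def by blast
qed

lemma inverse_unity_roots: "c \<in> unity_roots \<Longrightarrow> inverse c \<in> unity_roots"
  using powi_unity_roots[of c "-1"] by (simp add: power_int_minus)

lemma countable_unity_roots: "countable unity_roots"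
proof -
  have "finite {c::complex. c ^ n = 1}" if "n > 0" for n
    using that by (intro finite_nth_roots)
  then have "countable (\<Union>n\<in>{0<..}. {c::complex. c ^ n = 1})"
    by (intro countable_UN) (auto intro: countable_finite)
  moreover have "unity_roots = (\<Union>n\<in>{0<..}. {c. c ^ n = 1})" by (auto simp: unity_roots_def)
  ultimately show ?thesis by simp
qed

definition unity_roots_module :: "(int, complex) module" where
  "unity_roots_module = \<lparr>carrier = unity_roots, monoid.mult = (*), one = 1, ring.zero = 1,
     ring.add = (*), smult = (\<lambda>k c. c powi k)\<rparr>"

lemma unity_roots_module: "module \<Z> unity_roots_module"
proof (rule moduleI)
  show "abelian_group unity_roots_module"
  proof (rule abelian_groupI)
    fix c assume "c \<in> carrier unity_roots_module"
    then have "c \<in> unity_roots" by (simp add: unity_roots_module_def)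
    then have "c powi (-1) \<in> unity_roots" "c powi (-1) * c = 1"
      using powi_unity_roots[of c "-1"] unity_roots_nonzero by (auto simp: power_int_minus)
    then show "\<exists>y\<in>carrier unity_roots_module. y \<oplus>\<^bsub>unity_roots_module\<^esub> c = \<zero>\<^bsub>unity_roots_module\<^esub>"
      by (auto simp: unity_roots_module_def)
  qed (auto simp: unity_roots_module_def one_unity_roots mult_unity_roots)
qed (auto simp: unity_roots_module_def int_is_cring powi_unity_roots power_int_add
    power_int_mult_distrib power_int_mult[symmetric] mult.commute unity_roots_nonzero)

lemma int_ideal_principal:
  assumes "ideal K \<Z>"
  obtains n where "n \<in> K" "n \<ge> 0" "\<And>k. k \<in> K \<Longrightarrow> n dvd k"
proof -
  note KD = cring.ideal_props[OF int_is_cring assms, simplified]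
  show ?thesis
  proof (cases "K = {0}")
    case False
    then obtain k where k: "k \<in> K" "k \<noteq> 0" using KD(2) by blast
    have "- k \<in> K" using KD(6)[OF k(1), of "- 1"] by simp
    then have "\<exists>m. m > 0 \<and> int m \<in> K"
      using k by (intro exI[of _ "nat \<bar>k\<bar>"]) (auto simp: abs_if)
    define m where "m = (LEAST m. m > 0 \<and> int m \<in> K)"
    have m: "m > 0" "int m \<in> K"
      using LeastI_ex[OF \<open>\<exists>m. m > 0 \<and> int m \<in> K\<close>] by (auto simp: m_def)
    have "int m dvd x" if x: "x \<in> K" for x
    proof -
      have "x mod int m = x + (- (x div int m)) * int m" using minus_div_mult_eq_mod[of x "int m"] by simp
      also have "\<dots> \<in> K" by (intro KD(3) x KD(6) m)
      finally have "int (nat (x mod int m)) \<in> K" using m(1) by simp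
      then have "x mod int m \<le> 0"
        using not_less_Least[of "nat (x mod int m)" "\<lambda>m. m > 0 \<and> int m \<in> K"] m(1)
        by (auto simp: m_def[symmetric] nat_less_iff)
      moreover have "x mod int m \<ge> 0" using m(1) by simp
      ultimately show ?thesis by (simp only: dvd_eq_mod_eq_0 order_antisym)
    qed
    then show ?thesis using that[of "int m"] m by simp
  qed (use that[of 0] in auto)
qed

text \<open>Ideals of the integers are principal, so \<open>f\<close> is determined by its value at
  a generator \<open>n\<close>. Divisibility provides an \<open>n\<close>-th root \<open>d\<close>
  of that value, and \<open>k \<mapsto> d powi k\<close> extends \<open>f\<close>. For the zero
  ideal, \<open>d = 1\<close> is taken.\<close>

lemma unity_roots_module_injective:
  "relatively_injective \<Z> (regular_module \<Z>) unity_roots_module"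
  unfolding relatively_injective_def
proof (intro allI impI)
  fix K f assume "submodule K \<Z> (regular_module \<Z>)"
    and f: "f \<in> module_hom_set \<Z> (regular_module \<Z>\<lparr>carrier := K\<rparr>) unity_roots_module"
  then have K: "ideal K \<Z>" by (simp add: cring.submodule_regular_iff[OF int_is_cring])
  note fD = module_hom_setD[OF f, simplified, unfolded unity_roots_module_def, simplified]
  obtain n where n: "n \<in> K" "n \<ge> 0" "\<And>k. k \<in> K \<Longrightarrow> n dvd k" using int_ideal_principal[OF K] by metis
  obtain d where d: "d \<in> unity_roots" "d powi n = f n"
  proof (cases "n = 0")
    case True
    have "f (0 + 0) = f 0 * f 0" using fD(2)[of 0 0] n(1) True by simp
    then have "f 0 = 1" using fD(1)[of 0] n(1) True unity_roots_nonzero[of "f 0"] by simp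
    then show ?thesis using that[of 1] True one_unity_roots by simp
  next
    case False
    then have "nat n > 0" using n(2) by simp
    then obtain d where "d \<in> unity_roots" "d ^ nat n = f n"
      using unity_roots_divisible fD(1)[OF n(1)] by metis
    then show ?thesis using that n(2) by (simp add: power_int_nonneg_exp)
  qed
  show "\<exists>g\<in>module_hom_set \<Z> (regular_module \<Z>) unity_roots_module. \<forall>x\<in>K. g x = f x"
  proof (intro bexI ballI)
    show "(\<lambda>k. d powi k) \<in> module_hom_set \<Z> (regular_module \<Z>) unity_roots_module"
      using d(1) unity_roots_nonzero[OF d(1)]
      by (intro module_hom_setI)
        (auto simp: unity_roots_module_def powi_unity_roots power_int_add power_int_mult[symmetric] mult.commute)
    fix x assume "x \<in> K"
    then obtain q where q: "x = q * n" using n(3) by (metis dvdE mult.commute)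
    have "f x = f n powi q" using fD(3)[of n q] n(1) by (simp add: q)
    then show "d powi x = f x" by (simp add: d(2)[symmetric] power_int_mult[symmetric] q mult.commute)
  qed
qed

definition additive_character :: "('a, 'c) ring_scheme \<Rightarrow> 'a set \<Rightarrow> ('a \<Rightarrow> complex) \<Rightarrow> bool" where
  "additive_character R K \<chi> \<longleftrightarrow> (\<forall>x\<in>K. \<chi> x \<in> unity_roots) \<and>
     (\<forall>x\<in>K. \<forall>y\<in>K. \<chi> (x \<oplus>\<^bsub>R\<^esub> y) = \<chi> x * \<chi> y)"

text \<open>The additive group as a module over the integers, so that Baer's criterion over the
  integers yields extensions of characters.\<close>

definition int_module :: "('a, 'c) ring_scheme \<Rightarrow> (int, 'a) module" where
  "int_module R = \<lparr>carrier = carrier R, monoid.mult = monoid.mult R, one = one R,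
     ring.zero = ring.zero R, ring.add = ring.add R, smult = (\<lambda>k x. add_pow R k x)\<rparr>"

context cring
begin

lemma add_pow_int_zero: "add_pow R (0::int) x = \<zero>"
  by (simp add: add_pow_def)

lemma int_module_module: "module \<Z> (int_module R)"
proof (rule moduleI)
  show "abelian_group (int_module R)"
    by (rule abelian_groupI) (auto simp: int_module_def a_ac intro: l_neg)
qed (auto simp: int_module_def int_is_cring add.int_pow_mult add.int_pow_distrib add.int_pow_pow mult.commute)

text \<open>A character is only required to turn sums into products; this supplies the linearity
  over the integers that \<open>module_hom_set\<close> asks for.\<close>

lemma additive_character_add_pow:
  assumes K: "subgroup K (add_monoid R)" and \<phi>: "additive_character R K \<phi>" and x: "x \<in> K"
  shows "\<phi> (add_pow R (k::int) x) = \<phi> x powi k"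
proof -
  have KR: "K \<subseteq> carrier R" using subgroup.subset[OF K] by simp
  have K0: "\<zero> \<in> K" using subgroup.one_closed[OF K] by simp
  have nz: "\<phi> y \<noteq> 0" if "y \<in> K" for y using \<phi> that unity_roots_nonzero by (simp add: additive_character_def)
  have pK: "add_pow R (j::int) y \<in> K" if "y \<in> K" for y j
    using add.subgroup_int_pow_closed[OF K that] by simp
  have "\<phi> (\<zero> \<oplus> \<zero>) = \<phi> \<zero> * \<phi> \<zero>" using \<phi> K0 unfolding additive_character_def by blast
  then have \<phi>0: "\<phi> \<zero> = 1" using nz[OF K0] by simp
  have nat: "\<phi> (add_pow R (int n) y) = \<phi> y ^ n" if y: "y \<in> K" for y n
  proof (induction n)
    case (Suc n)
    have "add_pow R (int (Suc n)) y = add_pow R (int n) y \<oplus> add_pow R (1::int) y"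
      using y KR by (subst add.int_pow_mult[symmetric]) (auto simp: algebra_simps)
    then show ?case using Suc pK[OF y, of "int n"] y KR \<phi> by (auto simp: additive_character_def)
  qed (use y \<phi>0 in \<open>simp add: add_pow_int_zero\<close>)
  have neg: "\<phi> (add_pow R (- int n) x) = inverse (\<phi> x ^ n)" for n
  proof -
    have "add_pow R (- int n) x \<oplus> add_pow R (int n) x = \<zero>"
      using x KR by (subst add.int_pow_mult[symmetric]) (auto simp: add_pow_int_zero)
    then have "\<phi> (add_pow R (- int n) x) * \<phi> x ^ n = 1"
      using \<phi> pK[OF x] \<phi>0 nat[OF x] unfolding additive_character_def by metis
    then show ?thesis by (metis inverse_unique mult.commute)
  qed
  show ?thesis
  proof (cases k rule: int_cases2)
    case (nonneg n)
    then show ?thesis using nat[OF x] by simp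
  next
    case (nonpos n)
    then show ?thesis using neg by (simp add: power_int_minus)
  qed
qed

text \<open>The roots of unity form an injective module over the integers, so Baer's criterion
  applies to the additive group of \<open>R\<close>.\<close>

lemma additive_character_extend:
  assumes K: "subgroup K (add_monoid R)" and \<phi>: "additive_character R K \<phi>"
  obtains \<psi> where "additive_character R (carrier R) \<psi>" "\<And>x. x \<in> K \<Longrightarrow> \<psi> x = \<phi> x"
proof -
  interpret Z: module \<Z> "int_module R" by (rule int_module_module)
  have KR: "K \<subseteq> carrier R" using subgroup.subset[OF K] by simp
  have "subgroup K (add_monoid (int_module R))"
    using K by (simp add: subgroup_def int_module_def m_inv_def)
  then have "submodule K \<Z> (int_module R)"
    using add.subgroup_int_pow_closed[OF K]
    by (simp add: submodule_def submodule_axioms_def int_module_def)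
  moreover have "\<phi> \<in> module_hom_set \<Z> (int_module R\<lparr>carrier := K\<rparr>) unity_roots_module"
    using \<phi> additive_character_add_pow[OF K \<phi>]
    by (intro module_hom_setI) (simp_all add: int_module_def unity_roots_module_def additive_character_def)
  ultimately obtain \<psi> where \<psi>: "\<psi> \<in> module_hom_set \<Z> (int_module R) unity_roots_module" "\<And>x. x \<in> K \<Longrightarrow> \<psi> x = \<phi> x"
    using Baer_criterion[OF unity_roots_module Z.module_axioms unity_roots_module_injective]
    unfolding relatively_injective_def by blast
  have "additive_character R (carrier R) \<psi>"
    using module_hom_setD[OF \<psi>(1)] by (simp add: additive_character_def int_module_def unity_roots_module_def)
  then show ?thesis using that \<psi>(2) by blast
qed

text \<open>The class of \<open>1\<close> generates a nontrivial cyclic subgroup of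
  \<open>R / A\<close>, of order \<open>n\<close>, or infinite if \<open>n = 0\<close>. A character
  that is nontrivial on the generator is defined on \<open>K\<close>, the sum of \<open>A\<close>
  and the multiples of \<open>1\<close>, and then extended to \<open>R\<close>.\<close>

lemma separating_character:
  assumes A: "ideal A R" "\<one> \<notin> A"
  obtains \<psi> where "additive_character R (carrier R) \<psi>" "\<And>x. x \<in> A \<Longrightarrow> \<psi> x = 1" "\<psi> \<one> \<noteq> 1"
proof -
  note AD = ideal_props[OF A(1)]
  have one: "add_pow R (k::int) \<one> \<in> carrier R" for k by simp
  define J where "J = {k::int. add_pow R k \<one> \<in> A}"
  have "ideal J \<Z>"
  proof (rule cring.idealI'[OF int_is_cring], simp_all add: J_def AD(2) add_pow_int_zero)
    show "add_pow R (x + y) \<one> \<in> A" if "add_pow R x \<one> \<in> A" "add_pow R y \<one> \<in> A" for x y :: int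
      using that AD(3) by (simp add: add.int_pow_mult)
    show "add_pow R (r * x) \<one> \<in> A" if "add_pow R x \<one> \<in> A" for r x :: int
      using that AD(6)[OF that, of "add_pow R r \<one>"] by (simp add: add_pow_ldistr_int add.int_pow_pow mult.commute)
  qed
  then obtain n where n: "n \<in> J" "n \<ge> 0" "\<And>k. k \<in> J \<Longrightarrow> n dvd k" using int_ideal_principal by metis
  have "n \<noteq> 1" using n(1) A(2) by (auto simp: J_def)
  \<comment> \<open>The image of the generator must have order dividing \<open>n\<close>. Infinite
    order imposes nothing, and \<open>- 1\<close> is taken as a root of unity other than
    \<open>1\<close>.\<close>
  obtain c where c: "c \<in> unity_roots" "c \<noteq> 1" "c powi n = 1"
  proof (cases "n = 0")
    case True
    have "- 1 \<in> unity_roots" unfolding unity_roots_def by (auto intro!: exI[of _ 2])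
    then show ?thesis using that[of "- 1"] True by simp
  next
    case False
    then have n2: "nat n > 1" using n(2) \<open>n \<noteq> 1\<close> by linarith
    have "card {z::complex. z ^ nat n = 1} = nat n" using n2 by (intro card_nth_roots) auto
    moreover have "finite {1::complex}" "card {1::complex} = 1" by simp_all
    ultimately have "\<not> {z::complex. z ^ nat n = 1} \<subseteq> {1}"
      using n2 card_mono[of "{1::complex}" "{z. z ^ nat n = 1}"] by linarith
    then obtain z :: complex where "z ^ nat n = 1" "z \<noteq> 1" by blast
    moreover have "z \<in> unity_roots"
      using \<open>z ^ nat n = 1\<close> n2 unfolding unity_roots_def by (auto intro!: exI[of _ "nat n"])
    ultimately show ?thesis using that[of z] n(2) by (simp add: power_int_nonneg_exp)
  qed
  have cJ: "c powi k = 1" if k: "k \<in> J" for k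
  proof -
    obtain j where "k = n * j" using n(3)[OF k] by (elim dvdE)
    then have "c powi k = (c powi n) powi j" by (simp only: power_int_mult)
    then show ?thesis using c(3) by simp
  qed
  define K where "K = {r \<in> carrier R. \<exists>k::int. r \<ominus> add_pow R k \<one> \<in> A}"
  \<comment> \<open>Two admissible exponents differ by an element of \<open>J\<close>, so by
    \<open>cJ\<close> the choice does not affect the power of \<open>c\<close>.\<close>
  define \<phi> where "\<phi> r = c powi (SOME k. r \<ominus> add_pow R k \<one> \<in> A)" for r
  have \<phi>: "\<phi> r = c powi k" if r: "r \<in> carrier R" "r \<ominus> add_pow R k \<one> \<in> A" for r and k :: int
  proof -
    define j :: int where "j = (SOME k. r \<ominus> add_pow R k \<one> \<in> A)"
    have j: "r \<ominus> add_pow R j \<one> \<in> A" unfolding j_def by (rule someI) (rule r(2))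
    have "a \<ominus> b = (r \<ominus> b) \<ominus> (r \<ominus> a)" if "a \<in> carrier R" "b \<in> carrier R" for a b
      using r(1) that by algebra
    then have "add_pow R (j - k) \<one> = (r \<ominus> add_pow R k \<one>) \<ominus> (r \<ominus> add_pow R j \<one>)"
      using one by (simp add: add.int_pow_diff a_minus_def)
    then have "j - k \<in> J" using AD(5)[OF r(2) j] by (simp add: J_def)
    then have "c powi (j - k) = 1" by (rule cJ)
    then have "c powi j = c powi k"
      using unity_roots_nonzero[OF c(1)] by (simp add: power_int_diff)
    then show ?thesis by (simp add: \<phi>_def j_def)
  qed
  have sum: "(x \<oplus> y) \<ominus> add_pow R (k + l) \<one> \<in> A"
    if "x \<in> carrier R" "y \<in> carrier R" "x \<ominus> add_pow R k \<one> \<in> A" "y \<ominus> add_pow R l \<one> \<in> A" for x y and k l :: int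
  proof -
    have "(x \<oplus> y) \<ominus> (a \<oplus> b) = (x \<ominus> a) \<oplus> (y \<ominus> b)" if "a \<in> carrier R" "b \<in> carrier R" for a b
      using \<open>x \<in> carrier R\<close> \<open>y \<in> carrier R\<close> that by algebra
    then have "(x \<oplus> y) \<ominus> add_pow R (k + l) \<one> = (x \<ominus> add_pow R k \<one>) \<oplus> (y \<ominus> add_pow R l \<one>)"
      using one by (simp add: add.int_pow_mult)
    then show ?thesis using AD(3)[OF \<open>x \<ominus> add_pow R k \<one> \<in> A\<close> \<open>y \<ominus> add_pow R l \<one> \<in> A\<close>] by simp
  qed
  have AK: "x \<in> carrier R" "x \<ominus> add_pow R (0::int) \<one> \<in> A" if "x \<in> A" for x
    using that AD(1) by (auto simp: a_minus_def add_pow_int_zero)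
  have subK: "subgroup K (add_monoid R)"
  proof (rule add.subgroupI)
    show "K \<noteq> {}" using AK[OF AD(2)] by (auto simp: K_def)
    show "\<ominus> x \<in> K" if "x \<in> K" for x
    proof -
      obtain k :: int where k: "x \<in> carrier R" "x \<ominus> add_pow R k \<one> \<in> A" using \<open>x \<in> K\<close> by (auto simp: K_def)
      have "\<ominus> x \<ominus> (\<ominus> a) = \<ominus> (x \<ominus> a)" if "a \<in> carrier R" for a
        using k(1) that by algebra
      then have "\<ominus> x \<ominus> add_pow R (- k) \<one> = \<ominus> (x \<ominus> add_pow R k \<one>)"
        using one by (simp add: add.int_pow_neg)
      then have "\<ominus> x \<ominus> add_pow R (- k) \<one> \<in> A" using AD(4)[OF k(2)] by simp
      then show ?thesis using k(1) by (auto simp: K_def)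
    qed
    show "x \<oplus> y \<in> K" if "x \<in> K" "y \<in> K" for x y
      using that sum by (fastforce simp: K_def)
  qed (auto simp: K_def)
  moreover have "additive_character R K \<phi>"
    unfolding additive_character_def
  proof (intro conjI ballI)
    fix x assume "x \<in> K"
    then obtain k :: int where k: "x \<in> carrier R" "x \<ominus> add_pow R k \<one> \<in> A" by (auto simp: K_def)
    show "\<phi> x \<in> unity_roots" using \<phi>[OF k] powi_unity_roots[OF c(1)] by simp
    fix y assume "y \<in> K"
    then obtain l :: int where l: "y \<in> carrier R" "y \<ominus> add_pow R l \<one> \<in> A" by (auto simp: K_def)
    show "\<phi> (x \<oplus> y) = \<phi> x * \<phi> y"
      using \<phi>[OF _ sum[OF k(1) l(1) k(2) l(2)]] \<phi>[OF k] \<phi>[OF l] k l unity_roots_nonzero[OF c(1)]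
      by (simp add: power_int_add)
  qed
  ultimately obtain \<psi> where \<psi>: "additive_character R (carrier R) \<psi>" "\<And>x. x \<in> K \<Longrightarrow> \<psi> x = \<phi> x"
    using additive_character_extend by metis
  have "\<psi> x = 1" if "x \<in> A" for x
    using \<psi>(2)[of x] \<phi>[OF AK[OF that]] AK[OF that] by (auto simp: K_def)
  moreover have one_A: "\<one> \<ominus> add_pow R (1::int) \<one> \<in> A" using AD(2) by (simp add: a_minus_def r_neg)
  then have "\<one> \<in> K" unfolding K_def by blast
  then have "\<psi> \<one> = c" using \<psi>(2) \<phi>[OF one_closed one_A] by simp
  ultimately show ?thesis using that \<psi>(1) c(2) by blast
qed

end

subsection \<open>The character module of a quotient ring\<close>

text \<open>Hom(R / I, Q/Z), with a character of \<open>R / I\<close> represented by a character of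
  \<open>R\<close> that is trivial on \<open>I\<close>. Extensionality makes characters equal as
  soon as they agree on \<open>R\<close>, for the module laws as well as for counting.\<close>

definition character_module :: "('a, 'c) ring_scheme \<Rightarrow> 'a set \<Rightarrow> ('a, 'a \<Rightarrow> complex) module" where
  "character_module R I =
    \<lparr>carrier = {\<chi> \<in> extensional (carrier R). additive_character R (carrier R) \<chi> \<and> (\<forall>x\<in>I. \<chi> x = 1)},
     monoid.mult = undefined, one = undefined, ring.zero = (\<lambda>x\<in>carrier R. 1),
     ring.add = (\<lambda>\<chi> \<psi>. \<lambda>x\<in>carrier R. \<chi> x * \<psi> x),
     smult = (\<lambda>r \<chi>. \<lambda>x\<in>carrier R. \<chi> (r \<otimes>\<^bsub>R\<^esub> x))\<rparr>"

lemma (in cring) character_module_module: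
  assumes I: "ideal I R"
  shows "module R (character_module R I)"
proof -
  note ID = ideal_props[OF I]
  have rI: "(\<lambda>x\<in>carrier R. f x) y = f y" if "y \<in> I" for f y
    using that ID(1) by simp
  show ?thesis
  proof (rule moduleI)
    show "abelian_group (character_module R I)"
    proof (rule abelian_groupI)
      fix \<chi> assume \<chi>: "\<chi> \<in> carrier (character_module R I)"
      define \<psi> where "\<psi> = (\<lambda>x\<in>carrier R. \<chi> x powi (-1))"
      have "\<psi> \<in> carrier (character_module R I)"
        using \<chi> ID(1) by (auto simp: \<psi>_def character_module_def additive_character_def rI
            inverse_unity_roots power_int_minus)
      moreover have "\<psi> \<oplus>\<^bsub>character_module R I\<^esub> \<chi> = \<zero>\<^bsub>character_module R I\<^esub>"
        using \<chi> unity_roots_nonzero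
        by (auto simp: \<psi>_def character_module_def additive_character_def power_int_minus fun_eq_iff restrict_def)
      ultimately show "\<exists>\<psi>\<in>carrier (character_module R I). \<psi> \<oplus>\<^bsub>character_module R I\<^esub> \<chi> = \<zero>\<^bsub>character_module R I\<^esub>"
        by blast
    next
      fix \<chi> \<psi> assume "\<chi> \<in> carrier (character_module R I)" "\<psi> \<in> carrier (character_module R I)"
      then show "\<chi> \<oplus>\<^bsub>character_module R I\<^esub> \<psi> \<in> carrier (character_module R I)"
        using ID(1) by (auto simp: character_module_def additive_character_def mult_unity_roots)
    next
      show "\<zero>\<^bsub>character_module R I\<^esub> \<in> carrier (character_module R I)"
        using ID(1) by (auto simp: character_module_def additive_character_def one_unity_roots)
    next
      fix \<chi> assume "\<chi> \<in> carrier (character_module R I)"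
      then have "\<chi> \<in> extensional (carrier R)" by (simp add: character_module_def)
      then show "\<zero>\<^bsub>character_module R I\<^esub> \<oplus>\<^bsub>character_module R I\<^esub> \<chi> = \<chi>"
        by (intro extensionalityI[of _ "carrier R"]) (simp_all add: character_module_def)
    qed (simp_all add: character_module_def ac_simps cong: restrict_cong)
  next
    fix \<chi> assume "\<chi> \<in> carrier (character_module R I)"
    then have "\<chi> \<in> extensional (carrier R)" by (simp add: character_module_def)
    then show "\<one> \<odot>\<^bsub>character_module R I\<^esub> \<chi> = \<chi>"
      by (intro extensionalityI[of _ "carrier R"]) (simp_all add: character_module_def)
  next
    fix r \<chi> assume "r \<in> carrier R" "\<chi> \<in> carrier (character_module R I)"
    then show "r \<odot>\<^bsub>character_module R I\<^esub> \<chi> \<in> carrier (character_module R I)"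
      using ID(1,6) by (simp add: character_module_def additive_character_def r_distr)
    fix s assume "s \<in> carrier R"
    then show "(r \<oplus> s) \<odot>\<^bsub>character_module R I\<^esub> \<chi> =
        r \<odot>\<^bsub>character_module R I\<^esub> \<chi> \<oplus>\<^bsub>character_module R I\<^esub> s \<odot>\<^bsub>character_module R I\<^esub> \<chi>"
      using \<open>r \<in> carrier R\<close> \<open>\<chi> \<in> carrier (character_module R I)\<close>
      by (simp add: character_module_def additive_character_def l_distr cong: restrict_cong)
    show "(r \<otimes> s) \<odot>\<^bsub>character_module R I\<^esub> \<chi> =
        r \<odot>\<^bsub>character_module R I\<^esub> (s \<odot>\<^bsub>character_module R I\<^esub> \<chi>)"
      using \<open>r \<in> carrier R\<close> \<open>s \<in> carrier R\<close>
      by (simp add: character_module_def m_ac cong: restrict_cong)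
  qed (simp_all add: character_module_def cring_axioms cong: restrict_cong)
qed

text \<open>A character is determined by its graph, and the roots of unity are countable. For finite
  \<open>R\<close> the graphs are finite subsets of a countable set, which an infinite universe can
  hold. For infinite \<open>R\<close> the pairs of a ring element and a root of unity embed into
  \<open>R\<close>, so that graphs become subsets of \<open>R\<close>. These are the two conditions
  in \<open>large_universe\<close>.\<close>

lemma character_module_lepoll:
  assumes "large_universe TYPE('m) R"
  shows "carrier (character_module R I) \<lesssim> (UNIV :: 'm set)"
proof -
  have inf: "infinite (UNIV :: 'm set)" and pow: "Pow (carrier R) \<lesssim> (UNIV :: 'm set)"
    using assms by (auto simp: large_universe_def)
  define graph :: "('a \<Rightarrow> complex) \<Rightarrow> ('a \<times> complex) set"
    where "graph \<chi> = (\<lambda>x. (x, \<chi> x)) ` carrier R" for \<chi>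
  have inj: "inj_on graph (carrier (character_module R I))"
  proof (rule inj_onI)
    fix \<chi> \<psi> assume "\<chi> \<in> carrier (character_module R I)" "\<psi> \<in> carrier (character_module R I)"
      and "graph \<chi> = graph \<psi>"
    then show "\<chi> = \<psi>"
      by (intro extensionalityI[of _ "carrier R"]) (auto simp: character_module_def graph_def)
  qed
  have graph: "graph ` carrier (character_module R I) \<subseteq> Pow (carrier R \<times> unity_roots)"
    by (auto simp: graph_def character_module_def additive_character_def)
  show ?thesis
  proof (cases "finite (carrier R)")
    case True
    then have "graph ` carrier (character_module R I) \<subseteq> Fpow (carrier R \<times> unity_roots)"
      using graph by (auto simp: Fpow_def graph_def)
    moreover have "countable (Fpow (carrier R \<times> unity_roots))"
      using True by (intro countable_Fpow countable_SIGMA countable_unity_roots countable_finite)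
    ultimately have "countable (carrier (character_module R I))"
      using countable_image_inj_on[OF _ inj] countable_subset by blast
    then have "carrier (character_module R I) \<lesssim> (UNIV :: nat set)"
      by (auto simp: lepoll_def countable_def)
    also have "\<dots> \<lesssim> (UNIV :: 'm set)" using inf by (simp add: infinite_le_lepoll)
    finally show ?thesis .
  next
    case False
    have "unity_roots \<lesssim> (UNIV :: nat set)"
      using countable_unity_roots by (auto simp: lepoll_def countable_def)
    also have "\<dots> \<lesssim> carrier R" using False by (simp add: infinite_le_lepoll)
    finally have "carrier R \<times> unity_roots \<lesssim> carrier R \<times> carrier R"
      by (intro times_lepoll_mono) auto
    also have "\<dots> \<approx> carrier R"
      using card_of_Times_same_infinite[OF False] by (simp add: eqpoll_iff_card_of_ordIso)
    finally obtain j where j: "inj_on j (carrier R \<times> unity_roots)" "j ` (carrier R \<times> unity_roots) \<subseteq> carrier R"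
      by (auto simp: lepoll_def)
    have "inj_on (\<lambda>\<chi>. j ` graph \<chi>) (carrier (character_module R I))"
    proof (rule inj_onI)
      fix \<chi> \<psi> assume \<chi>: "\<chi> \<in> carrier (character_module R I)" and \<psi>: "\<psi> \<in> carrier (character_module R I)"
        and "j ` graph \<chi> = j ` graph \<psi>"
      then have "graph \<chi> = graph \<psi>"
        using graph by (subst (asm) inj_on_image_eq_iff[OF j(1)]) blast+
      then show "\<chi> = \<psi>" using inj \<chi> \<psi> by (simp add: inj_on_eq_iff)
    qed
    moreover have "(\<lambda>\<chi>. j ` graph \<chi>) ` carrier (character_module R I) \<subseteq> Pow (carrier R)"
      using j(2) graph by blast
    ultimately have "carrier (character_module R I) \<lesssim> Pow (carrier R)" unfolding lepoll_def by blast
    then show ?thesis using pow by (rule lepoll_trans)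
  qed
qed


subsection \<open>Quotient modules\<close>

definition quotient_module :: "('a, 'c) ring_scheme \<Rightarrow> 'a set \<Rightarrow> ('a, 'a set) module" where
  "quotient_module R I = \<lparr>carrier = carrier (R Quot I), monoid.mult = monoid.mult (R Quot I),
     one = one (R Quot I), ring.zero = ring.zero (R Quot I), ring.add = ring.add (R Quot I),
     smult = (\<lambda>r Y. (I +>\<^bsub>R\<^esub> r) \<otimes>\<^bsub>R Quot I\<^esub> Y)\<rparr>"

text \<open>This says that \<open>R / I\<close> is a semisimple ring.\<close>

definition semisimple_quotient :: "('a, 'c) ring_scheme \<Rightarrow> 'a set \<Rightarrow> bool" where
  "semisimple_quotient R I \<longleftrightarrow> (\<forall>J. ideal J R \<and> I \<subseteq> J \<longrightarrow>
     (\<exists>L. ideal L R \<and> J \<inter> L \<subseteq> I \<and> (\<exists>j\<in>J. \<exists>l\<in>L. \<one>\<^bsub>R\<^esub> = j \<oplus>\<^bsub>R\<^esub> l)))"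

lemma submodule_vimage:
  assumes "module R N" "module R N'" and f: "f \<in> module_hom_set R N N'" and K: "submodule K R N'"
  shows "submodule {x \<in> carrier N. f x \<in> K} R N"
proof -
  interpret N: module R N by fact
  interpret N': module R N' by fact
  note fD = module_hom_setD[OF f] and KE = N'.submoduleE[OF K]
  have neg: "f (\<ominus>\<^bsub>N\<^esub> x) = \<ominus>\<^bsub>N'\<^esub> f x" if x: "x \<in> carrier N" for x
  proof -
    have "f (\<ominus>\<^bsub>N\<^esub> x) \<oplus>\<^bsub>N'\<^esub> f x = f (\<ominus>\<^bsub>N\<^esub> x \<oplus>\<^bsub>N\<^esub> x)" using x by (simp add: fD)
    also have "\<dots> = \<zero>\<^bsub>N'\<^esub>"
      using x module_hom_set_zero[OF assms(1-3)] by (simp add: N.l_neg)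
    finally show ?thesis by (intro N'.minus_equality[symmetric]) (use x fD in auto)
  qed
  show ?thesis
    by (rule N.submoduleI)
      (use KE neg fD module_hom_set_zero[OF assms(1-3)] N'.submodule_zero[OF K] in auto)
qed

lemma (in module) hom_eq_if_kernel:
  assumes N: "module R N" and g: "g \<in> module_hom_set R N M"
    and xy: "x \<in> carrier N" "y \<in> carrier N" "g (x \<ominus>\<^bsub>N\<^esub> y) = \<zero>\<^bsub>M\<^esub>"
  shows "g x = g y"
proof -
  interpret N: module R N by fact
  note gD = module_hom_setD[OF g]
  have "g x = g (y \<oplus>\<^bsub>N\<^esub> (x \<ominus>\<^bsub>N\<^esub> y))"
    using xy(1,2) by (simp add: a_minus_def N.a_lcomm N.r_neg)
  also have "\<dots> = g y" using xy gD by simp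
  finally show ?thesis .
qed

context cring
begin

lemma regular_minus:
  assumes "x \<in> carrier R" "y \<in> carrier R"
  shows "x \<ominus>\<^bsub>regular_module R\<^esub> y = x \<ominus> y"
proof -
  interpret Reg: module R "regular_module R" by (rule regular_module_module)
  have "\<ominus>\<^bsub>regular_module R\<^esub> y = \<ominus> y"
    by (rule Reg.minus_equality) (use assms in \<open>auto simp: l_neg\<close>)
  then show ?thesis by (simp add: a_minus_def)
qed

lemma quotient_module_props:
  assumes I: "ideal I R"
  shows quotient_module_module: "module R (quotient_module R I)"
    and quotient_proj: "(\<lambda>r. I +> r) \<in> module_hom_set R (regular_module R) (quotient_module R I)"
    and quotient_carrier: "carrier (quotient_module R I) = (\<lambda>r. I +> r) ` carrier R"
    and quotient_zero_iff: "r \<in> carrier R \<Longrightarrow> I +> r = \<zero>\<^bsub>quotient_module R I\<^esub> \<longleftrightarrow> r \<in> I"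
proof -
  interpret I: ideal I R by fact
  interpret Q: cring "R Quot I" by (rule I.quotient_is_cring[OF cring_axioms])
  have hom: "(\<lambda>r. I +> r) \<in> ring_hom R (R Quot I)" by (rule I.rcos_ring_hom)
  note hD = ring_hom_memE[OF hom]
  show "module R (quotient_module R I)"
  proof (rule moduleI)
    show "abelian_group (quotient_module R I)"
      by (rule abelian_groupI) (auto simp: quotient_module_def Q.a_ac intro: Q.l_neg)
  qed (use hD in \<open>auto simp: quotient_module_def cring_axioms Q.l_distr Q.r_distr Q.m_assoc\<close>)
  show "(\<lambda>r. I +> r) \<in> module_hom_set R (regular_module R) (quotient_module R I)"
    by (rule module_hom_setI) (use hD in \<open>auto simp: quotient_module_def\<close>)
  show "carrier (quotient_module R I) = (\<lambda>r. I +> r) ` carrier R"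
    by (auto simp: quotient_module_def FactRing_def A_RCOSETS_def')
  show "I +> r = \<zero>\<^bsub>quotient_module R I\<^esub> \<longleftrightarrow> r \<in> I" if "r \<in> carrier R"
    using I.rcos_const_imp_mem[OF that] a_rcos_zero[OF I]
    by (auto simp: quotient_module_def FactRing_def)
qed

text \<open>Moves the extension problem from cosets to \<open>R\<close>: submodules of
  \<open>R / I\<close> are ideals above \<open>I\<close>, and homomorphisms on them are those that
  vanish on \<open>I\<close>. The extension inherits this vanishing from \<open>F\<close>, so it
  descends to \<open>R / I\<close>.\<close>

lemma quotient_relatively_injectiveI:
  assumes I: "ideal I R" and M: "module R M"
    and ext: "\<And>J F. \<lbrakk>ideal J R; I \<subseteq> J; F \<in> module_hom_set R (regular_module R\<lparr>carrier := J\<rparr>) M;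
       \<And>x. x \<in> I \<Longrightarrow> F x = \<zero>\<^bsub>M\<^esub>\<rbrakk> \<Longrightarrow> \<exists>G\<in>module_hom_set R (regular_module R) M. \<forall>x\<in>J. G x = F x"
  shows "relatively_injective R (quotient_module R I) M"
  unfolding relatively_injective_def
proof (intro allI impI)
  let ?Q = "quotient_module R I"
  note Q = quotient_module_module[OF I] and reg = regular_module_module
  note piD = module_hom_setD[OF quotient_proj[OF I], simplified]
  interpret Q: module R ?Q by (rule Q)
  interpret M: module R M by (rule M)
  fix K f assume K: "submodule K R ?Q" and f: "f \<in> module_hom_set R (?Q\<lparr>carrier := K\<rparr>) M"
  note fD = module_hom_setD[OF f, simplified]
  define J where "J = {r \<in> carrier R. I +> r \<in> K}"
  have J: "ideal J R"
    using submodule_vimage[OF reg Q quotient_proj[OF I] K] by (simp add: J_def submodule_regular_iff)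
  have IJ: "I \<subseteq> J"
  proof
    fix i assume "i \<in> I"
    then have "i \<in> carrier R" "I +> i = \<zero>\<^bsub>?Q\<^esub>"
      using ideal_props(1)[OF I] quotient_zero_iff[OF I] by auto
    then show "i \<in> J" using Q.submodule_zero[OF K] by (simp add: J_def)
  qed
  have f0: "f \<zero>\<^bsub>?Q\<^esub> = \<zero>\<^bsub>M\<^esub>"
    using module_hom_set_zero[OF submodule.submodule_is_module[OF K Q] M f] by simp
  have "(\<lambda>r. f (I +> r)) \<in> module_hom_set R (regular_module R\<lparr>carrier := J\<rparr>) M"
    by (rule module_hom_setI) (use fD piD in \<open>auto simp: J_def\<close>)
  moreover have F0: "f (I +> i) = \<zero>\<^bsub>M\<^esub>" if "i \<in> I" for i
    using that f0 quotient_zero_iff[OF I, of i] ideal_props(1)[OF I that] by simp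
  ultimately obtain G where G: "G \<in> module_hom_set R (regular_module R) M" "\<And>x. x \<in> J \<Longrightarrow> G x = f (I +> x)"
    using ext[OF J IJ] by metis
  note GD = module_hom_setD[OF G(1), simplified]
  define g where "g Y = G (SOME r. r \<in> carrier R \<and> I +> r = Y)" for Y
  have g: "g (I +> r) = G r" if r: "r \<in> carrier R" for r
  proof -
    define s where "s = (SOME s. s \<in> carrier R \<and> I +> s = I +> r)"
    have s: "s \<in> carrier R" "I +> s = I +> r"
      using someI[of "\<lambda>s. s \<in> carrier R \<and> I +> s = I +> r" r] r unfolding s_def by auto
    have "I +> (s \<ominus> r) = (I +> s) \<oplus>\<^bsub>?Q\<^esub> ((\<ominus> \<one>) \<odot>\<^bsub>?Q\<^esub> (I +> r))"
      using r s(1) piD(2)[of s "\<ominus> r"] piD(3)[of "\<ominus> \<one>" r] by (simp add: a_minus_def l_minus)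
    also have "\<dots> = \<zero>\<^bsub>?Q\<^esub>" using s r piD(1)[of r] by (simp add: Q.smult_l_minus Q.r_neg)
    finally have "s \<ominus> r \<in> I" using quotient_zero_iff[OF I, of "s \<ominus> r"] r s by simp
    then have "G (s \<ominus> r) = \<zero>\<^bsub>M\<^esub>" using G(2) F0 IJ by auto
    then have "G s = G r"
      using M.hom_eq_if_kernel[OF reg G(1), of s r] r s by (simp add: regular_minus)
    then show ?thesis by (simp add: g_def s_def)
  qed
  show "\<exists>g\<in>module_hom_set R ?Q M. \<forall>x\<in>K. g x = f x"
  proof (intro bexI ballI)
    show "g \<in> module_hom_set R ?Q M"
    proof (rule module_hom_setI)
      fix Y assume "Y \<in> carrier ?Q"
      then obtain y where y: "y \<in> carrier R" "Y = I +> y" using quotient_carrier[OF I] by auto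
      then show "g Y \<in> carrier M" using g GD(1) by simp
      {
        fix Z assume "Z \<in> carrier ?Q"
        then obtain z where z: "z \<in> carrier R" "Z = I +> z" using quotient_carrier[OF I] by auto
        have "g (Y \<oplus>\<^bsub>?Q\<^esub> Z) = g (I +> (y \<oplus> z))" using y z piD(2) by simp
        then show "g (Y \<oplus>\<^bsub>?Q\<^esub> Z) = g Y \<oplus>\<^bsub>M\<^esub> g Z" using y z g GD(2) by simp
      }
      fix r assume r: "r \<in> carrier R"
      have "g (r \<odot>\<^bsub>?Q\<^esub> Y) = g (I +> (r \<otimes> y))" using y r piD(3) by simp
      then show "g (r \<odot>\<^bsub>?Q\<^esub> Y) = r \<odot>\<^bsub>M\<^esub> g Y" using y r g GD(3) by simp
    qed
    fix Y assume Y: "Y \<in> K"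
    then obtain y where y: "y \<in> carrier R" "Y = I +> y"
      using quotient_carrier[OF I] Q.submoduleE(1)[OF K] by auto
    then show "g Y = f Y" using Y g[OF y(1)] G(2)[of y] by (simp add: J_def)
  qed
qed

lemma complemented_quotient_module:
  assumes I: "ideal I R" and compl: "complemented_module R (quotient_module R I)"
  shows "semisimple_quotient R I"
  unfolding semisimple_quotient_def
proof (intro allI impI, elim conjE)
  let ?Q = "quotient_module R I" and ?\<pi> = "\<lambda>r. I +> r"
  note Q = quotient_module_module[OF I] and reg = regular_module_module
  note piD = module_hom_setD[OF quotient_proj[OF I], simplified]
  interpret Q: module R ?Q by (rule Q)
  interpret Reg: module R "regular_module R" by (rule reg)
  fix J assume J: "ideal J R" "I \<subseteq> J"
  note JD = ideal_props[OF J(1)]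
  have "submodule (?\<pi> ` J) R ?Q"
    by (rule submodule_image[OF reg Q quotient_proj[OF I]]) (simp add: submodule_regular_iff J)
  from compl[unfolded complemented_module_def, rule_format, OF this]
  obtain L' where L': "submodule L' R ?Q" "?\<pi> ` J \<inter> L' = {\<zero>\<^bsub>?Q\<^esub>}"
    "\<forall>x\<in>carrier ?Q. \<exists>k\<in>?\<pi> ` J. \<exists>l\<in>L'. x = k \<oplus>\<^bsub>?Q\<^esub> l"
    by (elim exE conjE)
  define L where "L = {r \<in> carrier R. I +> r \<in> L'}"
  have L: "ideal L R"
    using submodule_vimage[OF reg Q quotient_proj[OF I] L'(1)] by (simp add: L_def submodule_regular_iff)
  have "J \<inter> L \<subseteq> I"
  proof
    fix r assume r: "r \<in> J \<inter> L"
    then have "I +> r \<in> ?\<pi> ` J \<inter> L'" by (auto simp: L_def)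
    then show "r \<in> I" using L'(2) quotient_zero_iff[OF I, of r] r by (auto simp: L_def)
  qed
  moreover have "\<exists>j\<in>J. \<exists>l\<in>L. \<one> = j \<oplus> l"
  proof -
    obtain j l' where j: "j \<in> J" "l' \<in> L'" "I +> \<one> = (I +> j) \<oplus>\<^bsub>?Q\<^esub> l'"
      using bspec[OF L'(3) piD(1)[OF one_closed]] by blast
    obtain l where l: "l \<in> carrier R" "l' = I +> l"
      using j(2) Q.submoduleE(1)[OF L'(1)] quotient_carrier[OF I] by auto
    have "I +> (\<one> \<ominus> (j \<oplus> l)) = (I +> \<one>) \<oplus>\<^bsub>?Q\<^esub> ((\<ominus> \<one>) \<odot>\<^bsub>?Q\<^esub> ((I +> j) \<oplus>\<^bsub>?Q\<^esub> (I +> l)))"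
      using j(1) l(1) JD(1) piD(2)[of \<one> "\<ominus> (j \<oplus> l)"] piD(3)[of "\<ominus> \<one>" "j \<oplus> l"] piD(2)[of j l]
      by (simp add: a_minus_def l_minus)
    also have "\<dots> = \<zero>\<^bsub>?Q\<^esub>"
      using j(3) l piD(1)[OF one_closed] piD(1)[of j] piD(1)[OF l(1)] JD(1)[OF j(1)]
      by (simp add: Q.smult_l_minus Q.r_neg)
    finally have i: "\<one> \<ominus> (j \<oplus> l) \<in> I" using quotient_zero_iff[OF I] l JD(1)[OF j(1)] by simp
    \<comment> \<open>The complement gives \<open>1 = j + l\<close> only modulo \<open>I\<close>; as
      \<open>I\<close> lies in \<open>J\<close>, the error can be added to \<open>j\<close>.\<close>
    then have "j \<oplus> (\<one> \<ominus> (j \<oplus> l)) \<in> J" using JD(3)[OF j(1)] J(2) by blast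
    moreover have "l \<in> L" using l j(2) by (simp add: L_def)
    moreover have "\<one> = (j \<oplus> (\<one> \<ominus> (j \<oplus> l))) \<oplus> l" using l(1) JD(1)[OF j(1)] by algebra
    ultimately show ?thesis by blast
  qed
  ultimately show "\<exists>L. ideal L R \<and> J \<inter> L \<subseteq> I \<and> (\<exists>j\<in>J. \<exists>l\<in>L. \<one> = j \<oplus> l)" using L by blast
qed

text \<open>The principal ideal of \<open>x\<close> is isomorphic to \<open>R / Ann(x)\<close>, so a
  homomorphism on \<open>R\<close> that vanishes on \<open>Ann(x)\<close> descends along
  \<open>r \<mapsto> r x\<close>.\<close>

lemma hom_from_principal_ideal:
  assumes M: "module R M" and x: "x \<in> carrier R" and h: "h \<in> module_hom_set R (regular_module R) M"
    and ann: "\<And>r. \<lbrakk>r \<in> carrier R; r \<otimes> x = \<zero>\<rbrakk> \<Longrightarrow> h r = \<zero>\<^bsub>M\<^esub>"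
  obtains f where "f \<in> module_hom_set R (regular_module R\<lparr>carrier := PIdl x\<rparr>) M"
    "\<And>r. r \<in> carrier R \<Longrightarrow> f (r \<otimes> x) = h r"
proof -
  interpret M: module R M by (rule M)
  note hD = module_hom_setD[OF h, simplified]
  define f where "f y = h (SOME r. r \<in> carrier R \<and> r \<otimes> x = y)" for y
  have f: "f (r \<otimes> x) = h r" if r: "r \<in> carrier R" for r
  proof -
    define s where "s = (SOME s. s \<in> carrier R \<and> s \<otimes> x = r \<otimes> x)"
    have s: "s \<in> carrier R" "s \<otimes> x = r \<otimes> x"
      using someI[of "\<lambda>s. s \<in> carrier R \<and> s \<otimes> x = r \<otimes> x" r] r unfolding s_def by auto
    have "(s \<ominus> r) \<otimes> x = s \<otimes> x \<ominus> r \<otimes> x" using r s(1) x by algebra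
    then have "h (s \<ominus> r) = \<zero>\<^bsub>M\<^esub>" using r s x by (intro ann) (simp_all add: a_minus_def r_neg)
    then have "h s = h r"
      using M.hom_eq_if_kernel[OF regular_module_module h, of s r] r s by (simp add: regular_minus)
    then show ?thesis by (simp add: f_def s_def)
  qed
  have "f \<in> module_hom_set R (regular_module R\<lparr>carrier := PIdl x\<rparr>) M"
  proof (rule module_hom_setI, simp_all)
    fix y assume "y \<in> PIdl x"
    then obtain r where r: "r \<in> carrier R" "y = r \<otimes> x" by (auto simp: cgenideal_def)
    then show "f y \<in> carrier M" using f hD(1) by simp
    {
      fix z assume "z \<in> PIdl x"
      then obtain s where s: "s \<in> carrier R" "z = s \<otimes> x" by (auto simp: cgenideal_def)
      have "f (y \<oplus> z) = f ((r \<oplus> s) \<otimes> x)" using r s x by (simp add: l_distr)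
      then show "f (y \<oplus> z) = f y \<oplus>\<^bsub>M\<^esub> f z" using r s f hD(2) by simp
    }
    fix s assume s: "s \<in> carrier R"
    have "f (s \<otimes> y) = f ((s \<otimes> r) \<otimes> x)" using r s x by (simp add: m_assoc)
    then show "f (s \<otimes> y) = s \<odot>\<^bsub>M\<^esub> f y" using r s f hD(3) by simp
  qed
  then show ?thesis using that f by blast
qed

text \<open>Homomorphisms into a coinduced module are additive characters: evaluation at
  \<open>1\<close> turns \<open>F\<close> into the character \<open>\<phi>\<close> of
  \<open>J\<close>, and a character \<open>\<psi>\<close> of \<open>R\<close> turns back into
  \<open>r \<mapsto> (s \<mapsto> \<psi> (r s))\<close>. Extending \<open>F\<close> thus amounts to
  extending \<open>\<phi>\<close>.\<close>

lemma character_module_relatively_injective: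
  assumes I: "ideal I R"
  shows "relatively_injective R (quotient_module R I) (character_module R I)"
proof (rule quotient_relatively_injectiveI[OF I character_module_module[OF I]])
  let ?M = "character_module R I"
  fix J F assume J: "ideal J R" "I \<subseteq> J" and F: "F \<in> module_hom_set R (regular_module R\<lparr>carrier := J\<rparr>) ?M"
    and F0: "\<And>x. x \<in> I \<Longrightarrow> F x = \<zero>\<^bsub>?M\<^esub>"
  note JD = ideal_props[OF J(1)] and FD = module_hom_setD[OF F, simplified]
  define \<phi> where "\<phi> j = F j \<one>" for j
  have Fj: "F j \<in> extensional (carrier R)" "additive_character R (carrier R) (F j)" if "j \<in> J" for j
    using FD(1)[OF that] by (auto simp: character_module_def)
  have "additive_character R J \<phi>"
    unfolding additive_character_def
  proof (intro conjI ballI)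
    show "\<phi> x \<in> unity_roots" if "x \<in> J" for x
      using Fj(2)[OF that] by (simp add: \<phi>_def additive_character_def)
    show "\<phi> (x \<oplus> y) = \<phi> x * \<phi> y" if "x \<in> J" "y \<in> J" for x y
      using FD(2)[OF that] by (simp add: \<phi>_def character_module_def)
  qed
  moreover have "subgroup J (add_monoid R)"
    using J(1) by (simp add: ideal_def additive_subgroup_def)
  ultimately obtain \<psi> where \<psi>: "additive_character R (carrier R) \<psi>" "\<And>x. x \<in> J \<Longrightarrow> \<psi> x = \<phi> x"
    using additive_character_extend by metis
  define G where "G r = (\<lambda>s\<in>carrier R. \<psi> (r \<otimes> s))" for r
  show "\<exists>G\<in>module_hom_set R (regular_module R) ?M. \<forall>x\<in>J. G x = F x"
  proof (intro bexI ballI)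
    show "G \<in> module_hom_set R (regular_module R) ?M"
    proof (rule module_hom_setI, simp_all)
      fix r assume r: "r \<in> carrier R"
      \<comment> \<open>\<open>r i\<close> lies in \<open>I\<close>, hence in \<open>J\<close>,
        where \<open>\<psi>\<close> is read off from \<open>F\<close>; and \<open>F\<close> vanishes
        on \<open>I\<close>.\<close>
      have "\<psi> (r \<otimes> i) = 1" if i: "i \<in> I" for i
        using \<psi>(2)[of "r \<otimes> i"] F0[of "r \<otimes> i"] ideal_props(6)[OF I i r] J(2)
        by (auto simp: \<phi>_def character_module_def)
      then show "G r \<in> carrier ?M"
        using r \<psi>(1) ideal_props(1)[OF I] by (simp add: G_def character_module_def additive_character_def r_distr)
      show "G (r \<oplus> s) = G r \<oplus>\<^bsub>?M\<^esub> G s" if "s \<in> carrier R" for s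
        using r that \<psi>(1)
        by (simp add: G_def character_module_def additive_character_def l_distr cong: restrict_cong)
      show "G (s \<otimes> r) = s \<odot>\<^bsub>?M\<^esub> G r" if "s \<in> carrier R" for s
        using r that by (simp add: G_def character_module_def m_ac cong: restrict_cong)
    qed
    fix j assume j: "j \<in> J"
    show "G j = F j"
    proof (rule extensionalityI[of _ "carrier R"])
      fix s assume s: "s \<in> carrier R"
      have "F (s \<otimes> j) \<one> = F j (s \<otimes> \<one>)"
        using FD(3)[OF s j] by (simp add: character_module_def)
      then show "G j s = F j s"
        using s j \<psi>(2)[OF JD(6)[OF j s]] JD(1)[OF j] by (simp add: G_def \<phi>_def m_comm)
    qed (use Fj(1)[OF j] in \<open>simp_all add: G_def\<close>)
  qed
qed

text \<open>
  A hom \<open>xR \<rightarrow> M\<close> into a module with \<open>xM = 0\<close> extends to \<open>R\<close> only if it vanishes at \<open>x\<close>; a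
  character that is trivial on \<open>xR + Ann(x)\<close>, but not on \<open>\<one>\<close>, gives one that does not.
\<close>

lemma character_module_not_injective:
  assumes x: "x \<in> carrier R" and irreg: "\<And>r. r \<in> carrier R \<Longrightarrow> x \<noteq> x \<otimes> x \<otimes> r"
  shows "\<not> relatively_injective R (regular_module R) (character_module R (PIdl x))"
proof
  let ?M = "character_module R (PIdl x)"
  assume inj: "relatively_injective R (regular_module R) ?M"
  have Ix: "ideal (PIdl x) R" by (rule cgenideal_ideal[OF x])
  interpret M: module R ?M by (rule character_module_module[OF Ix])
  define Ann where "Ann = {r \<in> carrier R. r \<otimes> x = \<zero>}"
  have Ann: "ideal Ann R"
    by (rule idealI') (use x in \<open>auto simp: Ann_def l_distr m_assoc\<close>)
  define A where "A = {p \<oplus> s \<otimes> x | p s. p \<in> Ann \<and> s \<in> carrier R}"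
  have A: "ideal A R" unfolding A_def by (rule ideal_sum_principal[OF Ann x])
  \<comment> \<open>Multiplying \<open>1 = p + s x\<close> by \<open>x\<close> would give
    \<open>x = x x s\<close>.\<close>
  have "\<one> \<notin> A"
  proof
    assume "\<one> \<in> A"
    then obtain p s where ps: "p \<in> carrier R" "p \<otimes> x = \<zero>" "s \<in> carrier R" "\<one> = p \<oplus> s \<otimes> x"
      by (auto simp: A_def Ann_def)
    have "x = (p \<oplus> s \<otimes> x) \<otimes> x" using x by (simp flip: ps(4))
    also have "\<dots> = p \<otimes> x \<oplus> x \<otimes> x \<otimes> s" using x ps(1,3) by algebra
    also have "\<dots> = x \<otimes> x \<otimes> s" using x ps(2,3) by simp
    finally show False using irreg[OF ps(3)] by blast
  qed
  then obtain \<chi> where \<chi>: "additive_character R (carrier R) \<chi>" "\<And>a. a \<in> A \<Longrightarrow> \<chi> a = 1" "\<chi> \<one> \<noteq> 1"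
    using separating_character[OF A] by metis
  have xA: "PIdl x \<subseteq> A"
  proof
    fix y assume "y \<in> PIdl x"
    then obtain r where "r \<in> carrier R" "y = \<zero> \<oplus> r \<otimes> x" using x by (auto simp: cgenideal_def)
    then show "y \<in> A" using ideal_props(2)[OF Ann] unfolding A_def by blast
  qed
  have AnnA: "r \<in> A" if "r \<in> Ann" for r
  proof -
    have "r = r \<oplus> \<zero> \<otimes> x" using that x by (simp add: Ann_def)
    then show ?thesis using that unfolding A_def by blast
  qed
  define \<chi>' where "\<chi>' = restrict \<chi> (carrier R)"
  have \<chi>': "\<chi>' \<in> carrier ?M"
    using \<chi>(1,2) xA ideal_props(1)[OF Ix] by (auto simp: \<chi>'_def character_module_def additive_character_def)
  have "(\<lambda>r. r \<odot>\<^bsub>?M\<^esub> \<chi>') \<in> module_hom_set R (regular_module R) ?M"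
    using \<chi>' by (intro module_hom_setI) (simp_all add: M.smult_l_distr M.smult_assoc1)
  moreover have "r \<odot>\<^bsub>?M\<^esub> \<chi>' = \<zero>\<^bsub>?M\<^esub>" if "r \<in> carrier R" "r \<otimes> x = \<zero>" for r
  proof -
    have "r \<otimes> s \<in> A" if "s \<in> carrier R" for s
      using that AnnA \<open>r \<in> carrier R\<close> \<open>r \<otimes> x = \<zero>\<close> ideal_props(7)[OF Ann, of r s] by (simp add: Ann_def)
    then show ?thesis using \<chi>(2) that
      by (simp add: character_module_def \<chi>'_def cong: restrict_cong)
  qed
  ultimately obtain f where f: "f \<in> module_hom_set R (regular_module R\<lparr>carrier := PIdl x\<rparr>) ?M"
    "\<And>r. r \<in> carrier R \<Longrightarrow> f (r \<otimes> x) = r \<odot>\<^bsub>?M\<^esub> \<chi>'"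
    using hom_from_principal_ideal[OF M.module_axioms x] by blast
  have "submodule (PIdl x) R (regular_module R)" using Ix by (simp add: submodule_regular_iff)
  then obtain g where g: "g \<in> module_hom_set R (regular_module R) ?M" "\<And>y. y \<in> PIdl x \<Longrightarrow> g y = f y"
    using inj f(1) unfolding relatively_injective_def by blast
  note gD = module_hom_setD[OF g(1), simplified]
  \<comment> \<open>The value of the character \<open>g x\<close> at \<open>1\<close> is computed
    twice: as \<open>\<chi> 1\<close>, since \<open>g\<close> extends \<open>f\<close>, and by
    linearity as the value of \<open>g 1\<close> at \<open>x\<close>, which is \<open>1\<close>
    because that character is trivial on the ideal of \<open>x\<close>.\<close>
  have "g x = f (\<one> \<otimes> x)" using g(2)[OF cgenideal_self[OF x]] x by simp
  also have "\<dots> = \<chi>'" using f(2)[of \<one>] \<chi>' by simp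
  finally have "g x \<one> = \<chi> \<one>" by (simp add: \<chi>'_def)
  moreover have "g x = x \<odot>\<^bsub>?M\<^esub> g \<one>" using gD(3)[of x \<one>] x by simp
  then have "g x \<one> = g \<one> x" using x by (simp add: character_module_def)
  moreover have "g \<one> x = 1"
    using gD(1)[OF one_closed] cgenideal_self[OF x] by (simp add: character_module_def)
  ultimately show False using \<chi>(3) by simp
qed

end

section \<open>Cyclic test modules over a ring without a middle class\<close>

locale no_middle_class_ring = cring R for R (structure) +
  fixes universe :: "'m itself"
  assumes large: "large_universe TYPE('m) R" and nmc: "no_middle_class TYPE('m) R"
begin

lemma carrier_small: "carrier R \<lesssim> (UNIV :: 'm set)"
proof -
  have "Pow (carrier R) \<lesssim> (UNIV :: 'm set)" using large by (simp add: large_universe_def)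
  then show ?thesis using lepoll_Pow_self lepoll_trans by blast
qed

text \<open>The hypothesis on \<open>R\<close> enters the argument only here, with the cyclic module
  \<open>R / I\<close> as the test module.\<close>

lemma quotient_dichotomy:
  fixes M :: "('a, 'p, 'd) module_scheme"
  assumes I: "ideal I R" and M: "module R M" "carrier M \<lesssim> (UNIV :: 'm set)"
    and inj: "relatively_injective R (quotient_module R I) M"
  shows "relatively_injective R (regular_module R) M \<or> semisimple_quotient R I"
proof -
  have "carrier (quotient_module R I) \<lesssim> carrier R"
    unfolding quotient_carrier[OF I] by (rule image_lepoll)
  then have "carrier (quotient_module R I) \<lesssim> (UNIV :: 'm set)" using carrier_small by (rule lepoll_trans)
  then show ?thesis
    using no_middle_class_dichotomy[OF nmc cring_axioms M(1) quotient_module_module[OF I] carrier_small M(2) _ inj]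
      complemented_quotient_module[OF I] by blast
qed

lemma irregular_semisimple_quotient:
  assumes x: "x \<in> carrier R" and irreg: "\<And>r. r \<in> carrier R \<Longrightarrow> x \<noteq> x \<otimes> x \<otimes> r"
  shows "semisimple_quotient R (PIdl x)"
  using quotient_dichotomy[OF cgenideal_ideal[OF x] character_module_module[OF cgenideal_ideal[OF x]]
      character_module_lepoll[OF large] character_module_relatively_injective[OF cgenideal_ideal[OF x]]]
    character_module_not_injective[OF x irreg] by blast

text \<open>Every homomorphism \<open>J / I \<rightarrow> I\<close> is zero: an element of
  \<open>I\<close> multiplies \<open>J\<close> into \<open>I\<close>, where the homomorphism
  vanishes, so \<open>I\<close> annihilates all its values. Hence \<open>I\<close> is injective
  relative to \<open>R / I\<close>. If \<open>I\<close> is also injective relative to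
  \<open>R\<close>, the identity of \<open>I\<close> extends to \<open>R\<close>, and its value at
  \<open>1\<close> is \<open>h\<close>.\<close>

lemma faithful_ideal_dichotomy:
  assumes I: "ideal I R" and faithful: "\<And>y. \<lbrakk>y \<in> I; \<And>u. u \<in> I \<Longrightarrow> u \<otimes> y = \<zero>\<rbrakk> \<Longrightarrow> y = \<zero>"
  shows "(\<exists>h\<in>I. \<forall>y\<in>I. h \<otimes> y = y) \<or> semisimple_quotient R I"
proof -
  let ?M = "regular_module R\<lparr>carrier := I\<rparr>"
  note ID = ideal_props[OF I]
  have subI: "submodule I R (regular_module R)" using I by (simp add: submodule_regular_iff)
  have M: "module R ?M" by (rule submodule.submodule_is_module[OF subI regular_module_module])
  have "relatively_injective R (quotient_module R I) ?M"
  proof (rule quotient_relatively_injectiveI[OF I M])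
    fix J F assume J: "ideal J R" "I \<subseteq> J" and F: "F \<in> module_hom_set R (regular_module R\<lparr>carrier := J\<rparr>) ?M"
      and F0: "\<And>x. x \<in> I \<Longrightarrow> F x = \<zero>\<^bsub>?M\<^esub>"
    note FD = module_hom_setD[OF F, simplified]
    have "F j = \<zero>" if j: "j \<in> J" for j
    proof (rule faithful)
      show "F j \<in> I" using FD(1)[OF j] .
      fix u assume u: "u \<in> I"
      then have "u \<otimes> F j = F (u \<otimes> j)" using FD(3)[OF ID(1) j] by simp
      then show "u \<otimes> F j = \<zero>" using F0[OF ID(7)[OF u ideal_props(1)[OF J(1) j]]] by simp
    qed
    moreover have "(\<lambda>_. \<zero>) \<in> module_hom_set R (regular_module R) ?M"
      by (rule module_hom_setI) (use ID(2) in auto)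
    ultimately show "\<exists>G\<in>module_hom_set R (regular_module R) ?M. \<forall>x\<in>J. G x = F x"
      by (intro bexI[of _ "\<lambda>_. \<zero>"]) auto
  qed
  moreover have "carrier ?M \<lesssim> carrier R" using ID(1) by (auto intro!: subset_imp_lepoll)
  then have "carrier ?M \<lesssim> (UNIV :: 'm set)" using carrier_small by (rule lepoll_trans)
  ultimately have "relatively_injective R (regular_module R) ?M \<or> semisimple_quotient R I"
    by (intro quotient_dichotomy[OF I M])
  moreover have "\<exists>h\<in>I. \<forall>y\<in>I. h \<otimes> y = y" if inj: "relatively_injective R (regular_module R) ?M"
  proof -
    have "(\<lambda>y. y) \<in> module_hom_set R (regular_module R\<lparr>carrier := I\<rparr>) ?M"
      by (rule module_hom_setI) auto
    then obtain g where g: "g \<in> module_hom_set R (regular_module R) ?M" "\<And>y. y \<in> I \<Longrightarrow> g y = y"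
      using inj subI unfolding relatively_injective_def by blast
    note gD = module_hom_setD[OF g(1), simplified]
    have "g \<one> \<otimes> y = y" if y: "y \<in> I" for y
      using gD(3)[of y \<one>] gD(1)[OF one_closed] g(2)[OF y] ID(1)[OF y] ID(1) m_comm by auto
    then show ?thesis using gD(1)[OF one_closed] by blast
  qed
  ultimately show ?thesis by blast
qed

text \<open>
  For an infinite chain, let \<open>f n = e (Suc n) \<ominus> e n\<close>. The even \<open>f n\<close> and \<open>e 0\<close> generate a
  non-principal ideal \<open>I\<close>, and the odd \<open>f n\<close> generate a non-principal ideal modulo \<open>I\<close>.
\<close>

lemma no_idempotent_chain:
  assumes e: "\<And>n::nat. e n \<in> carrier R" "\<And>n. e n \<otimes> e n = e n" "\<And>n. e n \<otimes> e (Suc n) = e n"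
    and strict: "\<And>n. e n \<noteq> e (Suc n)"
  shows False
proof -
  have le: "e m \<otimes> e n = e m" if "m \<le> n" for m n
    using that
  proof (induction rule: dec_induct)
    case (step n)
    have "e m \<otimes> e (Suc n) = e m \<otimes> (e n \<otimes> e (Suc n))" using step e(1) by (simp flip: m_assoc)
    then show ?case using step e(3) by simp
  qed (use e(2) in simp)
  define f where "f n = e (Suc n) \<ominus> e n" for n
  have fR: "f n \<in> carrier R" for n using e(1) by (simp add: f_def)
  have f0: "f n \<noteq> \<zero>" for n using strict[of n] e(1) by (simp add: f_def)
  have ef: "e m \<otimes> f n = \<zero>" if "m \<le> n" for m n
  proof -
    have "e m \<otimes> f n = e m \<otimes> e (Suc n) \<ominus> e m \<otimes> e n" using e(1) unfolding f_def by algebra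
    then show ?thesis using le[of m n] le[of m "Suc n"] that e(1) by (simp add: a_minus_def r_neg)
  qed
  have fe: "f m \<otimes> e n = f m" if "m < n" for m n
  proof -
    have "f m \<otimes> e n = e (Suc m) \<otimes> e n \<ominus> e m \<otimes> e n" using e(1) unfolding f_def by algebra
    then show ?thesis using le[of m n] le[of "Suc m" n] that by (simp add: f_def)
  qed
  have ff0: "f m \<otimes> f n = \<zero>" if "m < n" for m n
  proof -
    have "f m \<otimes> f n = (f m \<otimes> e n) \<otimes> f n" using fe[OF that] by simp
    also have "\<dots> = f m \<otimes> (e n \<otimes> f n)" using fR e(1) by (simp add: m_assoc)
    finally show ?thesis using ef[of n n] fR by simp
  qed
  have ff: "f m \<otimes> f n = \<zero>" if "m \<noteq> n" for m n
    using ff0 that fR m_comm by (metis linorder_neqE_nat)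
  have ffn: "f n \<otimes> f n = f n" for n
  proof -
    have "f n \<otimes> f n = f n \<otimes> e (Suc n) \<ominus> e n \<otimes> f n" using e(1) fR[of n] unfolding f_def by algebra
    then show ?thesis using fe[of n "Suc n"] ef[of n n] fR by (simp add: a_minus_def)
  qed
  \<comment> \<open>\<open>J\<close> is the union of the ideals generated by the \<open>e n\<close>.
    Vanishing of the products with the odd \<open>f\<close> singles out the part of \<open>J\<close>
    generated by \<open>e 0\<close> and the even \<open>f\<close>, in a form where membership is
    tested by multiplication.\<close>
  define J where "J = {r \<in> carrier R. \<exists>n. r \<otimes> e n = r}"
  define I where "I = {r \<in> J. \<forall>k. r \<otimes> f (2 * k + 1) = \<zero>}"
  have mono: "r \<otimes> e n = r" if "r \<in> carrier R" "r \<otimes> e m = r" "m \<le> n" for r m n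
    using m_assoc[of r "e m" "e n"] le[OF that(3)] that(1,2) e(1) by simp
  have J: "ideal J R"
  proof (rule idealI')
    fix x y assume "x \<in> J" "y \<in> J"
    then obtain m n where mn: "x \<in> carrier R" "y \<in> carrier R" "x \<otimes> e m = x" "y \<otimes> e n = y"
      by (auto simp: J_def)
    then have "x \<otimes> e (max m n) = x" "y \<otimes> e (max m n) = y" using mono by auto
    then have "(x \<oplus> y) \<otimes> e (max m n) = x \<oplus> y" using mn e(1) by (simp add: l_distr)
    then show "x \<oplus> y \<in> J" using mn by (auto simp: J_def)
  next
    fix r x assume "r \<in> carrier R" "x \<in> J"
    then obtain n where n: "x \<in> carrier R" "x \<otimes> e n = x" by (auto simp: J_def)
    then have "(r \<otimes> x) \<otimes> e n = r \<otimes> x" using \<open>r \<in> carrier R\<close> e(1) by (simp add: m_assoc)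
    then show "r \<otimes> x \<in> J" using n \<open>r \<in> carrier R\<close> by (auto simp: J_def)
  qed (use e(1) in \<open>auto simp: J_def\<close>)
  note JD = ideal_props[OF J]
  have I: "ideal I R"
    by (rule idealI') (use JD fR in \<open>auto simp: I_def l_distr m_assoc\<close>)
  have fJ: "f n \<in> J" for n using fe[of n "Suc n"] fR by (auto simp: J_def)
  have fI: "f (2 * k) \<in> I" for k
  proof -
    have "f (2 * k) \<otimes> f (2 * m + 1) = \<zero>" for m by (rule ff) presburger
    then show ?thesis using fJ by (simp add: I_def)
  qed
  have e0I: "e 0 \<in> I" using ef[of 0] e(1,2) by (auto simp: I_def J_def)
  have "y = \<zero>" if y: "y \<in> I" "\<And>u. u \<in> I \<Longrightarrow> u \<otimes> y = \<zero>" for y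
  proof -
    have yR: "y \<in> carrier R" using y(1) by (simp add: I_def J_def)
    have yf: "y \<otimes> f n = \<zero>" for n
    proof (cases "even n")
      case True
      then show ?thesis using y(2)[OF fI] fR yR m_comm by (metis dvdE)
    qed (use y(1) in \<open>auto simp: I_def elim!: oddE\<close>)
    have "y \<otimes> e n = \<zero>" for n
    proof (induction n)
      case 0
      then show ?case using y(2)[OF e0I] yR e(1) by (simp add: m_comm)
    next
      case (Suc n)
      have "y \<otimes> e (Suc n) = y \<otimes> e n \<oplus> y \<otimes> f n" using yR e(1) unfolding f_def by algebra
      then show ?case using Suc yf by simp
    qed
    moreover obtain n where "y \<otimes> e n = y" using y(1) by (auto simp: I_def J_def)
    ultimately show ?thesis by simp
  qed
  then have "(\<exists>h\<in>I. \<forall>y\<in>I. h \<otimes> y = y) \<or> semisimple_quotient R I"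
    by (rule faithful_ideal_dichotomy[OF I])
  then show False
  proof
    assume "\<exists>h\<in>I. \<forall>y\<in>I. h \<otimes> y = y"
    then obtain h where h: "h \<in> I" "\<And>y. y \<in> I \<Longrightarrow> h \<otimes> y = y" by blast
    then obtain n where n: "h \<in> carrier R" "h \<otimes> e n = h" by (auto simp: I_def J_def)
    \<comment> \<open>\<open>2 * n\<close> is an even index that is at least \<open>n\<close>: this
      \<open>f\<close> lies in \<open>I\<close>, so \<open>h\<close> must fix it, but it is
      orthogonal to \<open>e n\<close> and hence killed by \<open>h\<close>.\<close>
    have "f (2 * n) = (h \<otimes> e n) \<otimes> f (2 * n)" using h(2)[OF fI[of n]] n by simp
    also have "\<dots> = \<zero>" using m_assoc[of h "e n" "f (2 * n)"] ef[of n "2 * n"] n e(1) fR by simp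
    finally show False using f0 by blast
  next
    assume "semisimple_quotient R I"
    moreover have "I \<subseteq> J" by (auto simp: I_def)
    ultimately obtain L j l where L: "ideal L R" "J \<inter> L \<subseteq> I" and jl: "j \<in> J" "l \<in> L" "\<one> = j \<oplus> l"
      using J unfolding semisimple_quotient_def by blast
    obtain n where n: "j \<in> carrier R" "j \<otimes> e n = j" using jl(1) by (auto simp: J_def)
    have lR: "l \<in> carrier R" using ideal_props(1)[OF L(1) jl(2)] .
    \<comment> \<open>An odd index that is at least \<open>n\<close>. Then \<open>j\<close> kills
      \<open>f k\<close>, so \<open>f k = l f k\<close> lies in \<open>J \<inter> L\<close> and
      hence in \<open>I\<close>, although elements of \<open>I\<close> annihilate the idempotent
      \<open>f k\<close>.\<close>
    define k where "k = 2 * n + 1"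
    have "j \<otimes> f k = (j \<otimes> e n) \<otimes> f k" using n by simp
    also have "\<dots> = \<zero>" using m_assoc[of j "e n" "f k"] ef[of n k] n e(1) fR by (simp add: k_def)
    finally have jf: "j \<otimes> f k = \<zero>" .
    have "f k = (j \<oplus> l) \<otimes> f k" using fR by (simp flip: jl(3))
    also have "\<dots> = l \<otimes> f k" using jf n lR fR by (simp add: l_distr)
    finally have "f k \<in> L" using ideal_props(7)[OF L(1) jl(2) fR[of k]] by simp
    then have "f k \<in> I" using L(2) fJ by blast
    then have "f k \<otimes> f k = \<zero>" by (auto simp: I_def k_def)
    then show False using ffn f0 by simp
  qed
qed

end


subsection \<open>Rings without a middle class\<close>

context cring
begin

text \<open>Commutative semisimple rings are von Neumann regular; this is that fact for the quotient
  by \<open>w\<close>, written in \<open>R\<close>. For a complement \<open>L\<close> of the ideal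
  generated by \<open>w\<close> and \<open>z\<close>, the component \<open>l\<close> of
  \<open>1\<close> multiplies \<open>z\<close> into the ideal of \<open>w\<close>, and the other
  component is a multiple of \<open>z\<close> modulo \<open>w\<close>.\<close>

lemma semisimple_quotient_regular:
  assumes w: "w \<in> carrier R" and ss: "semisimple_quotient R (PIdl w)" and z: "z \<in> carrier R"
  obtains a b where "a \<in> carrier R" "b \<in> carrier R" "z = z \<otimes> z \<otimes> a \<oplus> w \<otimes> b"
proof -
  define J where "J = {p \<oplus> s \<otimes> z | p s. p \<in> PIdl w \<and> s \<in> carrier R}"
  have Iw: "ideal (PIdl w) R" by (rule cgenideal_ideal[OF w])
  have J: "ideal J R" unfolding J_def by (rule ideal_sum_principal[OF Iw z])
  have sub: "PIdl w \<subseteq> J"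
  proof
    fix y assume "y \<in> PIdl w"
    then have "y = y \<oplus> \<zero> \<otimes> z" using ideal_props(1)[OF Iw] z by simp
    then show "y \<in> J" using \<open>y \<in> PIdl w\<close> unfolding J_def by blast
  qed
  have zJ: "z \<in> J"
  proof -
    have "z = \<zero> \<oplus> \<one> \<otimes> z" using z by simp
    then show ?thesis using ideal_props(2)[OF Iw] unfolding J_def by blast
  qed
  obtain L j l where L: "ideal L R" "J \<inter> L \<subseteq> PIdl w" and jl: "j \<in> J" "l \<in> L" "\<one> = j \<oplus> l"
    using ss J sub unfolding semisimple_quotient_def by blast
  have "l \<otimes> z \<in> J \<inter> L"
    using ideal_props(6)[OF J zJ] ideal_props(7)[OF L(1) jl(2) z] ideal_props(1)[OF L(1) jl(2)] by simp
  then obtain b where b: "b \<in> carrier R" "l \<otimes> z = b \<otimes> w" using L(2) by (auto simp: cgenideal_def)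
  obtain c a where ca: "c \<in> carrier R" "a \<in> carrier R" "j = c \<otimes> w \<oplus> a \<otimes> z"
    using jl(1) by (auto simp: J_def cgenideal_def)
  have lR: "l \<in> carrier R" using ideal_props(1)[OF L(1) jl(2)] .
  have "z = (j \<oplus> l) \<otimes> z" using z by (simp flip: jl(3))
  also have "\<dots> = j \<otimes> z \<oplus> b \<otimes> w" using z lR ideal_props(1)[OF J jl(1)] by (simp add: l_distr b(2))
  also have "\<dots> = z \<otimes> z \<otimes> a \<oplus> w \<otimes> (c \<otimes> z \<oplus> b)"
    using z w b(1) ca(1,2) unfolding ca(3) by algebra
  finally show ?thesis using that[of a "c \<otimes> z \<oplus> b"] ca b z by simp
qed

text \<open>The identities \<open>h\<close> of \<open>fK\<close> and \<open>k\<close> of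
  \<open>gK\<close> are taken inside their corners, so that \<open>h y = h (f y) = f y\<close> and
  similarly for \<open>k\<close>. Thus \<open>h + k\<close> acts on \<open>K\<close> as
  \<open>f + g\<close> does.\<close>

lemma semisimple_corner_add:
  assumes fg: "f \<in> carrier R" "g \<in> carrier R" "f \<otimes> f = f" "g \<otimes> g = g"
    and ss: "semisimple_corner R f" "semisimple_corner R g"
  shows "semisimple_corner R (f \<oplus> g)"
  unfolding semisimple_corner_def
proof (intro allI impI, elim conjE)
  fix K assume K: "ideal K R" and fgK: "\<forall>y\<in>K. (f \<oplus> g) \<otimes> y = y"
  note KD = ideal_props[OF K]
  have corner: "\<exists>h\<in>K. h \<otimes> u = h \<and> (\<forall>y\<in>K. h \<otimes> (u \<otimes> y) = u \<otimes> y)"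
    if u: "u \<in> carrier R" "u \<otimes> u = u" "semisimple_corner R u" for u
  proof -
    have "ideal {y \<in> K. u \<otimes> y = y} R"
      by (rule idealI') (use KD u in \<open>auto simp: r_distr m_lcomm\<close>)
    then obtain h where h: "h \<in> K" "u \<otimes> h = h" "\<And>y. \<lbrakk>y \<in> K; u \<otimes> y = y\<rbrakk> \<Longrightarrow> h \<otimes> y = y"
      using u(3) unfolding semisimple_corner_def by blast
    have "h \<otimes> (u \<otimes> y) = u \<otimes> y" if "y \<in> K" for y
      by (rule h(3)) (use that u KD in \<open>auto simp flip: m_assoc\<close>)
    then show ?thesis using h(1,2) KD(1)[OF h(1)] u(1) m_comm by metis
  qed
  obtain h where h: "h \<in> K" "h \<otimes> f = h" "\<And>y. y \<in> K \<Longrightarrow> h \<otimes> (f \<otimes> y) = f \<otimes> y"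
    using corner[OF fg(1,3) ss(1)] by blast
  obtain k where k: "k \<in> K" "k \<otimes> g = k" "\<And>y. y \<in> K \<Longrightarrow> k \<otimes> (g \<otimes> y) = g \<otimes> y"
    using corner[OF fg(2,4) ss(2)] by blast
  have "(h \<oplus> k) \<otimes> y = y" if y: "y \<in> K" for y
  proof -
    have cl: "y \<in> carrier R" "h \<in> carrier R" "k \<in> carrier R" using KD(1) y h(1) k(1) by auto
    have "h \<otimes> y = f \<otimes> y" using h(3)[OF y] cl fg(1) h(2) by (simp flip: m_assoc)
    moreover have "k \<otimes> y = g \<otimes> y" using k(3)[OF y] cl fg(2) k(2) by (simp flip: m_assoc)
    ultimately have "(h \<oplus> k) \<otimes> y = (f \<oplus> g) \<otimes> y" using cl fg by (simp add: l_distr)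
    then show ?thesis using fgK y by simp
  qed
  then show "\<exists>h\<in>K. \<forall>y\<in>K. h \<otimes> y = y" using KD(3)[OF h(1) k(1)] by blast
qed

end

lemma (in no_middle_class_ring) nearly_semisimple: "nearly_semisimple R"
proof (cases "semisimple_corner R \<one>")
  case True
  then have "semisimple_corner R (\<one> \<ominus> \<zero>)" by (simp add: a_minus_def)
  then show ?thesis unfolding nearly_semisimple_def by (intro bexI[of _ \<zero>]) auto
next
  case False
  define P where "P e \<longleftrightarrow> e \<in> carrier R \<and> e \<otimes> e = e \<and> \<not> semisimple_corner R (\<one> \<ominus> e)" for e
  have "P \<zero>" using False by (simp add: P_def a_minus_def)
  \<comment> \<open>Maximality refers to the order of idempotents in which \<open>e e' = e\<close>
    means that \<open>e\<close> is below \<open>e'\<close>. Without a maximal one, dependent choice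
    produces the chain excluded by \<open>no_idempotent_chain\<close>.\<close>
  have "\<exists>e. P e \<and> (\<forall>e'. P e' \<and> e \<otimes> e' = e \<longrightarrow> e' = e)"
  proof (rule ccontr)
    assume no: "\<nexists>e. P e \<and> (\<forall>e'. P e' \<and> e \<otimes> e' = e \<longrightarrow> e' = e)"
    have "\<exists>e. \<forall>n::nat. P (e n) \<and> (e n \<otimes> e (Suc n) = e n \<and> e n \<noteq> e (Suc n))"
    proof (rule dependent_nat_choice)
      show "\<exists>e. P e" using \<open>P \<zero>\<close> by blast
      show "\<exists>y. P y \<and> x \<otimes> y = x \<and> x \<noteq> y" if "P x" for x using no that by metis
    qed
    then obtain e :: "nat \<Rightarrow> 'a" where "\<And>n. P (e n)" "\<And>n. e n \<otimes> e (Suc n) = e n" "\<And>n. e n \<noteq> e (Suc n)"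
      by blast
    then show False using no_idempotent_chain[of e] by (simp add: P_def)
  qed
  then obtain e where "P e" and max: "\<And>e'. \<lbrakk>P e'; e \<otimes> e' = e\<rbrakk> \<Longrightarrow> e' = e" by blast
  then have e: "e \<in> carrier R" "e \<otimes> e = e" "\<not> semisimple_corner R (\<one> \<ominus> e)" by (auto simp: P_def)
  define t where "t = \<one> \<ominus> e"
  have t: "t \<in> carrier R" "\<not> semisimple_corner R t" using e by (auto simp: t_def)
  have et: "e \<otimes> t = \<zero>"
  proof -
    have "e \<otimes> t = e \<ominus> e \<otimes> e" using e(1) unfolding t_def by algebra
    then show ?thesis using e by simp
  qed
  have tt: "t \<otimes> t = t"
  proof -
    have "t \<otimes> t = t \<ominus> e \<otimes> t" using e(1) unfolding t_def by algebra
    then show ?thesis using et t by (simp add: a_minus_def)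
  qed
  have e_eq: "\<one> \<ominus> t = e" using e(1) unfolding t_def by algebra
  have ew: "e \<otimes> w = \<zero>" if "w \<in> carrier R" "t \<otimes> w = w" for w
  proof -
    have "e \<otimes> w = (e \<otimes> t) \<otimes> w" using that e(1) t(1) by (simp add: m_assoc)
    then show ?thesis using et that by simp
  qed
  \<comment> \<open>\<open>e \<oplus> g\<close> is an idempotent strictly above \<open>e\<close>, so
    by maximality the corner of its complement \<open>t \<ominus> g\<close> is semisimple.\<close>
  have compl: "semisimple_corner R (t \<ominus> g)"
    if g: "g \<in> carrier R" "g \<otimes> g = g" "t \<otimes> g = g" "g \<noteq> \<zero>" for g
  proof (rule ccontr)
    assume n: "\<not> semisimple_corner R (t \<ominus> g)"
    have eg: "e \<otimes> g = \<zero>" using ew g by simp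
    have "(e \<oplus> g) \<otimes> (e \<oplus> g) = e \<otimes> e \<oplus> g \<otimes> g \<oplus> (e \<otimes> g \<oplus> e \<otimes> g)" using e(1) g(1) by algebra
    then have "(e \<oplus> g) \<otimes> (e \<oplus> g) = e \<oplus> g" using e g eg by simp
    moreover have "\<one> \<ominus> (e \<oplus> g) = t \<ominus> g" using e(1) g(1) unfolding t_def by algebra
    ultimately have "P (e \<oplus> g)" using e(1) g(1) n by (simp add: P_def)
    moreover have "e \<otimes> (e \<oplus> g) = e" using e(1,2) g(1) eg by (simp add: r_distr)
    ultimately have "e \<oplus> g = e" using max by blast
    then show False using e(1) g(1,4) by simp
  qed
  \<comment> \<open>A nontrivial idempotent \<open>f\<close> of \<open>tR\<close> and
    \<open>g = t \<ominus> f\<close> are complements of each other, so \<open>compl\<close> makes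
    both corners semisimple, and with them the corner of \<open>t\<close>.\<close>
  have connected: "f = \<zero> \<or> f = t" if f: "f \<in> carrier R" "f \<otimes> f = f" "t \<otimes> f = f" for f
  proof (rule ccontr)
    assume n: "\<not> (f = \<zero> \<or> f = t)"
    define g where "g = t \<ominus> f"
    have g: "g \<in> carrier R" "g \<noteq> \<zero>" using f t(1) n by (auto simp: g_def)
    have "g \<otimes> g = t \<otimes> t \<oplus> f \<otimes> f \<ominus> (t \<otimes> f \<oplus> t \<otimes> f)" "t \<otimes> g = t \<otimes> t \<ominus> t \<otimes> f"
      using f(1) t(1) unfolding g_def by algebra+
    moreover have "t \<oplus> f \<ominus> (f \<oplus> f) = t \<ominus> f" using f(1) t(1) by algebra
    ultimately have gg: "g \<otimes> g = g" "t \<otimes> g = g" using f tt by (simp_all add: g_def)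
    have "t \<ominus> g = f" "g \<oplus> f = t" using f(1) t(1) unfolding g_def by algebra+
    then have "semisimple_corner R g" "semisimple_corner R f"
      using compl[OF f] compl[OF g(1) gg g(2)] n by (auto simp: g_def)
    then have "semisimple_corner R (g \<oplus> f)" using semisimple_corner_add g gg f by blast
    then show False using t(2) \<open>g \<oplus> f = t\<close> by simp
  qed
  \<comment> \<open>\<open>x r\<close> is an idempotent of \<open>tR\<close>. If it is
    \<open>t\<close>, then \<open>x\<close> is a unit of \<open>tR\<close>; if it is zero, then so
    is \<open>x = x (x r)\<close>.\<close>
  have regular: "x = \<zero> \<or> (\<exists>s\<in>carrier R. x \<otimes> s = t)"
    if x: "x \<in> carrier R" "t \<otimes> x = x" and r: "r \<in> carrier R" "x = x \<otimes> x \<otimes> r" for x r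
  proof -
    have "(x \<otimes> r) \<otimes> (x \<otimes> r) = (x \<otimes> x \<otimes> r) \<otimes> r" using x(1) r(1) by algebra
    then have "(x \<otimes> r) \<otimes> (x \<otimes> r) = x \<otimes> r" by (simp flip: r(2))
    moreover have "t \<otimes> (x \<otimes> r) = x \<otimes> r" using x r(1) t(1) by (simp flip: m_assoc)
    ultimately have "x \<otimes> r = \<zero> \<or> x \<otimes> r = t" using connected x(1) r(1) by simp
    then show ?thesis
    proof
      assume "x \<otimes> r = \<zero>"
      then have "x \<otimes> x \<otimes> r = \<zero>" using x(1) r(1) by (simp add: m_assoc)
      then show ?thesis using r(2) by simp
    qed (use r(1) in blast)
  qed
  define irreg where "irreg x \<longleftrightarrow> x \<in> carrier R \<and> t \<otimes> x = x \<and> (\<forall>r\<in>carrier R. x \<noteq> x \<otimes> x \<otimes> r)" for x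
  have quot: "semisimple_quotient R (PIdl x)" if "irreg x" for x
    using that irregular_semisimple_quotient unfolding irreg_def by blast
  have square_zero: "x \<otimes> x = \<zero>" if x: "irreg x" for x
  proof -
    have xR: "x \<in> carrier R" "t \<otimes> x = x" and xr: "\<And>r. r \<in> carrier R \<Longrightarrow> x \<noteq> x \<otimes> x \<otimes> r"
      using x by (auto simp: irreg_def)
    have txx: "t \<otimes> (x \<otimes> x) = x \<otimes> x" using xR t(1) by (simp flip: m_assoc)
    have "\<not> irreg (x \<otimes> x)"
    proof
      assume "irreg (x \<otimes> x)"
      then obtain a b where ab: "a \<in> carrier R" "b \<in> carrier R" "x = x \<otimes> x \<otimes> a \<oplus> x \<otimes> x \<otimes> b"
        using semisimple_quotient_regular[OF _ quot xR(1)] xR(1) by blast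
      have "x \<otimes> x \<otimes> a \<oplus> x \<otimes> x \<otimes> b = x \<otimes> x \<otimes> (a \<oplus> b)" using xR(1) ab(1,2) by algebra
      then show False using xr[of "a \<oplus> b"] ab by simp
    qed
    \<comment> \<open>A square that is not irregular is zero or a unit of \<open>tR\<close>. The
      latter is excluded, since \<open>x = x x (s x)\<close> would contradict the irregularity of
      \<open>x\<close>.\<close>
    then have "x \<otimes> x = \<zero> \<or> (\<exists>s\<in>carrier R. (x \<otimes> x) \<otimes> s = t)"
      using regular[of "x \<otimes> x"] xR(1) txx unfolding irreg_def by blast
    moreover have "(x \<otimes> x) \<otimes> s \<noteq> t" if s: "s \<in> carrier R" for s
    proof
      assume *: "(x \<otimes> x) \<otimes> s = t"
      have "x \<otimes> x \<otimes> (s \<otimes> x) = ((x \<otimes> x) \<otimes> s) \<otimes> x" using xR(1) s by (simp add: m_assoc)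
      then have "x \<otimes> x \<otimes> (s \<otimes> x) = x" using * xR(2) by simp
      then show False using xr[of "s \<otimes> x"] xR(1) s by simp
    qed
    ultimately show ?thesis by blast
  qed
  \<comment> \<open>Otherwise every nonzero element of \<open>tR\<close> is a unit there, and the
    corner of \<open>t\<close> is semisimple because its only ideals are zero and
    \<open>tR\<close>.\<close>
  have "\<exists>x. irreg x"
  proof (rule ccontr)
    assume no: "\<nexists>x. irreg x"
    have "semisimple_corner R t"
      unfolding semisimple_corner_def
    proof (intro allI impI, elim conjE)
      fix K assume K: "ideal K R" "\<forall>y\<in>K. t \<otimes> y = y"
      note KD = ideal_props[OF K(1)]
      show "\<exists>h\<in>K. \<forall>y\<in>K. h \<otimes> y = y"
      proof (cases "K \<subseteq> {\<zero>}")
        case True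
        then show ?thesis using KD(2) by (intro bexI[of _ \<zero>]) auto
      next
        case False
        then obtain y where y: "y \<in> K" "y \<noteq> \<zero>" by blast
        then obtain s where "s \<in> carrier R" "y \<otimes> s = t"
          using no regular[of y] K(2) KD(1)[OF y(1)] unfolding irreg_def by blast
        then have "t \<in> K" using KD(7)[OF y(1)] by blast
        then show ?thesis using K(2) by blast
      qed
    qed
    then show False using t(2) by blast
  qed
  then obtain x where x: "irreg x" by blast
  then have xR: "x \<in> carrier R" "t \<otimes> x = x" and xr: "\<And>r. r \<in> carrier R \<Longrightarrow> x \<noteq> x \<otimes> x \<otimes> r"
    by (auto simp: irreg_def)
  have "semisimple_corner R e"
    unfolding semisimple_corner_def
  proof (intro allI impI, elim conjE)
    fix K assume K: "ideal K R" "\<forall>y\<in>K. e \<otimes> y = y"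
    note KD = ideal_props[OF K(1)]
    \<comment> \<open>Semisimplicity of \<open>R / xR\<close> is applied to \<open>K + xR\<close>.
      Since \<open>e x = 0\<close>, multiplication by \<open>e\<close> removes all multiples of
      \<open>x\<close> and leaves \<open>k\<close> acting as the identity on
      \<open>K\<close>.\<close>
    define J where "J = {k \<oplus> s \<otimes> x | k s. k \<in> K \<and> s \<in> carrier R}"
    have J: "ideal J R" unfolding J_def by (rule ideal_sum_principal[OF K(1) xR(1)])
    have "PIdl x \<subseteq> J"
    proof
      fix y assume "y \<in> PIdl x"
      then obtain s where "s \<in> carrier R" "y = \<zero> \<oplus> s \<otimes> x" using xR by (auto simp: cgenideal_def)
      then show "y \<in> J" using KD(2) unfolding J_def by blast
    qed
    then obtain L j l where L: "ideal L R" "J \<inter> L \<subseteq> PIdl x" and jl: "j \<in> J" "l \<in> L" "\<one> = j \<oplus> l"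
      using quot[OF x] J unfolding semisimple_quotient_def by blast
    obtain k s where ks: "k \<in> K" "s \<in> carrier R" "j = k \<oplus> s \<otimes> x" using jl(1) by (auto simp: J_def)
    have kR: "k \<in> carrier R" and lR: "l \<in> carrier R" using KD(1) ks(1) ideal_props(1)[OF L(1) jl(2)] by auto
    have "k \<otimes> y = y" if y: "y \<in> K" for y
    proof -
      have yR: "y \<in> carrier R" using KD(1) y by simp
      have "y = y \<oplus> \<zero> \<otimes> x" using yR xR by simp
      then have "y \<in> J" using y unfolding J_def by blast
      then have "l \<otimes> y \<in> J \<inter> L" using ideal_props(6)[OF J] ideal_props(7)[OF L(1) jl(2)] lR yR by simp
      then obtain r where r: "r \<in> carrier R" "l \<otimes> y = r \<otimes> x" using L(2) by (auto simp: cgenideal_def)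
      have "y = e \<otimes> ((j \<oplus> l) \<otimes> y)" using K(2) y yR by (simp flip: jl(3))
      also have "\<dots> = e \<otimes> (j \<otimes> y \<oplus> l \<otimes> y)"
        using yR lR kR ks xR(1) by (simp add: l_distr)
      also have "\<dots> = k \<otimes> (e \<otimes> y) \<oplus> (s \<otimes> y \<oplus> r) \<otimes> (e \<otimes> x)"
        using yR kR ks(2) xR(1) e(1) r(1) unfolding r(2) ks(3) by algebra
      also have "\<dots> = k \<otimes> y" using ew[OF xR] K(2) y yR kR ks(2) r(1) by simp
      finally show ?thesis by simp
    qed
    then show "\<exists>h\<in>K. \<forall>y\<in>K. h \<otimes> y = y" using ks(1) by blast
  qed
  moreover have "uniserial_corner R t x"
    unfolding uniserial_corner_def
  proof (intro conjI ballI impI)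
    show "x \<noteq> \<zero>" using xr[of \<zero>] by auto
    fix s assume s: "s \<in> carrier R"
    show "x \<otimes> s \<noteq> t"
    proof
      assume *: "x \<otimes> s = t"
      have "x \<otimes> x \<otimes> s = (x \<otimes> s) \<otimes> x" using xR(1) s by algebra
      then show False using xr[OF s] * xR(2) by simp
    qed
  next
    fix r assume r: "r \<in> carrier R" "t \<otimes> r = r"
    show "r = \<zero> \<or> (\<exists>s\<in>carrier R. r \<otimes> s = t) \<or>
      (\<exists>s\<in>carrier R. r = x \<otimes> s) \<and> (\<exists>s\<in>carrier R. x = r \<otimes> s)"
    proof (cases "irreg r")
      case True
      \<comment> \<open>\<open>v\<close> is a multiple of \<open>w\<close> up to a multiple of its
        own square, which vanishes. By symmetry, irregular elements divide each other.\<close>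
      have mult: "\<exists>s\<in>carrier R. v = w \<otimes> s" if v: "irreg v" and w: "irreg w" for v w
      proof -
        have vw: "v \<in> carrier R" "w \<in> carrier R" using v w by (auto simp: irreg_def)
        obtain a b where ab: "a \<in> carrier R" "b \<in> carrier R" "v = v \<otimes> v \<otimes> a \<oplus> w \<otimes> b"
          using semisimple_quotient_regular[OF vw(2) quot[OF w] vw(1)] by blast
        then have "v = w \<otimes> b" using square_zero[OF v] vw by simp
        then show ?thesis using ab(2) by blast
      qed
      then show ?thesis using x True by blast
    qed (use r regular[of r] in \<open>auto simp: irreg_def\<close>)
  qed (use xR in auto)
  ultimately show ?thesis
    unfolding nearly_semisimple_def using t(1) tt e_eq by (intro bexI[of _ t]) auto
qed


subsection \<open>The ring decomposition\<close>

text \<open>For an idempotent \<open>u\<close>, the ring \<open>uR\<close>; membership is expressed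
  by an equation instead of an image.\<close>

definition corner_ring :: "('a, 'c) ring_scheme \<Rightarrow> 'a \<Rightarrow> 'a ring" where
  "corner_ring R u = \<lparr>carrier = {r \<in> carrier R. u \<otimes>\<^bsub>R\<^esub> r = r}, monoid.mult = monoid.mult R,
     one = u, ring.zero = ring.zero R, ring.add = ring.add R\<rparr>"

lemma corner_ring_simps [simp]:
  "carrier (corner_ring R u) = {r \<in> carrier R. u \<otimes>\<^bsub>R\<^esub> r = r}"
  "x \<otimes>\<^bsub>corner_ring R u\<^esub> y = x \<otimes>\<^bsub>R\<^esub> y"
  "\<one>\<^bsub>corner_ring R u\<^esub> = u"
  "\<zero>\<^bsub>corner_ring R u\<^esub> = \<zero>\<^bsub>R\<^esub>"
  "x \<oplus>\<^bsub>corner_ring R u\<^esub> y = x \<oplus>\<^bsub>R\<^esub> y"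
  by (simp_all add: corner_ring_def)

lemma RDirProd_simps:
  "carrier (RDirProd S T) = carrier S \<times> carrier T"
  "(a, b) \<otimes>\<^bsub>RDirProd S T\<^esub> (c, d) = (a \<otimes>\<^bsub>S\<^esub> c, b \<otimes>\<^bsub>T\<^esub> d)"
  "(a, b) \<oplus>\<^bsub>RDirProd S T\<^esub> (c, d) = (a \<oplus>\<^bsub>S\<^esub> c, b \<oplus>\<^bsub>T\<^esub> d)"
  "\<one>\<^bsub>RDirProd S T\<^esub> = (\<one>\<^bsub>S\<^esub>, \<one>\<^bsub>T\<^esub>)"
  "\<zero>\<^bsub>RDirProd S T\<^esub> = (\<zero>\<^bsub>S\<^esub>, \<zero>\<^bsub>T\<^esub>)"
  by (auto simp: RDirProd_def DirProd_def monoid.defs)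

context cring
begin

lemma corner_ring_cring:
  assumes u: "u \<in> carrier R" "u \<otimes> u = u"
  shows "cring (corner_ring R u)"
proof (rule cringI)
  show "abelian_group (corner_ring R u)"
  proof (rule abelian_groupI)
    fix x assume "x \<in> carrier (corner_ring R u)"
    then have "\<ominus> x \<in> carrier (corner_ring R u)" "\<ominus> x \<oplus>\<^bsub>corner_ring R u\<^esub> x = \<zero>\<^bsub>corner_ring R u\<^esub>"
      using u by (auto simp: r_minus l_neg)
    then show "\<exists>y\<in>carrier (corner_ring R u). y \<oplus>\<^bsub>corner_ring R u\<^esub> x = \<zero>\<^bsub>corner_ring R u\<^esub>" by blast
  qed (use u in \<open>auto simp: a_ac r_distr\<close>)
  show "comm_monoid (corner_ring R u)"
  proof (rule comm_monoidI)
    show "x \<otimes>\<^bsub>corner_ring R u\<^esub> y \<in> carrier (corner_ring R u)"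
      if "x \<in> carrier (corner_ring R u)" "y \<in> carrier (corner_ring R u)" for x y
      using that u by (simp flip: m_assoc)
  qed (use u in \<open>simp_all add: m_ac\<close>)
qed (auto simp: l_distr)

text \<open>For \<open>x = u x\<close> one has \<open>r x = (u r) x\<close>, so closure under
  multiplication by \<open>uR\<close> already gives closure under multiplication by
  \<open>R\<close>.\<close>

lemma corner_ideal_iff:
  assumes u: "u \<in> carrier R" "u \<otimes> u = u"
  shows "ideal K (corner_ring R u) \<longleftrightarrow> ideal K R \<and> (\<forall>y\<in>K. u \<otimes> y = y)"
proof
  interpret S: cring "corner_ring R u" by (rule corner_ring_cring[OF u])
  assume K: "ideal K (corner_ring R u)"
  note KD = S.ideal_props[OF K, simplified]
  have "r \<otimes> x \<in> K" if "r \<in> carrier R" "x \<in> K" for r x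
  proof -
    have x: "x \<in> carrier R" "u \<otimes> x = x" using KD(1) that by auto
    have "u \<otimes> (u \<otimes> r) = u \<otimes> r" using u \<open>r \<in> carrier R\<close> by (simp flip: m_assoc)
    then have "(u \<otimes> r) \<otimes> x \<in> K" using KD(6)[OF \<open>x \<in> K\<close>, of "u \<otimes> r"] u \<open>r \<in> carrier R\<close> by simp
    moreover have "(u \<otimes> r) \<otimes> x = r \<otimes> (u \<otimes> x)" using u x(1) \<open>r \<in> carrier R\<close> by (simp add: m_ac)
    ultimately show ?thesis using x(2) by simp
  qed
  then show "ideal K R \<and> (\<forall>y\<in>K. u \<otimes> y = y)"
    using KD by (auto intro: idealI')
next
  assume K: "ideal K R \<and> (\<forall>y\<in>K. u \<otimes> y = y)"
  note KD = ideal_props[OF conjunct1[OF K]]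
  show "ideal K (corner_ring R u)"
    by (rule cring.idealI'[OF corner_ring_cring[OF u]]) (use K KD in auto)
qed

text \<open>Each ideal has an element acting as the identity on it. For maximal ideals this is the
  condition of \<open>semisimple_moduleI\<close> with \<open>Z = 0\<close>. For a descending chain
  with such elements \<open>h n\<close>, the annihilators of the \<open>h n\<close> increase, and
  the identity element of their union shows where the chain stops.\<close>

lemma semisimple_artinian_corner:
  assumes u: "u \<in> carrier R" "u \<otimes> u = u" and ss: "semisimple_corner R u"
  shows "semisimple_artinian_ring (corner_ring R u)"
proof -
  let ?S = "corner_ring R u"
  interpret S: cring ?S by (rule corner_ring_cring[OF u])
  interpret Reg: module ?S "regular_module ?S" by (rule S.regular_module_module)
  have gen: "\<exists>h\<in>K. \<forall>y\<in>K. h \<otimes> y = y" if "ideal K ?S" for K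
    using that ss unfolding corner_ideal_iff[OF u] semisimple_corner_def by blast
  have "semisimple_module ?S (regular_module ?S)"
  proof (rule Reg.semisimple_moduleI[of "{\<zero>}"])
    show "ideal {\<zero>} ?S" using S.zeroideal by simp
    fix P assume "maximalideal P ?S" "{\<zero>} \<subseteq> P"
    then have P: "ideal P ?S" by (simp add: maximalideal_def)
    note PD = S.ideal_props[OF P]
    obtain h where h: "h \<in> P" "\<And>y. y \<in> P \<Longrightarrow> h \<otimes> y = y" using gen[OF P] by blast
    have "(\<one>\<^bsub>?S\<^esub> \<ominus>\<^bsub>?S\<^esub> h) \<otimes>\<^bsub>?S\<^esub> y = \<zero>\<^bsub>?S\<^esub>" if y: "y \<in> P" for y
    proof -
      have "(\<one>\<^bsub>?S\<^esub> \<ominus>\<^bsub>?S\<^esub> h) \<otimes>\<^bsub>?S\<^esub> y = y \<ominus>\<^bsub>?S\<^esub> h \<otimes>\<^bsub>?S\<^esub> y"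
        using PD(1)[OF y] PD(1)[OF h(1)] by algebra
      also have "\<dots> = y \<ominus>\<^bsub>?S\<^esub> y" using h(2)[OF y] by simp
      also have "\<dots> = \<zero>\<^bsub>?S\<^esub>" using PD(1)[OF y] by algebra
      finally show ?thesis .
    qed
    then show "\<exists>e\<in>P. \<forall>y\<in>P. (\<one>\<^bsub>?S\<^esub> \<ominus>\<^bsub>?S\<^esub> e) \<otimes>\<^bsub>?S\<^esub> y \<in> {\<zero>}" using h(1) by auto
  qed (use Reg.smult_l_null in auto)
  moreover have "artinian_ring ?S"
    unfolding artinian_ring_def
  proof (intro allI impI, elim conjE)
    fix I :: "nat \<Rightarrow> 'a set" assume I: "\<forall>n. ideal (I n) ?S" "\<forall>n. I (Suc n) \<subseteq> I n"
    have IR: "ideal (I n) R" "\<And>y. y \<in> I n \<Longrightarrow> u \<otimes> y = y" for n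
      using I(1) unfolding corner_ideal_iff[OF u] by auto
    have mono: "I n \<subseteq> I m" if "m \<le> n" for m n
      by (rule lift_Suc_antimono_le[of I]) (use that I(2) in \<open>simp_all add: that\<close>)
    define h where "h n = (SOME h. h \<in> I n \<and> (\<forall>y\<in>I n. h \<otimes> y = y))" for n
    have h_props: "h n \<in> I n \<and> (\<forall>y\<in>I n. h n \<otimes> y = y)" for n
      unfolding h_def by (rule someI_ex) (use gen[of "I n"] I(1) in blast)
    then have h: "\<And>n. h n \<in> I n" "\<And>n y. y \<in> I n \<Longrightarrow> h n \<otimes> y = y" by blast+
    have hR: "h n \<in> carrier R" for n using ideal_props(1)[OF IR(1) h(1)] .
    have hh: "h m \<otimes> h n = h n" if "m \<le> n" for m n using h mono[OF that] by blast
    \<comment> \<open>The union of the annihilators of the \<open>h n\<close> in \<open>uR\<close>.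
      Its identity element \<open>g\<close> is killed by some \<open>h n\<close>, and this
      \<open>n\<close> is the index sought.\<close>
    define L where "L = {y \<in> carrier R. u \<otimes> y = y \<and> (\<exists>n. h n \<otimes> y = \<zero>)}"
    have L0: "h n \<otimes> y = \<zero>" if "y \<in> carrier R" "h m \<otimes> y = \<zero>" "m \<le> n" for y m n
    proof -
      have "h n \<otimes> y = h n \<otimes> (h m \<otimes> y)"
        using hh[OF that(3)] that(1) hR m_comm[of "h m" "h n"] m_assoc[of "h n" "h m" y] by simp
      then show ?thesis using that(2) hR by simp
    qed
    have "ideal L R"
    proof (rule idealI')
      fix x y assume "x \<in> L" "y \<in> L"
      then obtain m n where mn: "x \<in> carrier R" "y \<in> carrier R" "u \<otimes> x = x" "u \<otimes> y = y"
        "h m \<otimes> x = \<zero>" "h n \<otimes> y = \<zero>" by (auto simp: L_def)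
      then have "h (max m n) \<otimes> (x \<oplus> y) = \<zero>" using L0[of x m "max m n"] L0[of y n "max m n"] hR
        by (simp add: r_distr)
      then show "x \<oplus> y \<in> L" using mn u(1) by (auto simp: L_def r_distr)
    next
      fix r x assume r: "r \<in> carrier R" and "x \<in> L"
      then obtain n where x: "x \<in> carrier R" "u \<otimes> x = x" "h n \<otimes> x = \<zero>" by (auto simp: L_def)
      then have "u \<otimes> (r \<otimes> x) = r \<otimes> x" "h n \<otimes> (r \<otimes> x) = \<zero>"
        using r u(1) hR by (simp_all add: m_lcomm)
      then show "r \<otimes> x \<in> L" using x r by (auto simp: L_def)
    qed (use u hR in \<open>auto simp: L_def\<close>)
    then have "ideal L ?S" unfolding corner_ideal_iff[OF u] by (simp add: L_def)
    then obtain g where g: "g \<in> L" "\<And>y. y \<in> L \<Longrightarrow> g \<otimes> y = y" using gen by blast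
    then obtain n where n: "g \<in> carrier R" "h n \<otimes> g = \<zero>" by (auto simp: L_def)
    have "I k = I n" if k: "k \<ge> n" for k
    proof
      show "I k \<subseteq> I n" using mono[OF k] .
      have "h k \<otimes> (h n \<ominus> h k) = h n \<otimes> h k \<ominus> h k \<otimes> h k" using hR[of n] hR[of k] by algebra
      then have "h k \<otimes> (h n \<ominus> h k) = \<zero>" using hh[OF k] hh[of k k] hR[of k] by (simp add: a_minus_def r_neg)
      moreover have "u \<otimes> (h n \<ominus> h k) = h n \<ominus> h k"
        using IR(2)[OF h(1)[of n]] IR(2)[OF h(1)[of k]] u(1) hR by (simp add: a_minus_def r_distr r_minus)
      ultimately have "h n \<ominus> h k \<in> L" using hR by (auto simp: L_def)
      \<comment> \<open>The difference lies in \<open>L\<close>, so it is fixed by \<open>g\<close>;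
        but \<open>g\<close> annihilates \<open>h n\<close> and therefore also
        \<open>h k = h n h k\<close>.\<close>
      then have "h n \<ominus> h k = g \<otimes> (h n \<ominus> h k)" using g(2) by simp
      also have "\<dots> = h n \<otimes> g \<ominus> g \<otimes> (h n \<otimes> h k)" using hh[OF k] hR[of n] hR[of k] n(1) by simp algebra
      also have "\<dots> = h n \<otimes> g \<ominus> (h n \<otimes> g) \<otimes> h k" using hR[of n] hR[of k] n(1) by algebra
      also have "\<dots> = \<zero>" using n(2) hR by (simp add: a_minus_def)
      finally have "h n = h k" using hR[of n] hR[of k] by simp
      then show "I n \<subseteq> I k"
        using h(2)[of _ n] ideal_props(7)[OF IR(1) h(1), of _ k] ideal_props(1)[OF IR(1)] by (metis subsetI)
    qed
    then show "\<exists>n. \<forall>k\<ge>n. I k = I n" by blast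
  qed
  ultimately show ?thesis by (simp add: semisimple_artinian_ring_def)
qed

lemma uniserial_corner_local:
  assumes e: "e \<in> carrier R" "e \<otimes> e = e" and z: "uniserial_corner R e z"
  shows "local_ring (corner_ring R e)"
    and "\<And>m. maximalideal m (corner_ring R e) \<Longrightarrow> minimal_ideal m (corner_ring R e)"
proof -
  let ?T = "corner_ring R e"
  interpret T: cring ?T by (rule corner_ring_cring[OF e])
  have zR: "z \<in> carrier R" "e \<otimes> z = z" "z \<noteq> \<zero>" and nonunit: "\<And>s. s \<in> carrier R \<Longrightarrow> z \<otimes> s \<noteq> e"
    and cases: "\<And>r. \<lbrakk>r \<in> carrier R; e \<otimes> r = r\<rbrakk> \<Longrightarrow> r = \<zero> \<or> (\<exists>s\<in>carrier R. r \<otimes> s = e) \<or>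
       (\<exists>s\<in>carrier R. r = z \<otimes> s) \<and> (\<exists>t\<in>carrier R. z = r \<otimes> t)"
    using z unfolding uniserial_corner_def by blast+
  define m where "m = PIdl z"
  have m_iff: "y \<in> m \<longleftrightarrow> (\<exists>s\<in>carrier R. y = z \<otimes> s)" for y
    using zR(1) m_comm unfolding m_def cgenideal_def by auto
  have mR: "ideal m R" unfolding m_def by (rule cgenideal_ideal[OF zR(1)])
  have mT: "ideal m ?T"
    unfolding corner_ideal_iff[OF e]
  proof (intro conjI ballI mR)
    fix y assume "y \<in> m"
    then obtain s where "s \<in> carrier R" "y = z \<otimes> s" by (auto simp: m_iff)
    then show "e \<otimes> y = y" using e(1) zR(1,2) by (simp flip: m_assoc)
  qed
  have em: "e \<notin> m" using nonunit by (auto simp: m_iff)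
  have unit: "J = carrier ?T" if J: "ideal J ?T" "y \<in> J" "s \<in> carrier R" "y \<otimes> s = e" for J y s
  proof -
    have "e \<in> J" using J ideal_props(7)[of J y s] unfolding corner_ideal_iff[OF e] by simp
    then show ?thesis using ideal.one_imp_carrier[OF J(1)] by simp
  qed
  have proper: "m \<noteq> carrier ?T" using em e by auto
  \<comment> \<open>Elements of a proper ideal are not units of \<open>eR\<close>, so
    \<open>cases\<close> leaves zero and the multiples of \<open>z\<close>.\<close>
  have below: "J \<subseteq> m" if J: "ideal J ?T" "J \<noteq> carrier ?T" for J
  proof
    fix y assume y: "y \<in> J"
    then have "y \<in> carrier R" "e \<otimes> y = y" using T.ideal_props(1)[OF J(1)] by auto
    then show "y \<in> m" using cases[of y] unit[OF J(1) y] J(2) ideal_props(2)[OF mR] by (auto simp: m_iff)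
  qed
  have max: "maximalideal m ?T"
  proof (rule maximalidealI[OF mT])
    show "carrier ?T \<noteq> m" using proper by simp
    show "J = m \<or> J = carrier ?T" if "ideal J ?T" "m \<subseteq> J" for J using below[OF that(1)] that(2) by blast
  qed
  have uniq: "P = m" if P: "maximalideal P ?T" for P
  proof -
    interpret P: maximalideal P ?T by (rule P)
    have "P \<subseteq> m" using below[OF P.is_ideal] P.I_notcarr by auto
    then show ?thesis using P.I_maximal[OF mT] proper T.ideal_props(1)[OF mT] by blast
  qed
  show "local_ring ?T" unfolding local_ring_def using max uniq by blast
  have zm: "z \<in> m" using zR(1) by (auto simp: m_iff intro!: bexI[of _ \<one>])
  have "minimal_ideal m ?T"
    unfolding minimal_ideal_def
  proof (intro conjI allI impI mT)
    show "m \<noteq> {\<zero>\<^bsub>?T\<^esub>}" using zm zR(3) by auto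
    fix J assume J: "ideal J ?T \<and> J \<subseteq> m"
    then have JR: "ideal J R" by (simp add: corner_ideal_iff[OF e])
    show "J = {\<zero>\<^bsub>?T\<^esub>} \<or> J = m"
    proof (cases "J \<subseteq> {\<zero>}")
      case False
      then obtain y where y: "y \<in> J" "y \<noteq> \<zero>" by blast
      then have yT: "y \<in> carrier R" "e \<otimes> y = y" using T.ideal_props(1)[of J y] J by auto
      have "y \<otimes> s \<noteq> e" if "s \<in> carrier R" for s
        using unit[of J y s] J y(1) that proper T.ideal_props(1)[OF mT] by blast
      then obtain t where "t \<in> carrier R" "z = y \<otimes> t" using cases[OF yT] y(2) by blast
      then have "z \<in> J" using ideal_props(7)[OF JR y(1)] by simp
      then have "m \<subseteq> J" using ideal_props(7)[OF JR] by (auto simp: m_iff)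
      then show ?thesis using J by blast
    qed (use ideal_props(2)[OF JR] in auto)
  qed
  then show "\<And>m. maximalideal m ?T \<Longrightarrow> minimal_ideal m ?T" using uniq by blast
qed

text \<open>The Peirce decomposition \<open>r = (1 - e) r + e r\<close>; adding the components is
  the inverse map.\<close>

lemma corner_decomposition:
  assumes e: "e \<in> carrier R" "e \<otimes> e = e"
  shows "R \<simeq> RDirProd (corner_ring R (\<one> \<ominus> e)) (corner_ring R e)"
    and "(\<one> \<ominus> e) \<otimes> (\<one> \<ominus> e) = \<one> \<ominus> e"
proof -
  define u where "u = \<one> \<ominus> e"
  have u: "u \<in> carrier R" using e by (simp add: u_def)
  have eu: "e \<otimes> u = \<zero>"
  proof -
    have "e \<otimes> u = e \<ominus> e \<otimes> e" using e(1) unfolding u_def by algebra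
    then show ?thesis using e by simp
  qed
  have uu: "u \<otimes> u = u"
  proof -
    have "u \<otimes> u = u \<ominus> e \<otimes> u" using e(1) unfolding u_def by algebra
    then show ?thesis using eu u by (simp add: a_minus_def)
  qed
  then show "(\<one> \<ominus> e) \<otimes> (\<one> \<ominus> e) = \<one> \<ominus> e" by (simp add: u_def)
  have sum: "u \<otimes> r \<oplus> e \<otimes> r = r" if "r \<in> carrier R" for r
    using that e(1) unfolding u_def by algebra
  have mult: "v \<otimes> (x \<otimes> y) = (v \<otimes> x) \<otimes> (v \<otimes> y)"
    if "v \<in> carrier R" "v \<otimes> v = v" "x \<in> carrier R" "y \<in> carrier R" for v x y
  proof -
    have "(v \<otimes> x) \<otimes> (v \<otimes> y) = (v \<otimes> v) \<otimes> (x \<otimes> y)" using that(1,3,4) by algebra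
    then show ?thesis using that(2) by simp
  qed
  have idem: "v \<otimes> (v \<otimes> x) = v \<otimes> x" if "v \<in> carrier R" "v \<otimes> v = v" "x \<in> carrier R" for v x
    using that by (simp flip: m_assoc)
  have "(\<lambda>r. (u \<otimes> r, e \<otimes> r)) \<in> ring_iso R (RDirProd (corner_ring R u) (corner_ring R e))"
    unfolding ring_iso_def mem_Collect_eq
  proof
    show "(\<lambda>r. (u \<otimes> r, e \<otimes> r)) \<in> ring_hom R (RDirProd (corner_ring R u) (corner_ring R e))"
      by (rule ring_hom_memI)
        (use e u uu in \<open>auto simp: RDirProd_simps r_distr idem intro: mult\<close>)
    show "bij_betw (\<lambda>r. (u \<otimes> r, e \<otimes> r)) (carrier R) (carrier (RDirProd (corner_ring R u) (corner_ring R e)))"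
    proof (rule bij_betw_byWitness[where f' = "\<lambda>(a, b). a \<oplus> b"])
      show "\<forall>r\<in>carrier R. (\<lambda>(a, b). a \<oplus> b) (u \<otimes> r, e \<otimes> r) = r" using sum by simp
      have ab0: "e \<otimes> a = \<zero>" "u \<otimes> b = \<zero>"
        if "a \<in> carrier R" "u \<otimes> a = a" "b \<in> carrier R" "e \<otimes> b = b" for a b
      proof -
        have ue: "u \<otimes> e = \<zero>" using eu e u m_comm by simp
        show "e \<otimes> a = \<zero>" using m_assoc[of e u a] eu e u that(1,2) by simp
        show "u \<otimes> b = \<zero>" using m_assoc[of u e b] ue e u that(3,4) by simp
      qed
      show "\<forall>p\<in>carrier (RDirProd (corner_ring R u) (corner_ring R e)).
          (u \<otimes> (\<lambda>(a, b). a \<oplus> b) p, e \<otimes> (\<lambda>(a, b). a \<oplus> b) p) = p"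
      proof
        fix p assume "p \<in> carrier (RDirProd (corner_ring R u) (corner_ring R e))"
        then obtain a b where ab: "p = (a, b)" "a \<in> carrier R" "u \<otimes> a = a" "b \<in> carrier R" "e \<otimes> b = b"
          by (auto simp: RDirProd_simps)
        then show "(u \<otimes> (\<lambda>(a, b). a \<oplus> b) p, e \<otimes> (\<lambda>(a, b). a \<oplus> b) p) = p"
          using ab0[OF ab(2-5)] e(1) u by (simp add: r_distr)
      qed
    qed (use e u uu idem in \<open>auto simp: RDirProd_simps\<close>)
  qed
  then show "R \<simeq> RDirProd (corner_ring R (\<one> \<ominus> e)) (corner_ring R e)"
    unfolding is_ring_iso_def u_def by blast
qed

section \<open>From a ring decomposition back to an idempotent\<close>

text \<open>Let \<open>1 = k + l\<close> with \<open>l\<close> in a complement \<open>L\<close> of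
  \<open>K\<close>. Then \<open>l\<close> multiplies \<open>K\<close> into
  \<open>K \<inter> L\<close>, which is zero, so \<open>k\<close> is the identity on
  \<open>K\<close>.\<close>

lemma semisimple_regular_ideal:
  assumes ss: "semisimple_module R (regular_module R)" and K: "ideal K R"
  obtains h where "h \<in> K" "\<And>y. y \<in> K \<Longrightarrow> h \<otimes> y = y"
proof -
  interpret Reg: module R "regular_module R" by (rule regular_module_module)
  have "submodule K R (regular_module R)" using K by (simp add: submodule_regular_iff)
  from Reg.semisimple_imp_complemented[OF ss, unfolded complemented_module_def, rule_format, OF this]
  obtain L where L: "ideal L R" "K \<inter> L = {\<zero>}" "\<And>x. x \<in> carrier R \<Longrightarrow> \<exists>k\<in>K. \<exists>l\<in>L. x = k \<oplus> l"
    by (auto simp: submodule_regular_iff)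
  obtain k l where kl: "k \<in> K" "l \<in> L" "\<one> = k \<oplus> l" using L(3)[OF one_closed] by blast
  have cl: "k \<in> carrier R" "l \<in> carrier R" using ideal_props(1)[OF K kl(1)] ideal_props(1)[OF L(1) kl(2)] by auto
  have "k \<otimes> y = y" if y: "y \<in> K" for y
  proof -
    have yR: "y \<in> carrier R" using ideal_props(1)[OF K y] .
    have "l \<otimes> y \<in> K \<inter> L" using ideal_props(6)[OF K y cl(2)] ideal_props(7)[OF L(1) kl(2) yR] by simp
    then have "l \<otimes> y = \<zero>" using L(2) by blast
    moreover have "y = (k \<oplus> l) \<otimes> y" using yR by (simp flip: kl(3))
    ultimately show ?thesis using cl yR by (simp add: l_distr)
  qed
  then show ?thesis using that kl(1) by blast
qed

text \<open>The shape of \<open>uniserial_corner\<close> for \<open>e = 1\<close>. A nonunit lies in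
  some maximal ideal, hence in the only one, \<open>m\<close>; and \<open>m\<close>, being minimal,
  is generated by each of its nonzero elements, so any of them serves as \<open>z\<close>.\<close>

lemma local_ring_cases:
  assumes loc: "local_ring R" and min: "\<And>m. maximalideal m R \<Longrightarrow> minimal_ideal m R"
  obtains z where "z \<in> carrier R" "z \<noteq> \<zero>" "\<forall>s\<in>carrier R. z \<otimes> s \<noteq> \<one>"
    "\<forall>t\<in>carrier R. t = \<zero> \<or> (\<exists>s\<in>carrier R. t \<otimes> s = \<one>) \<or>
       (\<exists>s\<in>carrier R. t = z \<otimes> s) \<and> (\<exists>s\<in>carrier R. z = t \<otimes> s)"
proof -
  obtain m where m: "maximalideal m R" "\<And>P. maximalideal P R \<Longrightarrow> P = m"
    using loc unfolding local_ring_def by blast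
  interpret m: maximalideal m R by (rule m(1))
  have mmin: "m \<noteq> {\<zero>}" "\<And>J. \<lbrakk>ideal J R; J \<subseteq> m\<rbrakk> \<Longrightarrow> J = {\<zero>} \<or> J = m"
    using min[OF m(1)] by (auto simp: minimal_ideal_def)
  note mD = ideal_props[OF m.is_ideal]
  obtain z where z: "z \<in> m" "z \<noteq> \<zero>" using mmin(1) mD(2) by blast
  have one: "\<one> \<notin> m" using m.I_notcarr m.one_imp_carrier by auto
  have gen: "PIdl y = m" if y: "y \<in> m" "y \<noteq> \<zero>" for y
  proof -
    have yR: "y \<in> carrier R" using mD(1) y by simp
    have "PIdl y \<subseteq> m" using mD(6)[OF y(1)] by (auto simp: cgenideal_def)
    moreover have "PIdl y \<noteq> {\<zero>}" using cgenideal_self[OF yR] y(2) by blast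
    ultimately show ?thesis using mmin(2)[OF cgenideal_ideal[OF yR]] by blast
  qed
  have div: "\<exists>s\<in>carrier R. x = y \<otimes> s" if "x \<in> m" "y \<in> m" "y \<noteq> \<zero>" for x y
  proof -
    have "x \<in> PIdl y" using gen[OF that(2,3)] that(1) by simp
    then obtain s where "s \<in> carrier R" "x = s \<otimes> y" by (auto simp: cgenideal_def)
    then show ?thesis using m_comm[of s y] mD(1)[OF \<open>y \<in> m\<close>] by auto
  qed
  show ?thesis
  proof (rule that; (intro ballI)?)
    show "z \<in> carrier R" "z \<noteq> \<zero>" using z mD(1) by auto
    show "z \<otimes> s \<noteq> \<one>" if "s \<in> carrier R" for s using mD(7)[OF z(1) that] one by auto
    fix t assume t: "t \<in> carrier R"
    show "t = \<zero> \<or> (\<exists>s\<in>carrier R. t \<otimes> s = \<one>) \<or> (\<exists>s\<in>carrier R. t = z \<otimes> s) \<and> (\<exists>s\<in>carrier R. z = t \<otimes> s)"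
    proof (cases "\<one> \<in> PIdl t")
      case True
      then show ?thesis using t m_comm by (auto simp: cgenideal_def)
    next
      case False
      then obtain P where "maximalideal P R" "PIdl t \<subseteq> P"
        using exists_maximalideal[OF cgenideal_ideal[OF t]] by blast
      then have "t \<in> m" using m(2) cgenideal_self[OF t] by blast
      then show ?thesis using div z by blast
    qed
  qed
qed

text \<open>\<open>a\<close> and \<open>b\<close> embed the two factors into \<open>R\<close>
  without preserving the identity: the identities go to the idempotents \<open>1 - e\<close> and
  \<open>e\<close>. The properties of the factors are carried over along these embeddings.\<close>

lemma decomposition_nearly_semisimple:
  assumes S: "cring S" and T: "cring T" and iso: "R \<simeq> RDirProd S T"
    and ss: "semisimple_artinian_ring S"
    and T': "carrier T = {\<zero>\<^bsub>T\<^esub>} \<or> local_ring T \<and> (\<forall>m. maximalideal m T \<longrightarrow> minimal_ideal m T)"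
  shows "nearly_semisimple R"
proof -
  interpret S: cring S by (rule S)
  interpret T: cring T by (rule T)
  obtain \<phi> where \<phi>: "\<phi> \<in> ring_iso R (RDirProd S T)" using iso by (auto simp: is_ring_iso_def)
  define \<psi> where "\<psi> = inv_into (carrier R) \<phi>"
  have \<psi>: "\<psi> \<in> ring_iso (RDirProd S T) R"
    unfolding \<psi>_def by (rule ring_iso_set_sym[OF ring_axioms \<phi>])
  note \<psi>D = ring_iso_memE[OF \<psi>]
  have \<psi>0: "\<psi> (\<zero>\<^bsub>S\<^esub>, \<zero>\<^bsub>T\<^esub>) = \<zero>"
  proof -
    have "\<psi> (\<zero>\<^bsub>S\<^esub>, \<zero>\<^bsub>T\<^esub>) = \<psi> (\<zero>\<^bsub>S\<^esub>, \<zero>\<^bsub>T\<^esub>) \<oplus> \<psi> (\<zero>\<^bsub>S\<^esub>, \<zero>\<^bsub>T\<^esub>)"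
      using \<psi>D(3)[of "(\<zero>\<^bsub>S\<^esub>, \<zero>\<^bsub>T\<^esub>)" "(\<zero>\<^bsub>S\<^esub>, \<zero>\<^bsub>T\<^esub>)"] by (simp add: RDirProd_simps)
    then show ?thesis using \<psi>D(1)[of "(\<zero>\<^bsub>S\<^esub>, \<zero>\<^bsub>T\<^esub>)"] by (simp add: RDirProd_simps)
  qed
  define a where "a s = \<psi> (s, \<zero>\<^bsub>T\<^esub>)" for s
  define b where "b t = \<psi> (\<zero>\<^bsub>S\<^esub>, t)" for t
  have aR: "a s \<in> carrier R" if "s \<in> carrier S" for s using that \<psi>D(1) by (simp add: a_def RDirProd_simps)
  have bR: "b t \<in> carrier R" if "t \<in> carrier T" for t using that \<psi>D(1) by (simp add: b_def RDirProd_simps)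
  have am: "a s \<otimes> a s' = a (s \<otimes>\<^bsub>S\<^esub> s')" if "s \<in> carrier S" "s' \<in> carrier S" for s s'
    using that \<psi>D(2)[of "(s, \<zero>\<^bsub>T\<^esub>)" "(s', \<zero>\<^bsub>T\<^esub>)"] by (simp add: a_def RDirProd_simps)
  have bm: "b t \<otimes> b t' = b (t \<otimes>\<^bsub>T\<^esub> t')" if "t \<in> carrier T" "t' \<in> carrier T" for t t'
    using that \<psi>D(2)[of "(\<zero>\<^bsub>S\<^esub>, t)" "(\<zero>\<^bsub>S\<^esub>, t')"] by (simp add: b_def RDirProd_simps)
  have ab0: "a s \<otimes> b t = \<zero>" if "s \<in> carrier S" "t \<in> carrier T" for s t
    using that \<psi>D(2)[of "(s, \<zero>\<^bsub>T\<^esub>)" "(\<zero>\<^bsub>S\<^esub>, t)"] by (simp add: a_def b_def RDirProd_simps \<psi>0)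
  have aa: "a s \<oplus> a s' = a (s \<oplus>\<^bsub>S\<^esub> s')" if "s \<in> carrier S" "s' \<in> carrier S" for s s'
    using that \<psi>D(3)[of "(s, \<zero>\<^bsub>T\<^esub>)" "(s', \<zero>\<^bsub>T\<^esub>)"] by (simp add: a_def RDirProd_simps)
  have split: "\<exists>s\<in>carrier S. \<exists>t\<in>carrier T. r = a s \<oplus> b t" if "r \<in> carrier R" for r
  proof -
    have "r \<in> \<psi> ` carrier (RDirProd S T)" using that \<psi>D(5) by (simp add: bij_betw_def)
    then obtain s t where "s \<in> carrier S" "t \<in> carrier T" "r = \<psi> (s, t)" by (auto simp: RDirProd_simps)
    moreover from this have "r = a s \<oplus> b t"
      using \<psi>D(3)[of "(s, \<zero>\<^bsub>T\<^esub>)" "(\<zero>\<^bsub>S\<^esub>, t)"] by (simp add: a_def b_def RDirProd_simps)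
    ultimately show ?thesis by blast
  qed
  have b_inj: "t = t'" if "t \<in> carrier T" "t' \<in> carrier T" "b t = b t'" for t t'
    using that \<psi>D(5) by (auto simp: bij_betw_def inj_on_def b_def RDirProd_simps)
  have one: "\<one> = a \<one>\<^bsub>S\<^esub> \<oplus> b \<one>\<^bsub>T\<^esub>"
    using \<psi>D(4) \<psi>D(3)[of "(\<one>\<^bsub>S\<^esub>, \<zero>\<^bsub>T\<^esub>)" "(\<zero>\<^bsub>S\<^esub>, \<one>\<^bsub>T\<^esub>)"] by (simp add: a_def b_def RDirProd_simps)
  define e where "e = b \<one>\<^bsub>T\<^esub>"
  have e: "e \<in> carrier R" "e \<otimes> e = e" using bR bm by (auto simp: e_def)
  have u: "\<one> \<ominus> e = a \<one>\<^bsub>S\<^esub>"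
  proof -
    have "(a \<one>\<^bsub>S\<^esub> \<oplus> e) \<ominus> e = a \<one>\<^bsub>S\<^esub>" using e(1) aR[OF S.one_closed] by algebra
    then show ?thesis by (simp add: one e_def)
  qed
  have "semisimple_corner R (a \<one>\<^bsub>S\<^esub>)"
    unfolding semisimple_corner_def
  proof (intro allI impI, elim conjE)
    fix K assume K: "ideal K R" "\<forall>y\<in>K. a \<one>\<^bsub>S\<^esub> \<otimes> y = y"
    note KD = ideal_props[OF K(1)]
    define K' where "K' = {s \<in> carrier S. a s \<in> K}"
    have "ideal K' S"
    proof (rule S.idealI')
      show "\<zero>\<^bsub>S\<^esub> \<in> K'" using KD(2) \<psi>0 by (simp add: K'_def a_def)
      show "x \<oplus>\<^bsub>S\<^esub> y \<in> K'" if "x \<in> K'" "y \<in> K'" for x y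
        using that KD(3)[of "a x" "a y"] aa by (simp add: K'_def)
      show "r \<otimes>\<^bsub>S\<^esub> x \<in> K'" if "r \<in> carrier S" "x \<in> K'" for r x
        using that KD(6)[of "a x" "a r"] am aR by (simp add: K'_def)
    qed (simp add: K'_def)
    then obtain h where h: "h \<in> K'" "\<And>s. s \<in> K' \<Longrightarrow> h \<otimes>\<^bsub>S\<^esub> s = s"
      using S.semisimple_regular_ideal ss unfolding semisimple_artinian_ring_def by metis
    have "a h \<otimes> y = y" if y: "y \<in> K" for y
    proof -
      obtain s t where st: "s \<in> carrier S" "t \<in> carrier T" "y = a s \<oplus> b t" using split[OF KD(1)[OF y]] by blast
      \<comment> \<open>Elements of \<open>K\<close> are fixed by \<open>a 1\<close>, which removes
        the component from \<open>T\<close>; so \<open>K\<close> lies in the image of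
        \<open>a\<close>, and its preimage in \<open>S\<close> determines it.\<close>
      have "y = a \<one>\<^bsub>S\<^esub> \<otimes> (a s \<oplus> b t)" using K(2) y st(3) by simp
      also have "\<dots> = a s" using st aR bR am ab0 by (simp add: r_distr)
      finally have "y = a s" .
      then show ?thesis using y h(1) h(2)[of s] st(1) am by (simp add: K'_def)
    qed
    then show "\<exists>h\<in>K. \<forall>y\<in>K. h \<otimes> y = y" using h(1) by (auto simp: K'_def)
  qed
  moreover have "e = \<zero> \<or> (\<exists>z. uniserial_corner R e z)"
    using T'
  proof
    assume "carrier T = {\<zero>\<^bsub>T\<^esub>}"
    then have "\<one>\<^bsub>T\<^esub> = \<zero>\<^bsub>T\<^esub>" using T.one_closed by blast
    then show ?thesis using \<psi>0 by (simp add: e_def b_def)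
  next
    assume "local_ring T \<and> (\<forall>m. maximalideal m T \<longrightarrow> minimal_ideal m T)"
    then have loc: "local_ring T" and mini: "\<And>m. maximalideal m T \<Longrightarrow> minimal_ideal m T"
      by blast+
    obtain z where z: "z \<in> carrier T" "z \<noteq> \<zero>\<^bsub>T\<^esub>" "\<forall>s\<in>carrier T. z \<otimes>\<^bsub>T\<^esub> s \<noteq> \<one>\<^bsub>T\<^esub>"
      and cases: "\<forall>t\<in>carrier T. t = \<zero>\<^bsub>T\<^esub> \<or> (\<exists>s\<in>carrier T. t \<otimes>\<^bsub>T\<^esub> s = \<one>\<^bsub>T\<^esub>) \<or>
        (\<exists>s\<in>carrier T. t = z \<otimes>\<^bsub>T\<^esub> s) \<and> (\<exists>s\<in>carrier T. z = t \<otimes>\<^bsub>T\<^esub> s)"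
      using T.local_ring_cases[OF loc mini] .
    \<comment> \<open>Multiplying by an element of the image of \<open>b\<close> ignores the
      component from \<open>S\<close>, so that equations with factors from all of \<open>R\<close>
      become equations in \<open>T\<close>.\<close>
    have bt: "b t \<otimes> (a s \<oplus> b t') = b (t \<otimes>\<^bsub>T\<^esub> t')" if "t \<in> carrier T" "t' \<in> carrier T" "s \<in> carrier S" for t t' s
    proof -
      have "b t \<otimes> a s = \<zero>" using ab0[OF that(3,1)] that aR bR m_comm by simp
      then show ?thesis using that aR bR bm by (simp add: r_distr)
    qed
    have "uniserial_corner R e (b z)"
      unfolding uniserial_corner_def
    proof (intro conjI ballI impI)
      show "b z \<in> carrier R" using bR z(1) .
      show "e \<otimes> b z = b z" using bm z(1) by (simp add: e_def)
      show "b z \<noteq> \<zero>" using b_inj[OF z(1) T.zero_closed] z(2) \<psi>0 by (auto simp: b_def)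
      show "b z \<otimes> r \<noteq> e" if r: "r \<in> carrier R" for r
      proof -
        obtain s t where st: "s \<in> carrier S" "t \<in> carrier T" "r = a s \<oplus> b t" using split[OF r] by blast
        then show ?thesis using bt[OF z(1) st(2,1)] b_inj[of "z \<otimes>\<^bsub>T\<^esub> t" "\<one>\<^bsub>T\<^esub>"] z(1) bspec[OF z(3) st(2)]
          by (auto simp: e_def)
      qed
      fix r assume r: "r \<in> carrier R" "e \<otimes> r = r"
      obtain s t where st: "s \<in> carrier S" "t \<in> carrier T" "r = a s \<oplus> b t" using split[OF r(1)] by blast
      have rt: "r = b t" using r(2) bt[OF T.one_closed st(2,1)] st by (simp add: e_def)
      from bspec[OF cases st(2)]
      show "r = \<zero> \<or> (\<exists>s\<in>carrier R. r \<otimes> s = e) \<or>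
        (\<exists>s\<in>carrier R. r = b z \<otimes> s) \<and> (\<exists>t\<in>carrier R. b z = r \<otimes> t)"
      proof (elim disjE conjE)
        assume "t = \<zero>\<^bsub>T\<^esub>"
        then show ?thesis using rt \<psi>0 by (simp add: b_def)
      next
        assume "\<exists>s\<in>carrier T. t \<otimes>\<^bsub>T\<^esub> s = \<one>\<^bsub>T\<^esub>"
        then obtain s where s: "s \<in> carrier T" "t \<otimes>\<^bsub>T\<^esub> s = \<one>\<^bsub>T\<^esub>" by blast
        then have "r \<otimes> b s = e" using bm[OF st(2) s(1)] rt by (simp add: e_def)
        then show ?thesis using bR[OF s(1)] by blast
      next
        assume "\<exists>s\<in>carrier T. t = z \<otimes>\<^bsub>T\<^esub> s" "\<exists>s\<in>carrier T. z = t \<otimes>\<^bsub>T\<^esub> s"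
        then obtain s s' where s: "s \<in> carrier T" "t = z \<otimes>\<^bsub>T\<^esub> s" "s' \<in> carrier T" "z = t \<otimes>\<^bsub>T\<^esub> s'" by blast
        have "r = b z \<otimes> b s" using bm[OF z(1) s(1)] rt s(2) by simp
        moreover have "b z = r \<otimes> b s'" using bm[OF st(2) s(3)] rt s(4) by simp
        ultimately show ?thesis using bR s(1,3) by blast
      qed
    qed
    then show ?thesis by blast
  qed
  ultimately show ?thesis unfolding nearly_semisimple_def using e u by auto
qed

end

theorem theorem4p3:
  fixes R :: "('a, 'c) ring_scheme"
  assumes "cring R"
    and "large_universe TYPE('m) R"
  shows "no_middle_class TYPE('m) R \<longleftrightarrow>
    (\<exists>(S :: 'a ring) (T :: 'a ring).
       cring S \<and> cring T \<and> R \<simeq> RDirProd S T \<and>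
       semisimple_artinian_ring S \<and>
       (carrier T = {\<zero>\<^bsub>T\<^esub>} \<or>
        (local_ring T \<and> (\<forall>m. maximalideal m T \<longrightarrow> minimal_ideal m T))))"
proof
  interpret R: cring R by fact
  assume "no_middle_class TYPE('m) R"
  then interpret no_middle_class_ring R "TYPE('m)"
    using assms(2) by unfold_locales
  obtain e where e: "e \<in> carrier R" "e \<otimes>\<^bsub>R\<^esub> e = e" "semisimple_corner R (\<one>\<^bsub>R\<^esub> \<ominus>\<^bsub>R\<^esub> e)"
    and z: "e = \<zero>\<^bsub>R\<^esub> \<or> (\<exists>z. uniserial_corner R e z)"
    using nearly_semisimple unfolding nearly_semisimple_def by blast
  let ?u = "\<one>\<^bsub>R\<^esub> \<ominus>\<^bsub>R\<^esub> e"
  have u: "?u \<in> carrier R" "?u \<otimes>\<^bsub>R\<^esub> ?u = ?u"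
    using e R.corner_decomposition(2)[OF e(1,2)] by auto
  have "carrier (corner_ring R e) = {\<zero>\<^bsub>corner_ring R e\<^esub>} \<or>
      local_ring (corner_ring R e) \<and>
      (\<forall>m. maximalideal m (corner_ring R e) \<longrightarrow> minimal_ideal m (corner_ring R e))"
    using z
  proof
    assume "e = \<zero>\<^bsub>R\<^esub>"
    then show ?thesis by auto
  next
    assume "\<exists>z. uniserial_corner R e z"
    then show ?thesis using R.uniserial_corner_local[OF e(1,2)] by blast
  qed
  then show "\<exists>(S :: 'a ring) (T :: 'a ring).
       cring S \<and> cring T \<and> R \<simeq> RDirProd S T \<and>
       semisimple_artinian_ring S \<and>
       (carrier T = {\<zero>\<^bsub>T\<^esub>} \<or>
        (local_ring T \<and> (\<forall>m. maximalideal m T \<longrightarrow> minimal_ideal m T)))"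
    using R.corner_ring_cring[OF u] R.corner_ring_cring[OF e(1,2)] R.corner_decomposition(1)[OF e(1,2)]
      R.semisimple_artinian_corner[OF u e(3)]
    by blast
next
  assume "\<exists>(S :: 'a ring) (T :: 'a ring).
       cring S \<and> cring T \<and> R \<simeq> RDirProd S T \<and>
       semisimple_artinian_ring S \<and>
       (carrier T = {\<zero>\<^bsub>T\<^esub>} \<or>
        (local_ring T \<and> (\<forall>m. maximalideal m T \<longrightarrow> minimal_ideal m T)))"
  then have "nearly_semisimple R" using cring.decomposition_nearly_semisimple[OF assms(1)] by blast
  then show "no_middle_class TYPE('m) R" by (rule nearly_semisimple_no_middle_class)
qed

end
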